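(* Let $a>b>0$, $\lambda\ne0$, $p=\sqrt{a^2+b^2}$, $r=\sqrt{a^2-b^2}$. For the Kowalevski gyrostat in two constant fields, the set $\mathfrak C_1=\{\zeta\in P^6:\operatorname{rank}J(\zeta)=1\}$ is completely defined by the condition $\operatorname{rank}\{dK,dH\}=1$ and consists of the points of the following periodic trajectories: 1) the pendulum motions (for either choice of the sign, the same throughout) $$\boldsymbol\omega=\dot\varphi\,\mathbf e_3,\quad \boldsymbol\alpha\times\boldsymbol\beta\equiv\pm ab\,\mathbf e_3,\quad \boldsymbol\alpha=a(\mathbf e_1\cos\varphi-\mathbf e_2\sin\varphi),\quad \boldsymbol\beta=\pm b(\mathbf e_1\sin\varphi+\mathbf e_2\cos\varphi),\quad \ddot\varphi=-(a\pm b)\sin\varphi;$$ 2) the motions defined by the equations $$w_1=q(w)\sqrt w,\quad w_2=\frac{\sqrt w}{q(w)},\quad w_3=\frac{\lambda}{\sigma}w,$$ $$x_1=\frac{1}{\sigma u}\big[r^2\lambda^2\sigma^2-(\lambda^2+\sigma)\,u\,q^2(w)\,w\big],\qquad x_2=\frac{1}{\sigma u}\Big[r^2\lambda^2\sigma^2-(\lambda^2+\sigma)\,u\,\frac{w}{q^2(w)}\Big],$$ $$y_1=\sigma\Big(1+\frac{\sigma}{\lambda^2}-\frac{r^4\lambda^2\sigma}{u^2}\Big)+\frac{r^2\lambda^2}{u}q^2(w)\,w,\qquad y_2=\sigma\Big(1+\frac{\sigma}{\lambda^2}-\frac{r^4\lambda^2\sigma}{u^2}\Big)+\frac{r^2\lambda^2}{u}\frac{w}{q^2(w)},$$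 $$z_1=-\frac{r^2\lambda\sigma}{u}\frac{\sqrt w}{q(w)}+\frac{\lambda^2+\sigma}{\lambda}q(w)\sqrt w,\qquad z_2=-\frac{r^2\lambda\sigma}{u}q(w)\sqrt w+\frac{\lambda^2+\sigma}{\lambda}\frac{\sqrt w}{q(w)}.$$ Here $q(w)$ is the root of the equation $q^4-2Q(w)q^2+1=0$, where $$Q(w)=\frac{\sigma u^3+(\lambda^2+\sigma)[\lambda^2w^2+\sigma^2(2w-\sigma)]u^2+r^4\lambda^4\sigma^4}{2r^2\lambda^2\sigma^2(\lambda^2+\sigma)\,u\,w};$$ $\sigma,u$ are constants satisfying the equation $$\lambda^2(\lambda^2+\sigma)^2u^5+(\lambda^2+\sigma)[2p^2\lambda^4-(\lambda^2+\sigma)^3\sigma]\sigma u^4+r^4\lambda^6\sigma^2u^3+2r^4\lambda^4\sigma^4(\lambda^2+\sigma)^2u^2-r^8\lambda^8\sigma^6=0.$$ The evolution $w(t)$ is defined by the equation $$\Big(\frac{dw}{dt}\Big)^2=-\frac{\lambda^2}{4\sigma^2}P_+(w)P_-(w),$$ where $$P_\pm(w)=w^2+2\sigma^2\frac{u\pm r^2\lambda^2}{\lambda^2u}w+\frac{\sigma[u^3-(\lambda^2+\sigma)\sigma^2u^2+r^4\lambda^4\sigma^3]}{(\lambda^2+\sigma)\lambda^2u^2}.$$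
   Context: Phase space. Fix real $a>b>0$ and $\lambda\ne0$. $P^6=\{(\boldsymbol\omega,\boldsymbol\alpha,\boldsymbol\beta)\in\mathbb R^3\times\mathbb R^3\times\mathbb R^3:\ \boldsymbol\alpha\cdot\boldsymbol\alpha=a^2,\ \boldsymbol\beta\cdot\boldsymbol\beta=b^2,\ \boldsymbol\alpha\cdot\boldsymbol\beta=0\}$, a smooth 6-dimensional manifold; $\mathbf e_1,\mathbf e_2,\mathbf e_3$ is the canonical basis of $\mathbb R^3$. Equations of motion on $P^6$: $2\dot\omega_1=\omega_2(\omega_3-\lambda)+\beta_3$, $2\dot\omega_2=-\omega_1(\omega_3-\lambda)-\alpha_3$, $\dot\omega_3=\alpha_2-\beta_1$, $\dot{\boldsymbol\alpha}=\boldsymbol\alpha\times\boldsymbol\omega$, $\dot{\boldsymbol\beta}=\boldsymbol\beta\times\boldsymbol\omega$. First integrals. With $\mathbf M=(2\omega_1,2\omega_2,\omega_3+\lambda)$, $M_\alpha=\mathbf M\cdot\boldsymbol\alpha$, $M_\beta=\mathbf M\cdot\boldsymbol\beta$, $M_\gamma=\mathbf M\cdot(\boldsymbol\alpha\times\boldsymbol\beta)$, put $$H=\omega_1^2+\omega_2^2+\tfrac12\omega_3^2-\alpha_1-\beta_2,$$ $$K=(\omega_1^2-\omega_2^2+\alpha_1-\beta_2)^2+(2\omega_1\omega_2+\alpha_2+\beta_1)^2+2\lambda[(\omega_3-\lambda)(\omega_1^2+\omega_2^2)+2\omega_1\alpha_3+2\omega_2\beta_3],$$ $$G=\tfrac14(M_\alpha^2+M_\beta^2)+\tfrac12(\omega_3-\lambda)M_\gamma-b^2\alpha_1-a^2\beta_2.$$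 The momentum map is $J=(G,K,H):P^6\to\mathbb R^3$; $\operatorname{rank}J(\zeta)$ is the rank at $\zeta$ of the differential of $J$, and $dK,dH$ denote differentials restricted to the tangent space of $P^6$. Complex coordinates ($i^2=-1$): $x_1=(\alpha_1-\beta_2)+i(\alpha_2+\beta_1)$, $x_2=(\alpha_1-\beta_2)-i(\alpha_2+\beta_1)$, $y_1=(\alpha_1+\beta_2)+i(\alpha_2-\beta_1)$, $y_2=(\alpha_1+\beta_2)-i(\alpha_2-\beta_1)$, $z_1=\alpha_3+i\beta_3$, $z_2=\alpha_3-i\beta_3$, $w_1=\omega_1+i\omega_2$, $w_2=\omega_1-i\omega_2$, $w_3=\omega_3$. (In part 2, $w=w_1w_2$.)
   Formalization: Trajectories are taken non-constant (rest positions have rank 0); "periodic" becomes "periodic or homoclinic to an equilibrium", since separatrices lie in the set; at σ = −λ², where Q and P± read 0/0, they take their limit values along the (σ,u) curve. *)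

theory Defs
  imports "HOL-Analysis.Analysis"
begin

unbundle cross3_syntax

text \<open>A state \<open>(\<omega>, \<alpha>, \<beta>)\<close>: angular velocity and the two constant fields in the body frame.\<close>

type_synonym state = "(real^3) \<times> (real^3) \<times> (real^3)"

abbreviation e1 :: "real^3" where "e1 \<equiv> axis 1 1"
abbreviation e2 :: "real^3" where "e2 \<equiv> axis 2 1"
abbreviation e3 :: "real^3" where "e3 \<equiv> axis 3 1"

definition P6 :: "real \<Rightarrow> real \<Rightarrow> state set" where
  "P6 a b = {(\<omega>, \<alpha>, \<beta>). \<alpha> \<bullet> \<alpha> = a^2 \<and> \<beta> \<bullet> \<beta> = b^2 \<and> \<alpha> \<bullet> \<beta> = 0}"

definition constraints :: "state \<Rightarrow> real \<times> real \<times> real" where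
  "constraints = (\<lambda>(\<omega>, \<alpha>, \<beta>). (\<alpha> \<bullet> \<alpha>, \<beta> \<bullet> \<beta>, \<alpha> \<bullet> \<beta>))"

text \<open>For \<open>a, b > 0\<close> the set \<open>P6 a b\<close> is a regular level set of \<open>constraints\<close>, so its tangent space
  at a point is the kernel of the derivative.\<close>

definition tangent :: "state \<Rightarrow> state set" where
  "tangent \<zeta> = {v. frechet_derivative constraints (at \<zeta>) v = 0}"


section \<open>Equations of motion and first integrals\<close>

definition gyro_field :: "real \<Rightarrow> state \<Rightarrow> state" where
  "gyro_field lam = (\<lambda>(\<omega>, \<alpha>, \<beta>).
     (vector [(\<omega>$2 * (\<omega>$3 - lam) + \<beta>$3) / 2,
              (- \<omega>$1 * (\<omega>$3 - lam) - \<alpha>$3) / 2,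
              \<alpha>$2 - \<beta>$1],
      \<alpha> \<times> \<omega>,
      \<beta> \<times> \<omega>))"

definition motion :: "real \<Rightarrow> real \<Rightarrow> real \<Rightarrow> (real \<Rightarrow> state) \<Rightarrow> bool" where
  "motion a b lam \<gamma> \<longleftrightarrow>
     (\<forall>t. \<gamma> t \<in> P6 a b \<and> (\<gamma> has_vector_derivative gyro_field lam (\<gamma> t)) (at t))"

definition Hfun :: "state \<Rightarrow> real" where
  "Hfun = (\<lambda>(\<omega>, \<alpha>, \<beta>). (\<omega>$1)^2 + (\<omega>$2)^2 + (\<omega>$3)^2 / 2 - \<alpha>$1 - \<beta>$2)"

definition Kfun :: "real \<Rightarrow> state \<Rightarrow> real" where
  "Kfun lam = (\<lambda>(\<omega>, \<alpha>, \<beta>).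
     ((\<omega>$1)^2 - (\<omega>$2)^2 + \<alpha>$1 - \<beta>$2)^2 + (2 * \<omega>$1 * \<omega>$2 + \<alpha>$2 + \<beta>$1)^2
     + 2 * lam * ((\<omega>$3 - lam) * ((\<omega>$1)^2 + (\<omega>$2)^2) + 2 * \<omega>$1 * \<alpha>$3 + 2 * \<omega>$2 * \<beta>$3))"

definition Gfun :: "real \<Rightarrow> real \<Rightarrow> real \<Rightarrow> state \<Rightarrow> real" where
  "Gfun a b lam = (\<lambda>(\<omega>, \<alpha>, \<beta>).
     let M = vector [2 * \<omega>$1, 2 * \<omega>$2, \<omega>$3 + lam] :: real^3 in
       ((M \<bullet> \<alpha>)^2 + (M \<bullet> \<beta>)^2) / 4 + (\<omega>$3 - lam) * (M \<bullet> (\<alpha> \<times> \<beta>)) / 2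
       - b^2 * \<alpha>$1 - a^2 * \<beta>$2)"

definition Jmap :: "real \<Rightarrow> real \<Rightarrow> real \<Rightarrow> state \<Rightarrow> real \<times> real \<times> real" where
  "Jmap a b lam \<zeta> = (Gfun a b lam \<zeta>, Kfun lam \<zeta>, Hfun \<zeta>)"

definition rank_J :: "real \<Rightarrow> real \<Rightarrow> real \<Rightarrow> state \<Rightarrow> nat" where
  "rank_J a b lam \<zeta> = dim (frechet_derivative (Jmap a b lam) (at \<zeta>) ` tangent \<zeta>)"

text \<open>The rank of a finite system \<open>F\<close> of linear functionals restricted to a subspace \<open>T\<close>: the
  largest number of members that are linearly independent as functionals on \<open>T\<close>.\<close>

definition independent_on :: "'v set \<Rightarrow> ('v \<Rightarrow> real) set \<Rightarrow> bool" where
  "independent_on T S \<longleftrightarrow>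
     (\<forall>c. (\<forall>v\<in>T. (\<Sum>f\<in>S. c f * f v) = 0) \<longrightarrow> (\<forall>f\<in>S. c f = 0))"

definition rank_on :: "'v set \<Rightarrow> ('v \<Rightarrow> real) set \<Rightarrow> nat" where
  "rank_on T F = Max {card S | S. S \<subseteq> F \<and> independent_on T S}"

definition rank_KH :: "real \<Rightarrow> state \<Rightarrow> nat" where
  "rank_KH lam \<zeta> = rank_on (tangent \<zeta>)
     {frechet_derivative (Kfun lam) (at \<zeta>), frechet_derivative Hfun (at \<zeta>)}"

definition critical_set_1 :: "real \<Rightarrow> real \<Rightarrow> real \<Rightarrow> state set" where
  "critical_set_1 a b lam = {\<zeta> \<in> P6 a b. rank_J a b lam \<zeta> = 1}"


section \<open>Pendulum motions\<close>

definition pendulum_motion :: "real \<Rightarrow> real \<Rightarrow> real \<Rightarrow> (real \<Rightarrow> state) \<Rightarrow> bool" where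
  "pendulum_motion a b lam \<gamma> \<longleftrightarrow> motion a b lam \<gamma> \<and>
     (\<exists>s\<in>{1, -1}. \<exists>\<phi> \<phi>' :: real \<Rightarrow> real. \<forall>t.
        (\<phi> has_real_derivative \<phi>' t) (at t) \<and>
        (\<phi>' has_real_derivative - (a + s * b) * sin (\<phi> t)) (at t) \<and>
        (case \<gamma> t of (\<omega>, \<alpha>, \<beta>) \<Rightarrow>
           \<omega> = \<phi>' t *\<^sub>R e3 \<and>
           \<alpha> \<times> \<beta> = (s * (a * b)) *\<^sub>R e3 \<and>
           \<alpha> = a *\<^sub>R (cos (\<phi> t) *\<^sub>R e1 - sin (\<phi> t) *\<^sub>R e2) \<and>
           \<beta> = (s * b) *\<^sub>R (sin (\<phi> t) *\<^sub>R e1 + cos (\<phi> t) *\<^sub>R e2)))"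


section \<open>Complex coordinates\<close>

definition x1 :: "state \<Rightarrow> complex" where
  "x1 = (\<lambda>(\<omega>, \<alpha>, \<beta>). Complex (\<alpha>$1 - \<beta>$2) (\<alpha>$2 + \<beta>$1))"
definition x2 :: "state \<Rightarrow> complex" where
  "x2 = (\<lambda>(\<omega>, \<alpha>, \<beta>). Complex (\<alpha>$1 - \<beta>$2) (- (\<alpha>$2 + \<beta>$1)))"
definition y1 :: "state \<Rightarrow> complex" where
  "y1 = (\<lambda>(\<omega>, \<alpha>, \<beta>). Complex (\<alpha>$1 + \<beta>$2) (\<alpha>$2 - \<beta>$1))"
definition y2 :: "state \<Rightarrow> complex" where
  "y2 = (\<lambda>(\<omega>, \<alpha>, \<beta>). Complex (\<alpha>$1 + \<beta>$2) (- (\<alpha>$2 - \<beta>$1)))"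
definition z1 :: "state \<Rightarrow> complex" where
  "z1 = (\<lambda>(\<omega>, \<alpha>, \<beta>). Complex (\<alpha>$3) (\<beta>$3))"
definition z2 :: "state \<Rightarrow> complex" where
  "z2 = (\<lambda>(\<omega>, \<alpha>, \<beta>). Complex (\<alpha>$3) (- \<beta>$3))"
definition w1 :: "state \<Rightarrow> complex" where
  "w1 = (\<lambda>(\<omega>, \<alpha>, \<beta>). Complex (\<omega>$1) (\<omega>$2))"
definition w2 :: "state \<Rightarrow> complex" where
  "w2 = (\<lambda>(\<omega>, \<alpha>, \<beta>). Complex (\<omega>$1) (- \<omega>$2))"
definition w3 :: "state \<Rightarrow> real" where
  "w3 = (\<lambda>(\<omega>, \<alpha>, \<beta>). \<omega>$3)"

text \<open>The product \<open>w1 w2\<close> is real: the two factors are conjugate.\<close>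

definition ww :: "state \<Rightarrow> real" where
  "ww \<zeta> = Re (w1 \<zeta> * w2 \<zeta>)"


section \<open>The second family of motions\<close>

definition pp :: "real \<Rightarrow> real \<Rightarrow> real" where "pp a b = sqrt (a^2 + b^2)"
definition rr :: "real \<Rightarrow> real \<Rightarrow> real" where "rr a b = sqrt (a^2 - b^2)"

definition on_curve :: "real \<Rightarrow> real \<Rightarrow> real \<Rightarrow> real \<Rightarrow> real \<Rightarrow> bool" where
  "on_curve a b lam \<sigma> u \<longleftrightarrow>
     (let p = pp a b; r = rr a b in
       lam^2 * (lam^2 + \<sigma>)^2 * u^5
       + (lam^2 + \<sigma>) * (2 * p^2 * lam^4 - (lam^2 + \<sigma>)^3 * \<sigma>) * \<sigma> * u^4
       + r^4 * lam^6 * \<sigma>^2 * u^3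
       + 2 * r^4 * lam^4 * \<sigma>^4 * (lam^2 + \<sigma>)^2 * u^2
       - r^8 * lam^8 * \<sigma>^6 = 0)"

text \<open>At \<open>\<sigma> = -\<lambda>\<^sup>2\<close> the curve \<open>on_curve\<close> forces \<open>u\<^sup>3 = r\<^sup>4 \<lambda>\<^sup>1\<^sup>0\<close>, and the quotients in
  \<open>const_coeff\<close> (the constant term of both polynomials \<open>Ppm\<close>) and \<open>Qfun\<close> read \<open>0/0\<close>.
  The singularity is removable along the curve, which is smooth and parametrized by \<open>\<sigma>\<close> near
  that point; the values given for \<open>\<lambda>\<^sup>2 + \<sigma> = 0\<close> are the limits along it. They follow by
  substituting for \<open>(u\<^sup>3 - r\<^sup>4 \<lambda>\<^sup>2 \<sigma>\<^sup>4) / (\<lambda>\<^sup>2 + \<sigma>)\<close> from the curve equation divided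
  by \<open>\<lambda>\<^sup>2 + \<sigma>\<close>.\<close>

definition const_coeff :: "real \<Rightarrow> real \<Rightarrow> real \<Rightarrow> real \<Rightarrow> real \<Rightarrow> real" where
  "const_coeff a b lam \<sigma> u =
     (let p = pp a b; r = rr a b in
       if lam^2 + \<sigma> \<noteq> 0
       then \<sigma> * (u^3 - (lam^2 + \<sigma>) * \<sigma>^2 * u^2 + r^4 * lam^4 * \<sigma>^3)
              / ((lam^2 + \<sigma>) * lam^2 * u^2)
       else lam^4 + r^4 * lam^8 / u^2 - 2 * p^2 * u^2 / (r^4 * lam^4))"

definition Ppm :: "real \<Rightarrow> real \<Rightarrow> real \<Rightarrow> real \<Rightarrow> real \<Rightarrow> real \<Rightarrow> real \<Rightarrow> real" where
  "Ppm s a b lam \<sigma> u w =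
     w^2 + 2 * \<sigma>^2 * ((u + s * (rr a b)^2 * lam^2) / (lam^2 * u)) * w + const_coeff a b lam \<sigma> u"

definition Qfun :: "real \<Rightarrow> real \<Rightarrow> real \<Rightarrow> real \<Rightarrow> real \<Rightarrow> real \<Rightarrow> real" where
  "Qfun a b lam \<sigma> u w =
     (let r = rr a b in
       if lam^2 + \<sigma> \<noteq> 0
       then (\<sigma> * u^3 + (lam^2 + \<sigma>) * (lam^2 * w^2 + \<sigma>^2 * (2 * w - \<sigma>)) * u^2
               + r^4 * lam^4 * \<sigma>^4)
              / (2 * r^2 * lam^2 * \<sigma>^2 * (lam^2 + \<sigma>) * u * w)
       else u * (w^2 + 2 * lam^2 * w + const_coeff a b lam \<sigma> u) / (2 * r^2 * lam^4 * w))"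

text \<open>The phase-space equations at one point of a trajectory; \<open>q\<close> is a value of the (multivalued)
  root \<open>q(w)\<close>. A single trajectory passes between the roots \<open>\<plusminus>q\<close>, \<open>\<plusminus>1/q\<close>
  at the turning points of \<open>w\<close>, so \<open>q\<close> cannot be a function of \<open>w\<close> on it.\<close>

definition special_point ::
  "real \<Rightarrow> real \<Rightarrow> real \<Rightarrow> real \<Rightarrow> real \<Rightarrow> complex \<Rightarrow> state \<Rightarrow> bool" where
  "special_point a b lam \<sigma> u q \<zeta> \<longleftrightarrow>
     (let r = complex_of_real (rr a b); l = complex_of_real lam;
          S = complex_of_real \<sigma>; U = complex_of_real u;
          w = complex_of_real (ww \<zeta>); sw = complex_of_real (sqrt (ww \<zeta>)) in
       ww \<zeta> > 0 \<and>
       q^4 - 2 * complex_of_real (Qfun a b lam \<sigma> u (ww \<zeta>)) * q^2 + 1 = 0 \<and>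
       w1 \<zeta> = q * sw \<and>
       w2 \<zeta> = sw / q \<and>
       w3 \<zeta> = lam / \<sigma> * ww \<zeta> \<and>
       x1 \<zeta> = 1 / (S * U) * (r^2 * l^2 * S^2 - (l^2 + S) * U * q^2 * w) \<and>
       x2 \<zeta> = 1 / (S * U) * (r^2 * l^2 * S^2 - (l^2 + S) * U * (w / q^2)) \<and>
       y1 \<zeta> = S * (1 + S / l^2 - r^4 * l^2 * S / U^2) + r^2 * l^2 / U * q^2 * w \<and>
       y2 \<zeta> = S * (1 + S / l^2 - r^4 * l^2 * S / U^2) + r^2 * l^2 / U * (w / q^2) \<and>
       z1 \<zeta> = - (r^2 * l * S / U) * (sw / q) + (l^2 + S) / l * q * sw \<and>
       z2 \<zeta> = - (r^2 * l * S / U) * q * sw + (l^2 + S) / l * (sw / q))"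

definition special_motion :: "real \<Rightarrow> real \<Rightarrow> real \<Rightarrow> (real \<Rightarrow> state) \<Rightarrow> bool" where
  "special_motion a b lam \<gamma> \<longleftrightarrow> motion a b lam \<gamma> \<and>
     (\<exists>\<sigma> u. \<sigma> \<noteq> 0 \<and> u \<noteq> 0 \<and> on_curve a b lam \<sigma> u \<and>
        (\<forall>t. (\<exists>q. special_point a b lam \<sigma> u q (\<gamma> t)) \<and>
             (deriv (\<lambda>s. ww (\<gamma> s)) t)^2
               = - (lam^2 / (4 * \<sigma>^2)) * Ppm 1 a b lam \<sigma> u (ww (\<gamma> t))
                   * Ppm (- 1) a b lam \<sigma> u (ww (\<gamma> t))))"


section \<open>Periodicity\<close>

definition periodic :: "(real \<Rightarrow> state) \<Rightarrow> bool" where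
  "periodic \<gamma> \<longleftrightarrow> (\<exists>T>0. \<forall>t. \<gamma> (t + T) = \<gamma> t)"

text \<open>Separatrices: motions tending to one and the same equilibrium as \<open>t\<close> tends to plus and to
  minus infinity. The pendulum in its unstable upper position has them.\<close>

definition separatrix :: "real \<Rightarrow> (real \<Rightarrow> state) \<Rightarrow> bool" where
  "separatrix lam \<gamma> \<longleftrightarrow>
     (\<exists>\<epsilon>. gyro_field lam \<epsilon> = 0 \<and> (\<gamma> \<longlongrightarrow> \<epsilon>) at_top \<and> (\<gamma> \<longlongrightarrow> \<epsilon>) at_bot)"

end

theory Submission
  imports Defs
begin

text \<open>Call a point critical if \<open>dK\<close> is proportional to \<open>dH\<close> on the tangent space and \<open>dH \<noteq> 0\<close> there.
The form \<open>dH\<close> vanishes on the tangent space exactly at the equilibria, and at an equilibrium \<open>dK\<close> and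
\<open>dG\<close> vanish as well. Hence \<open>rank {dK, dH} = 1\<close> says that the point is critical, and \<open>rank J = 1\<close>
says that in addition \<open>dG\<close> is proportional to \<open>dH\<close>. The theorem follows once the critical points are
known explicitly, because \<open>dG\<close> turns out to be proportional to \<open>dH\<close> at each of them.\<close>

text \<open>Tangent vectors are arbitrary changes of \<open>\<omega>\<close> combined with infinitesimal rotations of the frame
\<open>(\<alpha>, \<beta>)\<close>, so \<open>dK = 2 \<mu> dH\<close> amounts to six polynomial equations
(\<open>dK_proportional_dH_iff\<close>). If \<open>\<omega>\<^sub>1 = \<omega>\<^sub>2 = 0\<close>, they force \<open>\<alpha>\<^sub>3 = \<beta>\<^sub>3 = 0\<close>,
which is the position of a pendulum. Otherwise \<open>\<mu> = \<sigma>\<close> is nonzero, and in the complex coordinates the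
equations express \<open>w\<^sub>3, z\<^sub>1, y\<^sub>1\<close> through \<open>w\<^sub>1\<close> and the one complex number
\<open>\<rho> = x\<^sub>1 + (1 + \<lambda>\<^sup>2/\<sigma>) w\<^sub>1\<^sup>2\<close>. The constraint \<open>z\<^sub>1\<^sup>2 + x\<^sub>1 y\<^sub>2 = r\<^sup>2\<close> then becomes
\<open>\<rho> B = r\<^sup>2\<close> with a real factor \<open>B\<close>; therefore \<open>\<rho>\<close> is real and nonzero, and the point belongs to
the family \<open>special_state\<close> (\<open>special_state_if_critical\<close>). This family is polynomial in the parameters
\<open>n = \<sigma>/\<lambda>\<close>, \<open>R = \<rho>/\<lambda>\<close> and in \<open>(p, q) = (\<omega>\<^sub>1, \<omega>\<^sub>2)/n\<close>; the constants of the statement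
are \<open>\<sigma> = \<lambda> n\<close> and \<open>u = r\<^sup>2 \<lambda>\<^sup>2 n / R\<close>, and the curve equation for \<open>(\<sigma>, u)\<close> is what remains of
the constraints after eliminating \<open>(p, q)\<close>. Polynomial identities give \<open>dK \<sim> dH\<close> and \<open>dG \<sim> dH\<close> on the
whole family (\<open>special_state_dK\<close>, \<open>special_state_dG\<close>).\<close>

text \<open>For fixed \<open>n\<close> and \<open>R\<close> the family is invariant: the equations of motion restrict to a cubic planar
system for \<open>(p, q)\<close> with a first integral whose level sets are bounded (\<open>special_state_flow\<close>), so
solutions exist for all times and every critical point lies on a motion of the required form. The
pendulum is the planar system \<open>\<phi>' = \<psi>, \<psi>' = - (a \<plusminus> b) sin \<phi>\<close>.\<close>

text \<open>Both planar systems are reversible: time reversal at a moment when \<open>p q = 0\<close>, respectively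
\<open>sin \<phi> = 0\<close>, acts on the state as a reflection. Two such moments give two reflections whose composition
is a shift of time, and the motion is periodic. If there is at most one such moment, then \<open>p\<^sup>2 + q\<^sup>2\<close>,
respectively \<open>\<psi>\<close>, is monotone near \<open>\<plusminus>\<infinity>\<close>; the motion converges at both ends, its limits are equilibria,
and the conserved quantities determine the equilibrium. This is the separatrix case.\<close>

section \<open>Ordinary differential equations on the whole time axis\<close>

lemma antiderivative_on_real_line:
  fixes g :: "real \<Rightarrow> 'a::banach"
  assumes "continuous_on UNIV g"
  shows "\<exists>G. G 0 = 0 \<and> (\<forall>t. (G has_vector_derivative g t) (at t))"
proof -
  define G where "G t = integral {0..t} g - integral {t..0} g" for t
  have int: "g integrable_on {c..d}" for c d
    by (intro integrable_continuous_real continuous_on_subset[OF assms]) auto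
  have "(G has_vector_derivative g t) (at t)" for t
  proof -
    define N where "N = \<bar>t\<bar> + 1"
    have shift: "G s = integral {-N..s} g - integral {-N..0} g" if "s \<in> {-N..N}" for s
    proof (cases "0 \<le> s")
      case True
      then have "integral {-N..0} g + integral {0..s} g = integral {-N..s} g"
        using that by (intro Henstock_Kurzweil_Integration.integral_combine int) (auto simp: N_def)
      moreover have "integral {s..0} g = 0"
        using True by (cases "s = 0") auto
      ultimately show ?thesis by (simp add: G_def algebra_simps)
    next
      case False
      then have "integral {-N..s} g + integral {s..0} g = integral {-N..0} g"
        using that by (intro Henstock_Kurzweil_Integration.integral_combine int) (auto simp: N_def)
      then show ?thesis using False by (simp add: G_def algebra_simps)
    qed
    have "((\<lambda>s. integral {-N..s} g) has_vector_derivative g t) (at t within {-N..N})"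
      by (intro integral_has_vector_derivative continuous_on_subset[OF assms]) (auto simp: N_def)
    then have "((\<lambda>s. integral {-N..s} g) has_vector_derivative g t) (at t)"
      by (subst (asm) at_within_interior) (auto simp: N_def)
    then have "((\<lambda>s. integral {-N..s} g - integral {-N..0} g) has_vector_derivative g t) (at t)"
      by (auto intro!: derivative_eq_intros)
    then show ?thesis
      by (rule has_vector_derivative_transform_within_open[where S="{-N<..<N}"])
         (auto simp: N_def shift)
  qed
  moreover have "G 0 = 0" by (simp add: G_def)
  ultimately show ?thesis by blast
qed

text \<open>Integrating an exponential bound gains the factor \<open>1/k\<close>; this makes the Picard operator a contraction
in the norm with weight \<open>exp (- k \<bar>t\<bar>)\<close>.\<close>

lemma exponential_bound_antiderivative:
  fixes G :: "real \<Rightarrow> 'a::real_normed_vector"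
  assumes "G 0 = 0" and G: "\<And>t. (G has_vector_derivative g t) (at t)"
    and k: "k > 0" and C: "C \<ge> 0" and bound: "\<And>s. norm (g s) \<le> C * exp (k * \<bar>s\<bar>)"
  shows "norm (G t) \<le> C / k * exp (k * \<bar>t\<bar>)"
proof -
  have forward: "norm (F t) \<le> C / k * exp (k * t)"
    if "F 0 = 0" "\<And>t. (F has_vector_derivative f t) (at t)"
      "\<And>s. norm (f s) \<le> C * exp (k * \<bar>s\<bar>)" "t \<ge> 0" for F :: "real \<Rightarrow> 'a" and f t
  proof (cases "t = 0")
    case True
    then show ?thesis using that k C by simp
  next
    case False
    have "norm (F t - F 0) \<le> C / k * exp (k * t) - C / k * exp (k * 0)"
    proof (rule differentiable_bound_general)
      show "0 < t" using False that by simp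
      show "continuous_on {0..t} F"
        by (meson continuous_at_imp_continuous_on has_vector_derivative_continuous that(2))
      show "((\<lambda>s. C / k * exp (k * s)) has_vector_derivative C * exp (k * s)) (at s)" for s
        using k by (auto intro!: derivative_eq_intros
            simp: has_real_derivative_iff_has_vector_derivative[symmetric])
      show "norm (f s) \<le> C * exp (k * s)" if "0 < s" for s
        using \<open>\<And>s. norm (f s) \<le> C * exp (k * \<bar>s\<bar>)\<close>[of s] that by simp
    qed (use k in \<open>auto intro!: continuous_intros that\<close>)
    moreover have "C / k * exp (k * 0) \<ge> 0" using k C by simp
    ultimately show ?thesis using \<open>F 0 = 0\<close> by simp
  qed
  show ?thesis
  proof (cases "t \<ge> 0")
    case True
    then show ?thesis using forward[OF assms(1) G bound] by simp
  next
    case False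
    have "((\<lambda>s. G (- s)) has_vector_derivative - g (- s)) (at s)" for s
    proof -
      have "(uminus has_vector_derivative -1) (at s)"
        by (auto intro!: derivative_eq_intros)
      from vector_diff_chain_at[OF this, of G "g (- s)"] G[of "- s"] show ?thesis
        by (simp add: o_def)
    qed
    moreover have "norm (- g (- s)) \<le> C * exp (k * \<bar>s\<bar>)" for s
      using bound[of "- s"] by simp
    ultimately have "norm (G (- (- t))) \<le> C / k * exp (k * - t)"
      using assms(1) False by (intro forward[of "\<lambda>s. G (- s)" "\<lambda>s. - g (- s)" "- t"]) auto
    then show ?thesis using False by simp
  qed
qed

text \<open>The Picard operator acts on functions of growth \<open>exp (k \<bar>t\<bar>)\<close>, represented as
\<open>exp (k \<bar>t\<bar>) y t\<close> with bounded continuous \<open>y\<close>. In the sup norm of \<open>y\<close> it contracts by \<open>L/k\<close>, so its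
fixed point is a solution on the whole line, without continuation of local solutions.\<close>

lemma lipschitz_ode_global_solution:
  fixes f :: "'a::euclidean_space \<Rightarrow> 'a"
  assumes lip: "L-lipschitz_on UNIV f"
  shows "\<exists>x. x 0 = x0 \<and> (\<forall>t. (x has_vector_derivative f (x t)) (at t))"
proof -
  \<comment> \<open>Any \<open>k > 0\<close> with \<open>L / k \<le> 1/2\<close> works.\<close>
  define k where "k = 2 * L + 2"
  have L0: "L \<ge> 0" using lip by (rule lipschitz_on_nonneg)
  have k: "k > 0" using L0 by (simp add: k_def)
  have fL: "norm (f y - f z) \<le> L * norm (y - z)" for y z
    using lipschitz_onD[OF lip, of y z] by (simp add: dist_norm)
  have fcont: "continuous_on UNIV f" using lip by (rule lipschitz_on_continuous_on)
  define h where "h y s = f (exp (k * \<bar>s\<bar>) *\<^sub>R apply_bcontfun y s)" for y :: "real \<Rightarrow>\<^sub>C 'a" and s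
  have hcont: "continuous_on UNIV (h y)" for y
    unfolding h_def by (intro continuous_on_compose2[OF fcont] continuous_intros) auto
  \<comment> \<open>The primitive of \<open>s \<mapsto> f (x s)\<close> that vanishes at \<open>0\<close>.\<close>
  define P where "P y = (SOME G. G 0 = 0 \<and> (\<forall>t. (G has_vector_derivative h y t) (at t)))" for y
  have P: "P y 0 = 0 \<and> (\<forall>t. (P y has_vector_derivative h y t) (at t))" for y
    unfolding P_def by (rule someI_ex[OF antiderivative_on_real_line[OF hcont[of y]]])
  define \<Phi> where "\<Phi> y t = exp (- k * \<bar>t\<bar>) *\<^sub>R (x0 + P y t)" for y t
  have cancel: "exp (- k * \<bar>t\<bar>) * exp (k * \<bar>t\<bar>) = 1" for t
    by (simp flip: exp_add)
  have bc: "\<Phi> y \<in> bcontfun" for y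
  proof (rule bcontfun_normI)
    have "continuous_on UNIV (P y)"
      using P[of y] by (meson continuous_at_imp_continuous_on has_vector_derivative_continuous)
    then show "continuous_on UNIV (\<Phi> y)"
      unfolding \<Phi>_def by (intro continuous_intros)
    define C where "C = norm (f 0) + L * norm y"
    have C: "C \<ge> 0" using L0 by (simp add: C_def)
    have "norm (h y s) \<le> C * exp (k * \<bar>s\<bar>)" for s
    proof -
      have "norm (h y s) \<le> norm (f 0) + norm (h y s - f 0)"
        by (metis add.commute diff_add_cancel norm_triangle_ineq)
      also have "norm (h y s - f 0) \<le> L * (exp (k * \<bar>s\<bar>) * norm (apply_bcontfun y s))"
        unfolding h_def using fL[of "exp (k * \<bar>s\<bar>) *\<^sub>R apply_bcontfun y s" 0] by simp
      also have "\<dots> \<le> L * (exp (k * \<bar>s\<bar>) * norm y)"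
        using norm_bounded[of y s] L0 by (intro mult_left_mono) auto
      also have "norm (f 0) \<le> norm (f 0) * exp (k * \<bar>s\<bar>)"
        using k by (simp add: mult_le_cancel_left1)
      finally show ?thesis by (simp add: C_def algebra_simps)
    qed
    then have PC: "norm (P y t) \<le> C / k * exp (k * \<bar>t\<bar>)" for t
      using exponential_bound_antiderivative[of "P y" "h y" k C t] P[of y] k C by auto
    show "norm (\<Phi> y t) \<le> norm x0 + C / k" for t
    proof -
      have "norm (\<Phi> y t) \<le> exp (- k * \<bar>t\<bar>) * (norm x0 + C / k * exp (k * \<bar>t\<bar>))"
        unfolding \<Phi>_def using PC[of t] norm_triangle_ineq[of x0 "P y t"] by simp
      also have "\<dots> = exp (- k * \<bar>t\<bar>) * norm x0 + C / k"
        using cancel[of t] by (simp add: algebra_simps)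
      also have "exp (- k * \<bar>t\<bar>) * norm x0 \<le> norm x0"
        using k by (simp add: mult_left_le_one_le)
      finally show ?thesis by simp
    qed
  qed
  define \<Psi> where "\<Psi> y = Bcontfun (\<Phi> y)" for y
  have \<Psi>: "apply_bcontfun (\<Psi> y) = \<Phi> y" for y
    unfolding \<Psi>_def using bc by (simp add: Bcontfun_inverse)
  have "\<exists>!y. \<Psi> y = y"
  proof (rule banach_fix_type)
    show "0 \<le> (1/2::real)" "(1/2::real) < 1" by auto
    show "\<forall>y z. dist (\<Psi> y) (\<Psi> z) \<le> 1/2 * dist y z"
    proof (intro allI dist_bound)
      fix y z t
      have D: "((\<lambda>t. P y t - P z t) has_vector_derivative h y t - h z t) (at t)" for t
        using P[of y] P[of z] by (auto intro!: derivative_eq_intros)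
      have B: "norm (h y s - h z s) \<le> (L * dist y z) * exp (k * \<bar>s\<bar>)" for s
      proof -
        have "norm (h y s - h z s) \<le> L * (exp (k * \<bar>s\<bar>) * norm (apply_bcontfun y s - apply_bcontfun z s))"
          unfolding h_def using fL by (metis abs_exp_cancel norm_scaleR scaleR_diff_right)
        also have "\<dots> \<le> L * (exp (k * \<bar>s\<bar>) * dist y z)"
          using dist_bounded[of y s z] L0 by (intro mult_left_mono) (auto simp: dist_norm)
        finally show ?thesis by (simp add: algebra_simps)
      qed
      have "norm (P y t - P z t) \<le> (L * dist y z) / k * exp (k * \<bar>t\<bar>)"
        using exponential_bound_antiderivative[OF _ D k _ B] P[of y] P[of z] L0 by simp
      then have "dist (\<Phi> y t) (\<Phi> z t) \<le> exp (- k * \<bar>t\<bar>) * ((L * dist y z) / k * exp (k * \<bar>t\<bar>))"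
        unfolding \<Phi>_def dist_norm
        by (simp flip: scaleR_diff_right del: times_divide_eq_left times_divide_eq_right)
      also have "\<dots> = L / k * dist y z" using cancel[of t] by (simp add: algebra_simps)
      also have "\<dots> \<le> 1/2 * dist y z"
        using L0 by (intro mult_right_mono) (auto simp: k_def divide_simps)
      finally show "dist (apply_bcontfun (\<Psi> y) t) (apply_bcontfun (\<Psi> z) t) \<le> 1/2 * dist y z"
        by (simp add: \<Psi>)
    qed
  qed
  then obtain y where y: "\<Psi> y = y" by blast
  define x where "x t = x0 + P y t" for t
  have "exp (k * \<bar>t\<bar>) *\<^sub>R apply_bcontfun y t = x t" for t
  proof -
    have "apply_bcontfun y t = exp (- k * \<bar>t\<bar>) *\<^sub>R x t"
      using fun_cong[OF \<Psi>[of y], of t] by (simp add: y \<Phi>_def x_def)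
    then show ?thesis using cancel[of t] by (simp add: mult.commute)
  qed
  then have "h y t = f (x t)" for t by (simp add: h_def)
  then have "(x has_vector_derivative f (x t)) (at t)" for t
    unfolding x_def using P[of y] by (auto intro!: derivative_eq_intros)
  moreover have "x 0 = x0" using P[of y] by (simp add: x_def)
  ultimately show ?thesis by blast
qed

text \<open>Gronwall's argument: on a bounded time interval both solutions stay in a ball on which \<open>f\<close> has a
Lipschitz constant \<open>L\<close>, so \<open>exp (- 2 L t) \<bar>x - y\<bar>\<^sup>2\<close> cannot increase.\<close>

lemma ode_unique_forward:
  fixes f :: "'a::euclidean_space \<Rightarrow> 'a"
  assumes lip: "\<And>r. \<exists>L. L-lipschitz_on (cball 0 r) f"
    and x: "\<And>t. (x has_vector_derivative f (x t)) (at t)"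
    and y: "\<And>t. (y has_vector_derivative f (y t)) (at t)"
    and eq: "x t0 = y t0" and "t0 \<le> t1"
  shows "x t1 = y t1"
proof -
  have "continuous_on {t0..t1} x" "continuous_on {t0..t1} y"
    using x y by (meson continuous_at_imp_continuous_on has_vector_derivative_continuous)+
  then have "bounded (x ` {t0..t1} \<union> y ` {t0..t1})"
    by (simp add: compact_imp_bounded compact_continuous_image)
  then obtain r where r: "\<And>t. t \<in> {t0..t1} \<Longrightarrow> x t \<in> cball 0 r \<and> y t \<in> cball 0 r"
    unfolding bounded_iff by (metis Un_iff imageI mem_cball_0)
  obtain L where L: "L-lipschitz_on (cball 0 r) f" using lip by blast
  define g where "g t = (x t - y t) \<bullet> (x t - y t)" for t
  define h where "h t = exp (- 2 * L * t) * g t" for t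
  have h': "(h has_real_derivative exp (- 2 * L * t) * (2 * ((x t - y t) \<bullet> (f (x t) - f (y t))) - 2 * L * g t)) (at t)" for t
  proof -
    have d: "((\<lambda>t. x t - y t) has_vector_derivative f (x t) - f (y t)) (at t)"
      using x y by (auto intro!: derivative_eq_intros)
    have "(g has_vector_derivative 2 * ((x t - y t) \<bullet> (f (x t) - f (y t)))) (at t)"
      unfolding g_def has_vector_derivative_def
      by (rule derivative_eq_intros d[unfolded has_vector_derivative_def] refl)+
         (auto simp: inner_commute algebra_simps)
    then have "(g has_real_derivative 2 * ((x t - y t) \<bullet> (f (x t) - f (y t)))) (at t)"
      by (simp add: has_real_derivative_iff_has_vector_derivative)
    then show ?thesis unfolding h_def
      by (auto intro!: derivative_eq_intros simp: algebra_simps)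
  qed
  have "h t1 \<le> h t0"
  proof (rule DERIV_nonpos_imp_nonincreasing[OF \<open>t0 \<le> t1\<close>])
    fix t assume t: "t0 \<le> t" "t \<le> t1"
    have "(x t - y t) \<bullet> (f (x t) - f (y t)) \<le> norm (x t - y t) * norm (f (x t) - f (y t))"
      by (rule norm_cauchy_schwarz)
    also have "\<dots> \<le> norm (x t - y t) * (L * norm (x t - y t))"
      using lipschitz_on_normD[OF L] r[of t] t by (intro mult_left_mono) auto
    also have "\<dots> = L * g t"
      by (simp add: g_def power2_norm_eq_inner[symmetric] power2_eq_square)
    finally show "\<exists>d. (h has_real_derivative d) (at t) \<and> d \<le> 0"
      by (intro exI[of _ "exp (- 2 * L * t) * (2 * ((x t - y t) \<bullet> (f (x t) - f (y t))) - 2 * L * g t)"] conjI h')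
         (simp add: mult_nonneg_nonpos)
  qed
  then have "g t1 \<le> 0" using eq by (simp add: h_def g_def mult_le_0_iff)
  then show ?thesis by (simp add: g_def flip: power2_norm_eq_inner)
qed

lemma time_reversed_solution:
  assumes "\<And>t. (x has_vector_derivative f (x t)) (at t)"
  shows "((\<lambda>t. x (c - t)) has_vector_derivative - f (x (c - t))) (at t)"
proof -
  have "(((\<lambda>t. c - t)) has_vector_derivative -1) (at t)"
    by (auto intro!: derivative_eq_intros)
  from vector_diff_chain_at[OF this, of x "f (x (c - t))"] assms show ?thesis by (simp add: o_def)
qed

lemma ode_unique:
  fixes f :: "'a::euclidean_space \<Rightarrow> 'a"
  assumes lip: "\<And>r. \<exists>L. L-lipschitz_on (cball 0 r) f"
    and x: "\<And>t. (x has_vector_derivative f (x t)) (at t)"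
    and y: "\<And>t. (y has_vector_derivative f (y t)) (at t)"
    and eq: "x t0 = y t0"
  shows "x t = y t"
proof (cases "t0 \<le> t")
  case True
  then show ?thesis using ode_unique_forward[OF lip x y eq] by blast
next
  case False
  have "x (0 - (- t)) = y (0 - (- t))"
  proof (rule ode_unique_forward[where f="\<lambda>x. - f x" and x="\<lambda>s. x (0 - s)"
        and y="\<lambda>s. y (0 - s)" and ?t0.0="- t0" and ?t1.0="- t"])
    show "\<exists>L. L-lipschitz_on (cball 0 r) (\<lambda>x. - f x)" for r
      using lip[of r] by simp
    show "((\<lambda>t. x (0 - t)) has_vector_derivative - f (x (0 - t))) (at t)" for t
      by (rule time_reversed_solution[OF x])
    show "((\<lambda>t. y (0 - t)) has_vector_derivative - f (y (0 - t))) (at t)" for t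
      by (rule time_reversed_solution[OF y])
    show "x (0 - (- t0)) = y (0 - (- t0))" using eq by simp
  qed (use False in auto)
  then show ?thesis by simp
qed

text \<open>A field that is Lipschitz on bounded sets only is multiplied by a cutoff \<open>\<eta>\<close> of bounded support.
The new field is a multiple of the old one at each point, so it conserves \<open>V\<close> too; the solution stays in the
bounded level set, where \<open>\<eta> = 1\<close>.\<close>

lemma ode_global_solution_conserved:
  fixes f :: "'a::euclidean_space \<Rightarrow> 'a" and V :: "'a \<Rightarrow> real"
  assumes lip: "\<And>r. \<exists>L. L-lipschitz_on (cball 0 r) f"
    and V: "\<And>x. (V has_derivative V' x) (at x)" and conserved: "\<And>x. V' x (f x) = 0"
    and bounded: "\<And>x. V x = V x0 \<Longrightarrow> norm x \<le> B"
  shows "\<exists>x. x 0 = x0 \<and> (\<forall>t. (x has_vector_derivative f (x t)) (at t))"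
proof -
  have B: "B \<ge> 0" using bounded[OF refl] norm_ge_zero order_trans by blast
  define \<eta> where "\<eta> x = min 1 (max 0 (B + 1 - norm x))" for x :: 'a
  have \<eta>: "\<bar>\<eta> x - \<eta> y\<bar> \<le> norm (x - y)" "0 \<le> \<eta> x" "\<eta> x \<le> 1" for x y
    using norm_triangle_ineq3[of x y] by (auto simp: \<eta>_def)
  obtain L where L: "L-lipschitz_on (cball 0 (B + 1)) f" using lip by blast
  have "compact (f ` cball 0 (B + 1))"
    by (intro compact_continuous_image lipschitz_on_continuous_on[OF L]) auto
  then obtain M where M: "\<And>x. norm x \<le> B + 1 \<Longrightarrow> norm (f x) \<le> M"
    using compact_imp_bounded bounded_iff
    by (metis imageI mem_cball_0)
  have M0: "M \<ge> 0" using M[of 0] B norm_ge_zero[of "f 0"] by (simp del: norm_ge_zero)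
  have L0: "L \<ge> 0" using L by (rule lipschitz_on_nonneg)
  have le: "norm (\<eta> x *\<^sub>R f x - \<eta> y *\<^sub>R f y) \<le> (L + M) * norm (x - y)" if "norm x \<le> B + 1" for x y
  proof (cases "norm y \<le> B + 1")
    case True
    have "\<eta> x *\<^sub>R f x - \<eta> y *\<^sub>R f y = \<eta> x *\<^sub>R (f x - f y) + (\<eta> x - \<eta> y) *\<^sub>R f y"
      by (simp add: algebra_simps)
    also have "norm \<dots> \<le> \<bar>\<eta> x\<bar> * norm (f x - f y) + \<bar>\<eta> x - \<eta> y\<bar> * norm (f y)"
      by (rule order_trans[OF norm_triangle_ineq]) simp
    also have "\<dots> \<le> 1 * (L * norm (x - y)) + norm (x - y) * M"
      using \<eta>(1)[of x y] \<eta>(2,3)[of x] M[OF True] lipschitz_on_normD[OF L, of x y] True that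
      by (intro add_mono mult_mono) auto
    finally show ?thesis by (simp add: algebra_simps)
  next
    case False
    then have "\<eta> y = 0" by (simp add: \<eta>_def)
    then have "norm (\<eta> x *\<^sub>R f x - \<eta> y *\<^sub>R f y) = \<bar>\<eta> x - \<eta> y\<bar> * norm (f x)" by simp
    also have "\<dots> \<le> norm (x - y) * M"
      using \<eta>(1)[of x y] M[OF that] by (intro mult_mono) auto
    also have "\<dots> \<le> (L + M) * norm (x - y)"
      using L0 by (simp add: algebra_simps)
    finally show ?thesis .
  qed
  have "(L + M)-lipschitz_on UNIV (\<lambda>x. \<eta> x *\<^sub>R f x)"
  proof (rule lipschitz_onI)
    fix x y :: 'a
    consider "norm x \<le> B + 1" | "norm y \<le> B + 1" | "\<eta> x = 0" "\<eta> y = 0"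
      unfolding \<eta>_def by linarith
    then show "dist (\<eta> x *\<^sub>R f x) (\<eta> y *\<^sub>R f y) \<le> (L + M) * dist x y"
    proof cases
      case 1
      then show ?thesis using le by (simp add: dist_norm)
    next
      case 2
      then show ?thesis using le[of y x] by (simp add: dist_norm norm_minus_commute)
    qed (use L0 M0 in auto)
  qed (use L0 M0 in auto)
  then obtain x where x: "x 0 = x0" "\<And>t. (x has_vector_derivative \<eta> (x t) *\<^sub>R f (x t)) (at t)"
    using lipschitz_ode_global_solution[of _ _ x0] by meson
  have "((\<lambda>t. V (x t)) has_real_derivative 0) (at t)" for t
  proof -
    interpret bounded_linear "V' (x t)" using V by (rule has_derivative_bounded_linear)
    have "((\<lambda>t. V (x t)) has_vector_derivative V' (x t) (\<eta> (x t) *\<^sub>R f (x t))) (at t)"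
      using vector_derivative_diff_chain_within[OF x(2) has_derivative_at_withinI[OF V]]
      by (simp add: o_def)
    then show ?thesis
      by (simp add: scale conserved has_real_derivative_iff_has_vector_derivative)
  qed
  then have "V (x t) = V x0" for t
    using DERIV_isconst_all[of "\<lambda>t. V (x t)" t 0] x(1) by simp
  then have "\<eta> (x t) = 1" for t
    using bounded[of "x t"] by (simp add: \<eta>_def)
  then have "\<forall>t. (x has_vector_derivative f (x t)) (at t)" using x(2) by simp
  then show ?thesis using x(1) by blast
qed

text \<open>If \<open>f e \<noteq> 0\<close>, the component of the solution along \<open>f e\<close> eventually grows by at least
\<open>\<bar>f e\<bar>\<^sup>2 / 2\<close> in every unit of time, which a convergent function cannot do.\<close>

lemma limit_of_solution_is_equilibrium:
  fixes f :: "'a::real_inner \<Rightarrow> 'a"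
  assumes x: "\<And>t. (x has_vector_derivative f (x t)) (at t)"
    and lim: "(x \<longlongrightarrow> e) at_top" and cont: "isCont f e"
  shows "f e = 0"
proof (rule ccontr)
  assume "f e \<noteq> 0"
  define d where "d = f e \<bullet> f e"
  have d: "d > 0" using \<open>f e \<noteq> 0\<close> by (simp add: d_def)
  have "((\<lambda>t. f (x t) \<bullet> f e) \<longlongrightarrow> d) at_top"
    unfolding d_def using isCont_tendsto_compose[OF cont lim] by (intro tendsto_intros)
  then have ev1: "eventually (\<lambda>t. f (x t) \<bullet> f e > d / 2) at_top"
    using d by (intro order_tendstoD) auto
  have shift: "filterlim (\<lambda>t::real. t + 1) at_top at_top"
    unfolding add.commute[of _ "1::real"]
    by (rule filterlim_tendsto_add_at_top[OF tendsto_const filterlim_ident])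
  have "((\<lambda>t. x (t + 1) \<bullet> f e - x t \<bullet> f e) \<longlongrightarrow> e \<bullet> f e - e \<bullet> f e) at_top"
    using lim filterlim_compose[OF lim shift] by (intro tendsto_intros)
  then have ev2: "eventually (\<lambda>t. x (t + 1) \<bullet> f e - x t \<bullet> f e < d / 2) at_top"
    using d by (intro order_tendstoD) auto
  obtain t where t: "\<And>s. s \<ge> t \<Longrightarrow> f (x s) \<bullet> f e > d / 2"
    "x (t + 1) \<bullet> f e - x t \<bullet> f e < d / 2"
  proof -
    obtain N1 N2 where N: "\<And>s. s \<ge> N1 \<Longrightarrow> f (x s) \<bullet> f e > d / 2"
      "\<And>s. s \<ge> N2 \<Longrightarrow> x (s + 1) \<bullet> f e - x s \<bullet> f e < d / 2"
      using ev1 ev2 unfolding eventually_at_top_linorder by blast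
    show ?thesis by (rule that[of "max N1 N2"]) (use N in auto)
  qed
  have der: "((\<lambda>t. x t \<bullet> f e) has_real_derivative f (x s) \<bullet> f e) (at s)" for s
    unfolding has_real_derivative_iff_has_vector_derivative has_vector_derivative_def
    by (rule derivative_eq_intros x[unfolded has_vector_derivative_def] refl)+ auto
  obtain s where "t < s" "x (t + 1) \<bullet> f e - x t \<bullet> f e = (t + 1 - t) * (f (x s) \<bullet> f e)"
    using MVT2[of t "t + 1", OF _ der] by auto
  then show False using t(1)[of s] t(2) by simp
qed

lemma constant_sign:
  fixes g :: "real \<Rightarrow> real"
  assumes "continuous_on {c..} g" "\<And>t. t \<ge> c \<Longrightarrow> g t \<noteq> 0"
  shows "(\<forall>t\<ge>c. g t > 0) \<or> (\<forall>t\<ge>c. g t < 0)"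
proof -
  have con: "connected (g ` {c..})" using assms(1) by (intro connected_continuous_image) auto
  show ?thesis
  proof (rule ccontr)
    assume "\<not> ?thesis"
    then obtain s t where st: "s \<ge> c" "g s \<le> 0" "t \<ge> c" "0 \<le> g t"
      by (meson not_le)
    have "0 \<in> g ` {c..}"
      by (rule connectedD_interval[OF con _ _ st(2) st(4)]) (use st in auto)
    then show False using assms(2) by auto
  qed
qed

lemma convergent_if_derivative_nonzero:
  fixes m g :: "real \<Rightarrow> real"
  assumes m: "\<And>t. (m has_real_derivative g t) (at t)" and g: "continuous_on UNIV g"
    and nz: "\<And>t. t \<ge> c \<Longrightarrow> g t \<noteq> 0" and bound: "\<And>t. \<bar>m t\<bar> \<le> B"
  obtains l where "(m \<longlongrightarrow> l) at_top"
proof -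
  have incr: "\<exists>l. (m \<longlongrightarrow> l) at_top"
    if m: "\<And>t. (m has_real_derivative g t) (at t)" and pos: "\<And>t. t \<ge> c \<Longrightarrow> g t > 0"
      and bound: "\<And>t. \<bar>m t\<bar> \<le> B" for m g :: "real \<Rightarrow> real"
  proof -
    have mono: "m s \<le> m t" if "c \<le> s" "s \<le> t" for s t
    proof (rule DERIV_nonneg_imp_nondecreasing[OF \<open>s \<le> t\<close>])
      fix r assume "s \<le> r" "r \<le> t"
      then have "g r \<ge> 0" using pos[of r] \<open>c \<le> s\<close> by simp
      then show "\<exists>d. (m has_real_derivative d) (at r) \<and> d \<ge> 0" using m by blast
    qed
    have bdd: "bdd_above (m ` {c..})"
      using bound by (intro bdd_aboveI[of _ B]) (auto simp: abs_le_iff)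
    define l where "l = Sup (m ` {c..})"
    have le: "m t \<le> l" if "t \<ge> c" for t
      unfolding l_def using that bdd by (intro cSup_upper) auto
    have "(m \<longlongrightarrow> l) at_top"
    proof (rule order_tendstoI)
      fix a assume "a < l"
      then obtain s where "s \<ge> c" "a < m s"
        unfolding l_def using less_cSup_iff[OF _ bdd, of a] by auto
      then show "eventually (\<lambda>t. a < m t) at_top"
        unfolding eventually_at_top_linorder using mono by (meson order.strict_trans2)
    next
      fix a assume "l < a"
      then show "eventually (\<lambda>t. m t < a) at_top"
        unfolding eventually_at_top_linorder using le by (meson order.strict_trans1)
    qed
    then show ?thesis by blast
  qed
  have "(\<forall>t\<ge>c. g t > 0) \<or> (\<forall>t\<ge>c. g t < 0)"
    by (intro constant_sign nz continuous_on_subset[OF g]) auto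
  then have "\<exists>l. (m \<longlongrightarrow> l) at_top"
  proof
    assume "\<forall>t\<ge>c. g t > 0"
    then show ?thesis using incr[OF m _ bound] by blast
  next
    assume neg: "\<forall>t\<ge>c. g t < 0"
    have "((\<lambda>t. - m t) has_real_derivative - g t) (at t)" for t
      using m by (auto intro!: derivative_eq_intros)
    then obtain l where "((\<lambda>t. - m t) \<longlongrightarrow> l) at_top"
      using incr[of "\<lambda>t. - m t" "\<lambda>t. - g t"] neg bound by auto
    then have "(m \<longlongrightarrow> - l) at_top" using tendsto_minus_cancel_left by force
    then show ?thesis by blast
  qed
  then show ?thesis using that by blast
qed

text \<open>Without zeros the function keeps its sign, and it equals plus or minus the root of its square.\<close>

lemma convergent_if_square_convergent:
  fixes f :: "real \<Rightarrow> real"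
  assumes "continuous_on UNIV f" "\<And>t. t \<ge> c \<Longrightarrow> f t \<noteq> 0" "((\<lambda>t. (f t)\<^sup>2) \<longlongrightarrow> l) at_top"
  obtains k where "(f \<longlongrightarrow> k) at_top"
proof -
  have lim: "((\<lambda>t. sqrt ((f t)\<^sup>2)) \<longlongrightarrow> sqrt l) at_top" using assms(3) by (rule tendsto_real_sqrt)
  have "(\<forall>t\<ge>c. f t > 0) \<or> (\<forall>t\<ge>c. f t < 0)"
    by (intro constant_sign assms continuous_on_subset[OF assms(1)]) auto
  then have "\<exists>k. (f \<longlongrightarrow> k) at_top"
  proof
    assume "\<forall>t\<ge>c. f t > 0"
    then have "eventually (\<lambda>t. sqrt ((f t)\<^sup>2) = f t) at_top"
      unfolding eventually_at_top_linorder by (intro exI[of _ c]) auto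
    with lim show ?thesis by (blast intro: Lim_transform_eventually)
  next
    assume "\<forall>t\<ge>c. f t < 0"
    then have "eventually (\<lambda>t. - sqrt ((f t)\<^sup>2) = f t) at_top"
      unfolding eventually_at_top_linorder by (intro exI[of _ c]) auto
    with tendsto_minus[OF lim] show ?thesis by (blast intro: Lim_transform_eventually)
  qed
  then show ?thesis using that by blast
qed

section \<open>Differentials of the integrals on the tangent space\<close>

definition dC :: "state \<Rightarrow> state \<Rightarrow> real \<times> real \<times> real" where
  "dC = (\<lambda>(\<omega>, \<alpha>, \<beta>) (\<delta>\<omega>, \<delta>\<alpha>, \<delta>\<beta>). (2 * (\<alpha> \<bullet> \<delta>\<alpha>), 2 * (\<beta> \<bullet> \<delta>\<beta>), \<alpha> \<bullet> \<delta>\<beta> + \<delta>\<alpha> \<bullet> \<beta>))"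

definition dH :: "state \<Rightarrow> state \<Rightarrow> real" where
  "dH = (\<lambda>(\<omega>, \<alpha>, \<beta>) (\<delta>\<omega>, \<delta>\<alpha>, \<delta>\<beta>).
     2 * \<omega>$1 * \<delta>\<omega>$1 + 2 * \<omega>$2 * \<delta>\<omega>$2 + \<omega>$3 * \<delta>\<omega>$3 - \<delta>\<alpha>$1 - \<delta>\<beta>$2)"

definition dK :: "real \<Rightarrow> state \<Rightarrow> state \<Rightarrow> real" where
  "dK lam = (\<lambda>(\<omega>, \<alpha>, \<beta>) (\<delta>\<omega>, \<delta>\<alpha>, \<delta>\<beta>).
     2 * ((\<omega>$1)^2 - (\<omega>$2)^2 + \<alpha>$1 - \<beta>$2) * (2 * \<omega>$1 * \<delta>\<omega>$1 - 2 * \<omega>$2 * \<delta>\<omega>$2 + \<delta>\<alpha>$1 - \<delta>\<beta>$2)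
     + 2 * (2 * \<omega>$1 * \<omega>$2 + \<alpha>$2 + \<beta>$1) * (2 * \<omega>$1 * \<delta>\<omega>$2 + 2 * \<omega>$2 * \<delta>\<omega>$1 + \<delta>\<alpha>$2 + \<delta>\<beta>$1)
     + 2 * lam * (\<delta>\<omega>$3 * ((\<omega>$1)^2 + (\<omega>$2)^2) + (\<omega>$3 - lam) * (2 * \<omega>$1 * \<delta>\<omega>$1 + 2 * \<omega>$2 * \<delta>\<omega>$2)
        + 2 * (\<omega>$1 * \<delta>\<alpha>$3 + \<delta>\<omega>$1 * \<alpha>$3) + 2 * (\<omega>$2 * \<delta>\<beta>$3 + \<delta>\<omega>$2 * \<beta>$3)))"

definition momentum :: "real \<Rightarrow> real^3 \<Rightarrow> real^3" where
  "momentum lam \<omega> = vector [2 * \<omega>$1, 2 * \<omega>$2, \<omega>$3 + lam]"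

definition dG :: "real \<Rightarrow> real \<Rightarrow> real \<Rightarrow> state \<Rightarrow> state \<Rightarrow> real" where
  "dG a b lam = (\<lambda>(\<omega>, \<alpha>, \<beta>) (\<delta>\<omega>, \<delta>\<alpha>, \<delta>\<beta>).
     let M = momentum lam \<omega>; \<delta>M = vector [2 * \<delta>\<omega>$1, 2 * \<delta>\<omega>$2, \<delta>\<omega>$3] :: real^3 in
       ((M \<bullet> \<alpha>) * (\<delta>M \<bullet> \<alpha> + M \<bullet> \<delta>\<alpha>) + (M \<bullet> \<beta>) * (\<delta>M \<bullet> \<beta> + M \<bullet> \<delta>\<beta>)) / 2
       + (\<delta>\<omega>$3 * (M \<bullet> (\<alpha> \<times> \<beta>))
          + (\<omega>$3 - lam) * (\<delta>M \<bullet> (\<alpha> \<times> \<beta>) + M \<bullet> (\<delta>\<alpha> \<times> \<beta>) + M \<bullet> (\<alpha> \<times> \<delta>\<beta>))) / 2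
       - b^2 * \<delta>\<alpha>$1 - a^2 * \<delta>\<beta>$2)"

lemma has_derivative_state_coordinates:
  "((\<lambda>\<zeta>::state. fst \<zeta> $ i) has_derivative (\<lambda>v. fst v $ i)) F"
  "((\<lambda>\<zeta>::state. fst (snd \<zeta>) $ i) has_derivative (\<lambda>v. fst (snd v) $ i)) F"
  "((\<lambda>\<zeta>::state. snd (snd \<zeta>) $ i) has_derivative (\<lambda>v. snd (snd v) $ i)) F"
  by (intro bounded_linear_imp_has_derivative bounded_linear_intros
      bounded_linear_compose[OF bounded_linear_vec_nth])+

lemma constraints_has_derivative: "(constraints has_derivative dC \<zeta>) (at \<zeta>)"
  unfolding constraints_def dC_def case_prod_beta
  by (rule has_derivative_eq_rhs, (rule derivative_intros)+) (auto simp: fun_eq_iff inner_commute)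

lemma Hfun_has_derivative: "(Hfun has_derivative dH \<zeta>) (at \<zeta>)"
  unfolding Hfun_def dH_def case_prod_beta
  by (rule has_derivative_eq_rhs, (rule derivative_intros has_derivative_state_coordinates zero_neq_numeral[symmetric])+)
     (auto simp: fun_eq_iff)

lemma Kfun_has_derivative: "(Kfun lam has_derivative dK lam \<zeta>) (at \<zeta>)"
  unfolding Kfun_def dK_def case_prod_beta
  by (rule has_derivative_eq_rhs, (rule derivative_intros has_derivative_state_coordinates zero_neq_numeral[symmetric])+)
     (auto simp: fun_eq_iff algebra_simps)

lemma Gfun_has_derivative: "(Gfun a b lam has_derivative dG a b lam \<zeta>) (at \<zeta>)"
  unfolding Gfun_def dG_def momentum_def case_prod_beta Let_def inner_vec_def sum_3 cross3_def vector_3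
    inner_real_def
  by (rule has_derivative_eq_rhs, (rule derivative_intros has_derivative_state_coordinates zero_neq_numeral[symmetric])+)
     (auto simp: fun_eq_iff algebra_simps)

lemma frechet_derivatives:
  "frechet_derivative constraints (at \<zeta>) = dC \<zeta>"
  "frechet_derivative Hfun (at \<zeta>) = dH \<zeta>"
  "frechet_derivative (Kfun lam) (at \<zeta>) = dK lam \<zeta>"
  "frechet_derivative (Jmap a b lam) (at \<zeta>) = (\<lambda>v. (dG a b lam \<zeta> v, dK lam \<zeta> v, dH \<zeta> v))"
proof -
  have "(Jmap a b lam has_derivative (\<lambda>v. (dG a b lam \<zeta> v, dK lam \<zeta> v, dH \<zeta> v))) (at \<zeta>)"
    unfolding Jmap_def[abs_def]
    by (intro has_derivative_Pair Gfun_has_derivative Kfun_has_derivative Hfun_has_derivative)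
  then show "frechet_derivative (Jmap a b lam) (at \<zeta>) = (\<lambda>v. (dG a b lam \<zeta> v, dK lam \<zeta> v, dH \<zeta> v))"
    by (rule frechet_derivative_at[symmetric])
qed (intro frechet_derivative_at[symmetric] constraints_has_derivative Hfun_has_derivative
      Kfun_has_derivative)+

text \<open>The variation by \<open>\<delta>\<omega>\<close> and by an infinitesimal rotation \<open>\<theta>\<close> of the two fields; the latter is the
general form of a variation that preserves the lengths of \<open>\<alpha>\<close> and \<open>\<beta>\<close> and their angle.\<close>

definition variation :: "state \<Rightarrow> real^3 \<Rightarrow> real^3 \<Rightarrow> state" where
  "variation = (\<lambda>(\<omega>, \<alpha>, \<beta>) \<delta>\<omega> \<theta>. (\<delta>\<omega>, \<alpha> \<times> \<theta>, \<beta> \<times> \<theta>))"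

lemma zero_if_orthogonal_to_frame:
  fixes u \<alpha> \<beta> :: "real^3"
  assumes "\<alpha> \<times> \<beta> \<noteq> 0" "u \<bullet> \<alpha> = 0" "u \<bullet> \<beta> = 0" "u \<bullet> (\<alpha> \<times> \<beta>) = 0"
  shows "u = 0"
proof -
  have "u \<times> (\<alpha> \<times> \<beta>) = 0" using assms by (simp add: Lagrange)
  then show ?thesis using norm_and_cross_eq_0[of u "\<alpha> \<times> \<beta>"] assms by simp
qed

lemma P6_cross_nonzero:
  assumes "(\<omega>, \<alpha>, \<beta>) \<in> P6 a b" "a > 0" "b > 0"
  shows "(\<alpha> \<times> \<beta>) \<bullet> (\<alpha> \<times> \<beta>) = a^2 * b^2" "\<alpha> \<times> \<beta> \<noteq> 0"
proof -
  show *: "(\<alpha> \<times> \<beta>) \<bullet> (\<alpha> \<times> \<beta>) = a^2 * b^2"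
    using assms(1) by (simp add: dot_cross P6_def inner_commute)
  show "\<alpha> \<times> \<beta> \<noteq> 0"
  proof
    assume "\<alpha> \<times> \<beta> = 0"
    then show False using * assms by simp
  qed
qed

text \<open>The frame \<open>\<alpha>, \<beta>, \<alpha> \<times> \<beta>\<close> is orthogonal, so the rotation vector can be written down from the
components of \<open>\<delta>\<alpha>\<close> and \<open>\<delta>\<beta>\<close> in it.\<close>

lemma tangent_eq_variations:
  assumes P: "\<zeta> \<in> P6 a b" and a: "a > 0" and b: "b > 0"
  shows "tangent \<zeta> = range (case_prod (variation \<zeta>))"
proof -
  obtain \<omega> \<alpha> \<beta> where \<zeta>: "\<zeta> = (\<omega>, \<alpha>, \<beta>)" by (cases \<zeta>) auto
  have AB: "\<alpha> \<bullet> \<alpha> = a^2" "\<beta> \<bullet> \<beta> = b^2" "\<alpha> \<bullet> \<beta> = 0" "\<beta> \<bullet> \<alpha> = 0"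
    using P by (auto simp: \<zeta> P6_def inner_commute)
  define \<gamma> where "\<gamma> = \<alpha> \<times> \<beta>"
  have N: "\<gamma> \<bullet> \<gamma> = a^2 * b^2" "\<gamma> \<noteq> 0"
    using P6_cross_nonzero P a b unfolding \<gamma>_def \<zeta> by auto
  have N0: "a^2 * b^2 \<noteq> 0" using a b by simp
  have orth: "\<alpha> \<bullet> \<gamma> = 0" "\<beta> \<bullet> \<gamma> = 0" "\<gamma> \<bullet> \<alpha> = 0" "\<gamma> \<bullet> \<beta> = 0"
    by (simp_all add: \<gamma>_def dot_cross_self)
  have cr: "\<alpha> \<times> \<gamma> = - (a^2 *\<^sub>R \<beta>)" "\<beta> \<times> \<gamma> = b^2 *\<^sub>R \<alpha>" "\<beta> \<times> \<alpha> = - \<gamma>" "\<alpha> \<times> \<beta> = \<gamma>"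
    by (simp_all add: \<gamma>_def Lagrange AB cross_skew[of \<beta> \<alpha>])
  show ?thesis
  proof (intro equalityI subsetI)
    fix v assume "v \<in> tangent \<zeta>"
    obtain \<delta>\<omega> \<delta>\<alpha> \<delta>\<beta> where v: "v = (\<delta>\<omega>, \<delta>\<alpha>, \<delta>\<beta>)" by (cases v) auto
    have T: "\<delta>\<alpha> \<bullet> \<alpha> = 0" "\<delta>\<beta> \<bullet> \<beta> = 0" "\<delta>\<beta> \<bullet> \<alpha> = - (\<delta>\<alpha> \<bullet> \<beta>)"
      using \<open>v \<in> tangent \<zeta>\<close>
      by (auto simp: tangent_def frechet_derivatives dC_def v \<zeta> zero_prod_def inner_commute)
    \<comment> \<open>The coefficients are dictated by \<open>\<alpha> \<times> \<gamma> = - a\<^sup>2 \<beta>\<close>, \<open>\<beta> \<times> \<gamma> = b\<^sup>2 \<alpha>\<close> and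
      \<open>\<gamma> \<bullet> \<gamma> = a\<^sup>2 b\<^sup>2\<close>.\<close>
    define \<theta> where "\<theta> = (1 / (a^2 * b^2)) *\<^sub>R ((\<delta>\<alpha> \<bullet> \<gamma>) *\<^sub>R \<beta> - (\<delta>\<beta> \<bullet> \<gamma>) *\<^sub>R \<alpha> - (\<delta>\<alpha> \<bullet> \<beta>) *\<^sub>R \<gamma>)"
    have "\<alpha> \<times> \<theta> = (1 / (a^2 * b^2)) *\<^sub>R ((\<delta>\<alpha> \<bullet> \<gamma>) *\<^sub>R \<gamma> + ((\<delta>\<alpha> \<bullet> \<beta>) * a^2) *\<^sub>R \<beta>)"
      unfolding \<theta>_def
      by (simp only: cross_mult_right Cross3.right_diff_distrib cr cross_refl) (simp add: algebra_simps)
    then have "\<alpha> \<times> \<theta> - \<delta>\<alpha> = 0"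
      using N0 a b
      by (intro zero_if_orthogonal_to_frame[of \<alpha> \<beta>])
         (simp_all add: N cr orth AB T inner_diff_left inner_add_left)
    moreover have "\<beta> \<times> \<theta> = (1 / (a^2 * b^2)) *\<^sub>R ((\<delta>\<beta> \<bullet> \<gamma>) *\<^sub>R \<gamma> - ((\<delta>\<alpha> \<bullet> \<beta>) * b^2) *\<^sub>R \<alpha>)"
      unfolding \<theta>_def
      by (simp only: cross_mult_right Cross3.right_diff_distrib cr cross_refl) (simp add: algebra_simps)
    then have "\<beta> \<times> \<theta> - \<delta>\<beta> = 0"
      using N0 a b
      by (intro zero_if_orthogonal_to_frame[of \<alpha> \<beta>])
         (simp_all add: N cr orth AB T inner_diff_left inner_add_left)
    ultimately have "v = case_prod (variation \<zeta>) (\<delta>\<omega>, \<theta>)"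
      by (simp add: v variation_def \<zeta>)
    then show "v \<in> range (case_prod (variation \<zeta>))" by blast
  next
    fix v assume "v \<in> range (case_prod (variation \<zeta>))"
    then obtain \<delta>\<omega> \<theta> where "v = (\<delta>\<omega>, \<alpha> \<times> \<theta>, \<beta> \<times> \<theta>)" by (auto simp: variation_def \<zeta>)
    moreover have "\<alpha> \<bullet> (\<beta> \<times> \<theta>) + (\<alpha> \<times> \<theta>) \<bullet> \<beta> = 0"
      by (metis add.right_inverse cross_skew cross_triple inner_commute inner_minus_left)
    ultimately show "v \<in> tangent \<zeta>"
      by (simp add: tangent_def frechet_derivatives dC_def \<zeta> zero_prod_def dot_cross_self)
  qed
qed

section \<open>Rank one as proportionality\<close>

text \<open>The hypothesis excludes the case in which \<open>k\<close> alone is nonzero. The case \<open>k = h\<close>, where the set has one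
element, needs a separate argument.\<close>

lemma rank_on_pair_eq_1_iff:
  assumes "(\<forall>v\<in>T. h v = 0) \<Longrightarrow> (\<forall>v\<in>T. k v = (0::real))"
  shows "rank_on T {k, h} = 1 \<longleftrightarrow> (\<exists>v\<in>T. h v \<noteq> 0) \<and> (\<exists>\<mu>. \<forall>v\<in>T. k v = \<mu> * h v)"
proof -
  define R where "R = card ` {S \<in> Pow {k, h}. independent_on T S}"
  have rank: "rank_on T {k, h} = Max R"
    unfolding rank_on_def R_def image_def Pow_def by (intro arg_cong[of _ _ Max]) blast
  have fin: "finite R" unfolding R_def by simp
  have RI: "card S \<in> R" if "S \<subseteq> {k, h}" "independent_on T S" for S
    unfolding R_def using that by blast
  have RE: "\<exists>S. S \<subseteq> {k, h} \<and> independent_on T S \<and> n = card S" if "n \<in> R" for n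
    using that unfolding R_def by blast
  have ne: "R \<noteq> {}" using RI[of "{}"] by (auto simp: independent_on_def)
  show ?thesis
  proof
    assume R1: "rank_on T {k, h} = 1"
    have "1 \<in> R" using Max_in[OF fin ne] R1 by (simp add: rank)
    then obtain S where S: "S \<subseteq> {k, h}" "independent_on T S" "card S = 1"
      using RE by metis
    then obtain f where f: "S = {f}" "f = k \<or> f = h" by (auto simp: card_1_singleton_iff)
    have "\<exists>v\<in>T. h v \<noteq> 0"
    proof (rule ccontr)
      assume "\<not> ?thesis"
      then have "\<forall>v\<in>T. f v = 0" using assms f by auto
      then show False
        using S(2)[unfolded f(1) independent_on_def, THEN spec, of "\<lambda>_. 1"] by simp
    qed
    moreover have "\<exists>\<mu>. \<forall>v\<in>T. k v = \<mu> * h v"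
    proof (cases "k = h")
      case False
      then have "2 = card {k, h}" by simp
      moreover have "2 \<notin> R"
        using Max_ge[OF fin, of 2] R1 by (auto simp: rank)
      ultimately have "\<not> independent_on T {k, h}" using RI[of "{k, h}"] by auto
      then obtain c where c: "\<forall>v\<in>T. c k * k v + c h * h v = 0" "c k \<noteq> 0 \<or> c h \<noteq> 0"
        unfolding independent_on_def using False by auto
      obtain v where "v \<in> T" "h v \<noteq> 0" using \<open>\<exists>v\<in>T. h v \<noteq> 0\<close> by blast
      then have "c k \<noteq> 0" using c by force
      then have "\<forall>v\<in>T. k v = (- c h / c k) * h v"
        using c(1) by (auto simp: field_simps eq_neg_iff_add_eq_0)
      then show ?thesis by blast
    qed (auto intro: exI[of _ 1])
    ultimately show "(\<exists>v\<in>T. h v \<noteq> 0) \<and> (\<exists>\<mu>. \<forall>v\<in>T. k v = \<mu> * h v)" by blast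
  next
    assume "(\<exists>v\<in>T. h v \<noteq> 0) \<and> (\<exists>\<mu>. \<forall>v\<in>T. k v = \<mu> * h v)"
    then obtain v \<mu> where v: "v \<in> T" "h v \<noteq> 0" and \<mu>: "\<forall>v\<in>T. k v = \<mu> * h v" by blast
    have "independent_on T {h}" using v by (auto simp: independent_on_def)
    then have in1: "1 \<in> R" using RI[of "{h}"] by simp
    have "n \<le> 1" if n: "n \<in> R" for n
    proof (rule ccontr)
      obtain S where S: "n = card S" "S \<subseteq> {k, h}" "independent_on T S" using RE[OF n] by blast
      assume "\<not> n \<le> 1"
      then have "\<not> card S \<le> 1" by (simp add: S)
      have "S = {k, h} \<and> k \<noteq> h"
      proof -
        have "card S \<le> card {k, h}" using S by (intro card_mono) auto
        with \<open>\<not> card S \<le> 1\<close> have "k \<noteq> h" by (cases "k = h") auto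
        moreover have "S = {k, h}"
          using S(2) \<open>\<not> card S \<le> 1\<close> \<open>card S \<le> card {k, h}\<close> calculation by (intro card_seteq) auto
        ultimately show ?thesis by simp
      qed
      then have "k \<noteq> h" "S = {k, h}" by auto
      have "\<forall>v\<in>T. (\<Sum>f\<in>S. (if f = k then 1 else - \<mu>) * f v) = 0"
        using \<mu> \<open>k \<noteq> h\<close> by (auto simp: \<open>S = {k, h}\<close>)
      then have "\<forall>f\<in>S. (if f = k then 1 else - \<mu>) = 0"
        using S(3)[unfolded independent_on_def, THEN spec, of "\<lambda>f. if f = k then 1 else - \<mu>"]
        by blast
      then show False by (auto simp: \<open>S = {k, h}\<close>)
    qed
    then show "rank_on T {k, h} = 1"
      unfolding rank using in1 fin by (intro Max_eqI) auto
  qed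
qed

text \<open>A one-dimensional image is spanned by the image of one vector \<open>w\<close>; the hypothesis makes \<open>h w\<close> nonzero, and
the ratios at \<open>w\<close> are the factors of proportionality.\<close>

lemma dim_image_triple_eq_1_iff:
  fixes g k h :: "'v \<Rightarrow> real"
  assumes "(\<forall>v\<in>T. h v = 0) \<Longrightarrow> (\<forall>v\<in>T. k v = 0) \<and> (\<forall>v\<in>T. g v = 0)"
  shows "dim ((\<lambda>v. (g v, k v, h v)) ` T) = 1 \<longleftrightarrow>
    (\<exists>v\<in>T. h v \<noteq> 0) \<and> (\<exists>\<mu>. \<forall>v\<in>T. k v = \<mu> * h v) \<and> (\<exists>\<nu>. \<forall>v\<in>T. g v = \<nu> * h v)"
    (is "dim ?S = 1 \<longleftrightarrow> ?R")
proof
  assume dim1: "dim ?S = 1"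
  obtain B where B: "B \<subseteq> ?S" "independent B" "?S \<subseteq> span B" "card B = dim ?S"
    by (rule basis_exists[of ?S])
  then obtain e where e: "B = {e}" using dim1 by (auto simp: card_1_singleton_iff)
  then have "e \<noteq> 0" using B(2) by (auto simp: dependent_zero)
  obtain w where w: "w \<in> T" "e = (g w, k w, h w)" using B(1) e by auto
  have mult: "\<exists>c. g v = c * g w \<and> k v = c * k w \<and> h v = c * h w" if "v \<in> T" for v
  proof -
    have "(g v, k v, h v) \<in> span {e}" using B(3) e that by auto
    then show ?thesis by (auto simp: span_singleton w)
  qed
  have "h w \<noteq> 0"
  proof
    assume "h w = 0"
    then have "\<forall>v\<in>T. h v = 0" using mult by fastforce
    then show False using assms w \<open>e \<noteq> 0\<close> by (auto simp: zero_prod_def)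
  qed
  moreover have "k v = k w / h w * h v" "g v = g w / h w * h v" if "v \<in> T" for v
    using mult[OF that] \<open>h w \<noteq> 0\<close> by auto
  ultimately show ?R using w(1) by blast
next
  assume ?R
  then obtain w \<mu> \<nu> where w: "w \<in> T" "h w \<noteq> 0" and \<mu>: "\<forall>v\<in>T. k v = \<mu> * h v"
    and \<nu>: "\<forall>v\<in>T. g v = \<nu> * h v" by blast
  show "dim ?S = 1"
  proof (rule dim_unique)
    let ?e = "(g w, k w, h w)"
    show "{?e} \<subseteq> ?S" using w by auto
    show "independent {?e}" using w by (simp add: zero_prod_def)
    show "?S \<subseteq> span {?e}"
    proof clarify
      fix v assume "v \<in> T"
      then have "(g v, k v, h v) = (h v / h w) *\<^sub>R ?e"
        using \<mu> \<nu> w by (auto simp: field_simps)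
      then show "(g v, k v, h v) \<in> span {?e}"
        by (metis span_base span_scale singletonI)
    qed
  qed simp
qed

section \<open>Equations for the critical points\<close>

lemma dH_variation:
  "dH (\<omega>, \<alpha>, \<beta>) (variation (\<omega>, \<alpha>, \<beta>) \<delta> \<theta>) =
     2 * \<omega>$1 * \<delta>$1 + 2 * \<omega>$2 * \<delta>$2 + \<omega>$3 * \<delta>$3 - \<beta>$3 * \<theta>$1 + \<alpha>$3 * \<theta>$2 - (\<alpha>$2 - \<beta>$1) * \<theta>$3"
  by (simp add: dH_def variation_def cross_components algebra_simps)

lemma dK_variation:
  fixes \<omega> \<alpha> \<beta> :: "real^3" and lam :: real
  defines "X \<equiv> (\<omega>$1)^2 - (\<omega>$2)^2 + \<alpha>$1 - \<beta>$2" and "Y \<equiv> 2 * \<omega>$1 * \<omega>$2 + \<alpha>$2 + \<beta>$1"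
  shows "dK lam (\<omega>, \<alpha>, \<beta>) (variation (\<omega>, \<alpha>, \<beta>) \<delta> \<theta>) =
     4 * (X * \<omega>$1 + Y * \<omega>$2 + lam * ((\<omega>$3 - lam) * \<omega>$1 + \<alpha>$3)) * \<delta>$1
     + 4 * (Y * \<omega>$1 - X * \<omega>$2 + lam * ((\<omega>$3 - lam) * \<omega>$2 + \<beta>$3)) * \<delta>$2
     + 2 * lam * ((\<omega>$1)^2 + (\<omega>$2)^2) * \<delta>$3
     + 2 * (Y * \<alpha>$3 - X * \<beta>$3 - 2 * lam * (\<omega>$1 * \<alpha>$2 + \<omega>$2 * \<beta>$2)) * \<theta>$1
     + 2 * (2 * lam * (\<omega>$1 * \<alpha>$1 + \<omega>$2 * \<beta>$1) - X * \<alpha>$3 - Y * \<beta>$3) * \<theta>$2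
     + 2 * (X * (\<alpha>$2 + \<beta>$1) - Y * (\<alpha>$1 - \<beta>$2)) * \<theta>$3"
  unfolding X_def Y_def
  by (simp add: dK_def variation_def cross_components) algebra

text \<open>The six equations are the coefficients of the components of \<open>\<delta>\<omega>\<close> and \<open>\<theta>\<close>. With
\<open>U = X + i Y = w\<^sub>1\<^sup>2 + x\<^sub>1\<close> the first two read
\<open>U w\<^sub>2 + \<lambda> (w\<^sub>3 - \<lambda>) w\<^sub>1 + \<lambda> z\<^sub>1 = \<mu> w\<^sub>1\<close>, the fourth and fifth
\<open>U z\<^sub>2 + \<mu> z\<^sub>1 = \<lambda> (x\<^sub>1 w\<^sub>2 + y\<^sub>1 w\<^sub>1)\<close>.\<close>

lemma dK_proportional_dH_iff:
  fixes \<omega> \<alpha> \<beta> :: "real^3" and lam \<mu> :: real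
  defines "X \<equiv> (\<omega>$1)^2 - (\<omega>$2)^2 + \<alpha>$1 - \<beta>$2" and "Y \<equiv> 2 * \<omega>$1 * \<omega>$2 + \<alpha>$2 + \<beta>$1"
  assumes "(\<omega>, \<alpha>, \<beta>) \<in> P6 a b" "a > 0" "b > 0"
  shows "(\<forall>v\<in>tangent (\<omega>, \<alpha>, \<beta>). dK lam (\<omega>, \<alpha>, \<beta>) v = 2 * \<mu> * dH (\<omega>, \<alpha>, \<beta>) v) \<longleftrightarrow>
     X * \<omega>$1 + Y * \<omega>$2 + lam * ((\<omega>$3 - lam) * \<omega>$1 + \<alpha>$3) = \<mu> * \<omega>$1
   \<and> Y * \<omega>$1 - X * \<omega>$2 + lam * ((\<omega>$3 - lam) * \<omega>$2 + \<beta>$3) = \<mu> * \<omega>$2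
   \<and> lam * ((\<omega>$1)^2 + (\<omega>$2)^2) = \<mu> * \<omega>$3
   \<and> Y * \<alpha>$3 - X * \<beta>$3 - 2 * lam * (\<omega>$1 * \<alpha>$2 + \<omega>$2 * \<beta>$2) = - \<mu> * \<beta>$3
   \<and> 2 * lam * (\<omega>$1 * \<alpha>$1 + \<omega>$2 * \<beta>$1) - X * \<alpha>$3 - Y * \<beta>$3 = \<mu> * \<alpha>$3
   \<and> X * (\<alpha>$2 + \<beta>$1) - Y * (\<alpha>$1 - \<beta>$2) = - \<mu> * (\<alpha>$2 - \<beta>$1)"
    (is "?L \<longleftrightarrow> ?R")
proof -
  have "?L \<longleftrightarrow> (\<forall>\<delta> \<theta>. dK lam (\<omega>, \<alpha>, \<beta>) (variation (\<omega>, \<alpha>, \<beta>) \<delta> \<theta>)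
      = 2 * \<mu> * dH (\<omega>, \<alpha>, \<beta>) (variation (\<omega>, \<alpha>, \<beta>) \<delta> \<theta>))"
    using tangent_eq_variations[OF assms(3-)] by auto
  also have "\<dots> \<longleftrightarrow> ?R"
  proof
    assume *: "\<forall>\<delta> \<theta>. dK lam (\<omega>, \<alpha>, \<beta>) (variation (\<omega>, \<alpha>, \<beta>) \<delta> \<theta>)
      = 2 * \<mu> * dH (\<omega>, \<alpha>, \<beta>) (variation (\<omega>, \<alpha>, \<beta>) \<delta> \<theta>)"
    show ?R
      using *[rule_format, of "vector [1,0,0]" 0] *[rule_format, of "vector [0,1,0]" 0]
        *[rule_format, of "vector [0,0,1]" 0] *[rule_format, of 0 "vector [1,0,0]"]
        *[rule_format, of 0 "vector [0,1,0]"] *[rule_format, of 0 "vector [0,0,1]"]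
      unfolding dK_variation dH_variation X_def[symmetric] Y_def[symmetric]
      by simp (simp add: algebra_simps)
  next
    assume R: ?R
    then have "2 * lam * ((\<omega>$1)^2 + (\<omega>$2)^2) = 2 * \<mu> * \<omega>$3" by simp
    with R show "\<forall>\<delta> \<theta>. dK lam (\<omega>, \<alpha>, \<beta>) (variation (\<omega>, \<alpha>, \<beta>) \<delta> \<theta>)
      = 2 * \<mu> * dH (\<omega>, \<alpha>, \<beta>) (variation (\<omega>, \<alpha>, \<beta>) \<delta> \<theta>)"
      unfolding dK_variation dH_variation X_def[symmetric] Y_def[symmetric]
      by (simp only: simp_thms) (simp add: algebra_simps)
  qed
  finally show ?thesis .
qed

lemma dH_vanishes_iff:
  assumes "(\<omega>, \<alpha>, \<beta>) \<in> P6 a b" "a > 0" "b > 0"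
  shows "(\<forall>v\<in>tangent (\<omega>, \<alpha>, \<beta>). dH (\<omega>, \<alpha>, \<beta>) v = 0) \<longleftrightarrow>
    \<omega>$1 = 0 \<and> \<omega>$2 = 0 \<and> \<omega>$3 = 0 \<and> \<alpha>$3 = 0 \<and> \<beta>$3 = 0 \<and> \<alpha>$2 = \<beta>$1" (is "?L \<longleftrightarrow> ?R")
proof -
  have "?L \<longleftrightarrow> (\<forall>\<delta> \<theta>. dH (\<omega>, \<alpha>, \<beta>) (variation (\<omega>, \<alpha>, \<beta>) \<delta> \<theta>) = 0)"
    using tangent_eq_variations[OF assms] by auto
  also have "\<dots> \<longleftrightarrow> ?R"
  proof
    assume *: "\<forall>\<delta> \<theta>. dH (\<omega>, \<alpha>, \<beta>) (variation (\<omega>, \<alpha>, \<beta>) \<delta> \<theta>) = 0"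
    show ?R
      using *[rule_format, of "vector [1,0,0]" 0] *[rule_format, of "vector [0,1,0]" 0]
        *[rule_format, of "vector [0,0,1]" 0] *[rule_format, of 0 "vector [1,0,0]"]
        *[rule_format, of 0 "vector [0,1,0]"] *[rule_format, of 0 "vector [0,0,1]"]
      unfolding dH_variation by simp
  qed (simp add: dH_variation)
  finally show ?thesis .
qed

text \<open>An equilibrium has \<open>\<omega>\<close> parallel to both \<open>\<alpha>\<close> and \<open>\<beta>\<close>, which are orthogonal and nonzero; so \<open>\<omega> = 0\<close>.\<close>

lemma equilibrium_iff:
  assumes P: "(\<omega>, \<alpha>, \<beta>) \<in> P6 a b" and "a > 0" "b > 0"
  shows "gyro_field lam (\<omega>, \<alpha>, \<beta>) = 0 \<longleftrightarrow> \<omega> = 0 \<and> \<alpha>$3 = 0 \<and> \<beta>$3 = 0 \<and> \<alpha>$2 = \<beta>$1"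
proof
  assume eq: "gyro_field lam (\<omega>, \<alpha>, \<beta>) = 0"
  then have "\<alpha> \<times> \<omega> = 0" "\<beta> \<times> \<omega> = 0" by (auto simp: gyro_field_def zero_prod_def)
  then have "\<omega> \<times> (\<alpha> \<times> \<beta>) = 0"
    using Jacobi[of \<alpha> \<beta> \<omega>] by (simp add: cross_skew[of \<omega> \<alpha>])
  moreover have "\<omega> \<bullet> (\<alpha> \<times> \<beta>) = 0"
    using \<open>\<beta> \<times> \<omega> = 0\<close> cross_triple[of \<alpha> \<beta> \<omega>] by (simp add: inner_commute)
  ultimately have "\<omega> = 0"
    using norm_and_cross_eq_0[of \<omega> "\<alpha> \<times> \<beta>"] P6_cross_nonzero(2)[OF assms] by simp
  then show "\<omega> = 0 \<and> \<alpha>$3 = 0 \<and> \<beta>$3 = 0 \<and> \<alpha>$2 = \<beta>$1"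
    using eq by (auto simp: gyro_field_def zero_prod_def vec_eq_iff forall_3)
next
  assume "\<omega> = 0 \<and> \<alpha>$3 = 0 \<and> \<beta>$3 = 0 \<and> \<alpha>$2 = \<beta>$1"
  then show "gyro_field lam (\<omega>, \<alpha>, \<beta>) = 0"
    by (simp add: gyro_field_def zero_prod_def vec_eq_iff[of "vector _"] forall_3)
qed

lemma P6_coordinates:
  "(\<omega>, \<alpha>, \<beta>) \<in> P6 a b \<longleftrightarrow> (\<alpha>$1)^2 + (\<alpha>$2)^2 + (\<alpha>$3)^2 = a^2
     \<and> (\<beta>$1)^2 + (\<beta>$2)^2 + (\<beta>$3)^2 = b^2 \<and> \<alpha>$1 * \<beta>$1 + \<alpha>$2 * \<beta>$2 + \<alpha>$3 * \<beta>$3 = 0"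
  by (simp add: P6_def inner_vec_def sum_3 power2_eq_square)

text \<open>The terms of \<open>dG\<close> that contain \<open>\<theta>\<close> through \<open>\<alpha> \<times> \<beta>\<close> combine to a multiple of
\<open>(M \<times> \<gamma>) \<bullet> \<theta>\<close>. The factor 2 on the left avoids denominators.\<close>

lemma dG_variation:
  fixes \<omega> \<alpha> \<beta> :: "real^3" and a b lam :: real
  defines "M1 \<equiv> 2 * \<omega>$1" and "M2 \<equiv> 2 * \<omega>$2" and "M3 \<equiv> \<omega>$3 + lam" and "l \<equiv> \<omega>$3 - lam"
    and "\<gamma> \<equiv> \<alpha> \<times> \<beta>"
  defines "u \<equiv> M1 * \<alpha>$1 + M2 * \<alpha>$2 + M3 * \<alpha>$3" and "v \<equiv> M1 * \<beta>$1 + M2 * \<beta>$2 + M3 * \<beta>$3"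
  shows "2 * dG a b lam (\<omega>, \<alpha>, \<beta>) (variation (\<omega>, \<alpha>, \<beta>) \<delta> \<theta>) =
     2 * (u * \<alpha>$1 + v * \<beta>$1 + l * \<gamma>$1) * \<delta>$1 + 2 * (u * \<alpha>$2 + v * \<beta>$2 + l * \<gamma>$2) * \<delta>$2
     + (u * \<alpha>$3 + v * \<beta>$3 + l * \<gamma>$3 + M1 * \<gamma>$1 + M2 * \<gamma>$2 + M3 * \<gamma>$3) * \<delta>$3
     + (u * (M2 * \<alpha>$3 - M3 * \<alpha>$2) + v * (M2 * \<beta>$3 - M3 * \<beta>$2) + l * (M2 * \<gamma>$3 - M3 * \<gamma>$2)
        - 2 * a^2 * \<beta>$3) * \<theta>$1
     + (u * (M3 * \<alpha>$1 - M1 * \<alpha>$3) + v * (M3 * \<beta>$1 - M1 * \<beta>$3) + l * (M3 * \<gamma>$1 - M1 * \<gamma>$3)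
        + 2 * b^2 * \<alpha>$3) * \<theta>$2
     + (u * (M1 * \<alpha>$2 - M2 * \<alpha>$1) + v * (M1 * \<beta>$2 - M2 * \<beta>$1) + l * (M1 * \<gamma>$2 - M2 * \<gamma>$1)
        - 2 * b^2 * \<alpha>$2 + 2 * a^2 * \<beta>$1) * \<theta>$3"
proof -
  have *: "2 * dG a b lam (\<omega>, \<alpha>, \<beta>) (\<delta>, \<delta>\<alpha>, \<delta>\<beta>) =
      u * (M1 * \<delta>\<alpha>$1 + M2 * \<delta>\<alpha>$2 + M3 * \<delta>\<alpha>$3 + 2 * \<delta>$1 * \<alpha>$1 + 2 * \<delta>$2 * \<alpha>$2 + \<delta>$3 * \<alpha>$3)
    + v * (M1 * \<delta>\<beta>$1 + M2 * \<delta>\<beta>$2 + M3 * \<delta>\<beta>$3 + 2 * \<delta>$1 * \<beta>$1 + 2 * \<delta>$2 * \<beta>$2 + \<delta>$3 * \<beta>$3)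
    + \<delta>$3 * (M1 * \<gamma>$1 + M2 * \<gamma>$2 + M3 * \<gamma>$3)
    + l * (2 * \<delta>$1 * \<gamma>$1 + 2 * \<delta>$2 * \<gamma>$2 + \<delta>$3 * \<gamma>$3
       + M1 * (\<delta>\<alpha>$2 * \<beta>$3 - \<delta>\<alpha>$3 * \<beta>$2 + \<alpha>$2 * \<delta>\<beta>$3 - \<alpha>$3 * \<delta>\<beta>$2)
       + M2 * (\<delta>\<alpha>$3 * \<beta>$1 - \<delta>\<alpha>$1 * \<beta>$3 + \<alpha>$3 * \<delta>\<beta>$1 - \<alpha>$1 * \<delta>\<beta>$3)
       + M3 * (\<delta>\<alpha>$1 * \<beta>$2 - \<delta>\<alpha>$2 * \<beta>$1 + \<alpha>$1 * \<delta>\<beta>$2 - \<alpha>$2 * \<delta>\<beta>$1))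
    - 2 * b^2 * \<delta>\<alpha>$1 - 2 * a^2 * \<delta>\<beta>$2" for \<delta>\<alpha> \<delta>\<beta>
    by (simp add: dG_def Let_def momentum_def inner_vec_def sum_3 M1_def M2_def M3_def l_def u_def v_def
        flip: \<gamma>_def)
       (simp add: cross_components algebra_simps add_divide_distrib diff_divide_distrib)
  show ?thesis
    by (simp only: variation_def prod.case * \<gamma>_def cross_components) algebra
qed

section \<open>The family of special states\<close>

text \<open>The complex coordinates of this state are, with \<open>T = \<lambda> + n\<close> and \<open>w\<^sub>1 = n (p + i q)\<close>:
\<open>w\<^sub>3 = w/n\<close>, \<open>x\<^sub>1 = \<lambda> R - (T/n) w\<^sub>1\<^sup>2\<close>, \<open>y\<^sub>1 = n T - R\<^sup>2 + (R/n) w\<^sub>1\<^sup>2\<close>,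
\<open>z\<^sub>1 = T w\<^sub>1 - R w\<^sub>2\<close>. These are the formulas of the second family of motions for
\<open>\<sigma> = \<lambda> n\<close> and \<open>u = r\<^sup>2 \<lambda>\<^sup>2 n / R\<close>. In the real coordinates a factor \<open>T - R\<close> splits off from \<open>\<alpha>\<close> and
a factor \<open>T + R\<close> from \<open>\<beta>\<close>, and scaling \<open>\<omega>\<^sub>1, \<omega>\<^sub>2\<close> by \<open>n\<close> removes the denominators.\<close>

definition special_state :: "real \<Rightarrow> real \<Rightarrow> real \<Rightarrow> real \<Rightarrow> real \<Rightarrow> state" where
  "special_state lam n R p q =
     (vector [n * p, n * q, n * (p^2 + q^2)],
      (lam + n - R) *\<^sub>R vector [(n + R - n * (p^2 - q^2)) / 2, - n * p * q, n * p],
      (lam + n + R) *\<^sub>R vector [- n * p * q, (n - R + n * (p^2 - q^2)) / 2, n * q])"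

text \<open>The first integral of the planar motion of \<open>(p, q)\<close>: both lengths of \<open>\<alpha>\<close> and \<open>\<beta>\<close> are functions of it.
On the phase space its value times \<open>- n\<^sup>2\<close> is the constant term of the polynomials \<open>P\<^sub>\<plusminus>\<close>.\<close>

definition level :: "real \<Rightarrow> real \<Rightarrow> real \<Rightarrow> real \<Rightarrow> real" where
  "level n R p q = n^2 * (p^2 + q^2)^2 + 2 * n^2 * (p^2 + q^2) - 2 * n * R * (p^2 - q^2)"

lemma special_state_P6:
  assumes "special_state lam n R p q \<in> P6 a b"
  defines "T \<equiv> lam + n" and "Z \<equiv> level n R p q"
  shows "a^2 - b^2 = R * (lam * (n * T - R^2) - T * Z)"
    and "a^2 + b^2 = (T^2 + R^2) * (n^2 + R^2 + Z) / 2 - 2 * T * n * R^2"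
    and "a^2 = (T - R)^2 * (n^2 + R^2 + 2 * n * R + Z) / 4"
    and "b^2 = (T + R)^2 * (n^2 + R^2 - 2 * n * R + Z) / 4"
proof -
  have ab: "a^2 = ((T - R) * ((n + R - n * (p^2 - q^2)) / 2))^2 + ((T - R) * (- n * p * q))^2 + ((T - R) * (n * p))^2"
    "b^2 = ((T + R) * (- n * p * q))^2 + ((T + R) * ((n - R + n * (p^2 - q^2)) / 2))^2 + ((T + R) * (n * q))^2"
    using assms(1) by (simp_all add: special_state_def P6_coordinates T_def)
  show a: "a^2 = (T - R)^2 * (n^2 + R^2 + 2 * n * R + Z) / 4"
    unfolding ab Z_def level_def by (simp add: field_simps) algebra
  show b: "b^2 = (T + R)^2 * (n^2 + R^2 - 2 * n * R + Z) / 4"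
    unfolding ab Z_def level_def by (simp add: field_simps) algebra
  show "a^2 - b^2 = R * (lam * (n * T - R^2) - T * Z)"
    unfolding a b T_def by (simp add: field_simps) algebra
  show "a^2 + b^2 = (T^2 + R^2) * (n^2 + R^2 + Z) / 2 - 2 * T * n * R^2"
    unfolding a b T_def by (simp add: field_simps) algebra
qed

lemma special_state_dK:
  assumes P: "special_state lam n R p q \<in> P6 a b" and "a > 0" "b > 0" and lam: "lam \<noteq> 0"
  shows "\<forall>v\<in>tangent (special_state lam n R p q).
    dK lam (special_state lam n R p q) v = 2 * (lam * n) * dH (special_state lam n R p q) v"
  using P unfolding special_state_def
  by (subst dK_proportional_dH_iff[OF _ assms(2,3)], assumption)
     (simp only: vector_3 vector_scaleR_component real_scaleR_def, intro conjI;
      simp add: field_simps; algebra)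

text \<open>With \<open>N = T\<^sup>2 - R\<^sup>2\<close> the numbers \<open>M\<^sub>\<alpha>\<close>, \<open>M\<^sub>\<beta>\<close> are \<open>N \<omega>\<^sub>1\<close>, \<open>N \<omega>\<^sub>2\<close>, and \<open>\<alpha> \<times> \<beta>\<close> has the factor
\<open>N\<close> as well; all six equations for \<open>dG = \<nu> dH\<close> are divisible by \<open>N\<close>, and the quotients are polynomial
identities of low degree. The value of \<open>\<nu>\<close> is found from any one of the equations.\<close>

lemma special_state_dG:
  assumes P: "special_state lam n R p q \<in> P6 a b" and "a > 0" "b > 0"
  shows "\<exists>\<nu>. \<forall>v\<in>tangent (special_state lam n R p q).
    dG a b lam (special_state lam n R p q) v = \<nu> * dH (special_state lam n R p q) v"
proof -
  define T where "T = lam + n"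
  define Z where "Z = level n R p q"
  define E where "E = Z + R^2 - n^2 - 2 * n * lam"
  define N where "N = T^2 - R^2"
  define F1 F2 where "F1 = n^2 + R^2 + 2 * n * R + Z" and "F2 = n^2 + R^2 - 2 * n * R + Z"
  define w where "w = p^2 + q^2"
  define \<nu> where "\<nu> = - N * E / 4"
  \<comment> \<open>The fields without their factors: \<open>\<alpha> = (T - R) A\<close>, \<open>\<beta> = (T + R) B\<close> and \<open>\<alpha> \<times> \<beta> = N C\<close>.\<close>
  define A1 A2 A3 B1 B2 B3 where AB: "A1 = (n + R - n * (p^2 - q^2)) / 2" "A2 = - n * p * q" "A3 = n * p"
    "B1 = - n * p * q" "B2 = (n - R + n * (p^2 - q^2)) / 2" "B3 = n * q"
  define \<omega> \<alpha> \<beta> where z: "\<omega> = (vector [n * p, n * q, n * w] :: real^3)"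
     "\<alpha> = (vector [(T - R) * A1, (T - R) * A2, (T - R) * A3] :: real^3)"
     "\<beta> = (vector [(T + R) * B1, (T + R) * B2, (T + R) * B3] :: real^3)"
  have state: "special_state lam n R p q = (\<omega>, \<alpha>, \<beta>)"
    by (simp add: special_state_def z T_def w_def AB vec_eq_iff forall_3)
  define C1 C2 C3 where C: "C1 = - n * p / 2 * (n - R + n * w)" "C2 = - n * q / 2 * (n + R + n * w)"
    "C3 = (n^2 - R^2 + 2 * R * n * (p^2 - q^2) - n^2 * w^2) / 4"
  have \<gamma>: "\<alpha>$2 * \<beta>$3 - \<beta>$2 * \<alpha>$3 = N * C1" "\<alpha>$3 * \<beta>$1 - \<beta>$3 * \<alpha>$1 = N * C2"
    "\<alpha>$1 * \<beta>$2 - \<beta>$1 * \<alpha>$2 = N * C3"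
    unfolding z vector_3 AB C N_def w_def by (simp_all add: field_simps) algebra+
  have M\<alpha>: "2 * (n * p) * \<alpha>$1 + 2 * (n * q) * \<alpha>$2 + (n * w + lam) * \<alpha>$3 = N * (n * p)"
    and M\<beta>: "2 * (n * p) * \<beta>$1 + 2 * (n * q) * \<beta>$2 + (n * w + lam) * \<beta>$3 = N * (n * q)"
    unfolding z vector_3 AB N_def T_def w_def by (simp_all add: field_simps) algebra+
  have lam: "lam = T - n" by (simp add: T_def)
  have a2: "a^2 = (T - R)^2 * (n^2 + R^2 + 2 * n * R + Z) / 4"
    and b2: "b^2 = (T + R)^2 * (n^2 + R^2 - 2 * n * R + Z) / 4"
    using special_state_P6(3,4)[OF P] unfolding T_def Z_def by auto
  have Zw: "Z = n^2 * w^2 + 2 * n^2 * w - 2 * n * R * (p^2 - q^2)"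
    by (simp add: Z_def level_def w_def)
  let ?l = "n * w - lam" let ?M3 = "n * w + lam"
  \<comment> \<open>The six equations divided by \<open>N\<close>; the first two are also divided by 2.\<close>
  have c1: "n * p * ((T - R) * A1) + n * q * ((T + R) * B1) + ?l * C1 = - E / 2 * (n * p)"
    and c2: "n * p * ((T - R) * A2) + n * q * ((T + R) * B2) + ?l * C2 = - E / 2 * (n * q)"
    and c3: "n * p * ((T - R) * A3) + n * q * ((T + R) * B3) + ?l * C3
      + 2 * (n * p) * C1 + 2 * (n * q) * C2 + ?M3 * C3 = - E / 2 * (n * w)"
    and c4: "n * p * (2 * (n * q) * ((T - R) * A3) - ?M3 * ((T - R) * A2))
      + n * q * (2 * (n * q) * ((T + R) * B3) - ?M3 * ((T + R) * B2))
      + ?l * (2 * (n * q) * C3 - ?M3 * C2)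
      - (T - R) * F1 / 2 * B3 = E / 2 * ((T + R) * B3)"
    and c5: "n * p * (?M3 * ((T - R) * A1) - 2 * (n * p) * ((T - R) * A3))
      + n * q * (?M3 * ((T + R) * B1) - 2 * (n * p) * ((T + R) * B3))
      + ?l * (?M3 * C1 - 2 * (n * p) * C3)
      + (T + R) * F2 / 2 * A3 = - E / 2 * ((T - R) * A3)"
    and c6: "n * p * (2 * (n * p) * ((T - R) * A2) - 2 * (n * q) * ((T - R) * A1))
      + n * q * (2 * (n * p) * ((T + R) * B2) - 2 * (n * q) * ((T + R) * B1))
      + ?l * (2 * (n * p) * C2 - 2 * (n * q) * C1)
      - (T + R) * F2 / 2 * A2 + (T - R) * F1 / 2 * B1
      = E / 2 * ((T - R) * A2 - (T + R) * B1)"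
    unfolding AB C E_def F1_def F2_def Zw w_def lam by (simp_all add: field_simps) algebra+
  \<comment> \<open>The squared lengths supply the missing factor of \<open>N\<close> in the terms with \<open>a\<^sup>2\<close> and \<open>b\<^sup>2\<close>.\<close>
  have a2N: "a^2 * (T + R) = N * ((T - R) * F1 / 4)"
    and b2N: "b^2 * (T - R) = N * ((T + R) * F2 / 4)"
    unfolding a2 b2 N_def F1_def F2_def by (simp_all add: field_simps power2_eq_square)
  have e1: "2 * (N * (n * p) * ((T - R) * A1) + N * (n * q) * ((T + R) * B1) + ?l * (N * C1)) = 4 * \<nu> * (n * p)"
    using c1 unfolding \<nu>_def by algebra
  have e2: "2 * (N * (n * p) * ((T - R) * A2) + N * (n * q) * ((T + R) * B2) + ?l * (N * C2)) = 4 * \<nu> * (n * q)"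
    using c2 unfolding \<nu>_def by algebra
  have e3: "N * (n * p) * ((T - R) * A3) + N * (n * q) * ((T + R) * B3) + ?l * (N * C3)
      + 2 * (n * p) * (N * C1) + 2 * (n * q) * (N * C2) + ?M3 * (N * C3) = 2 * \<nu> * (n * w)"
    using c3 unfolding \<nu>_def by algebra
  have e4: "N * (n * p) * (2 * (n * q) * ((T - R) * A3) - ?M3 * ((T - R) * A2))
      + N * (n * q) * (2 * (n * q) * ((T + R) * B3) - ?M3 * ((T + R) * B2))
      + ?l * (2 * (n * q) * (N * C3) - ?M3 * (N * C2))
      - 2 * a^2 * ((T + R) * B3) = - 2 * \<nu> * ((T + R) * B3)"
    using c4 a2N unfolding \<nu>_def by algebra
  have e5: "N * (n * p) * (?M3 * ((T - R) * A1) - 2 * (n * p) * ((T - R) * A3))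
      + N * (n * q) * (?M3 * ((T + R) * B1) - 2 * (n * p) * ((T + R) * B3))
      + ?l * (?M3 * (N * C1) - 2 * (n * p) * (N * C3))
      + 2 * b^2 * ((T - R) * A3) = 2 * \<nu> * ((T - R) * A3)"
  proof -
    have "2 * b^2 * ((T - R) * A3) = N * ((T + R) * F2 / 2) * A3" using b2N by simp
    then show ?thesis using arg_cong[OF c5, of "\<lambda>x. N * x"]
      by (simp add: \<nu>_def field_simps)
  qed
  have e6: "N * (n * p) * (2 * (n * p) * ((T - R) * A2) - 2 * (n * q) * ((T - R) * A1))
      + N * (n * q) * (2 * (n * p) * ((T + R) * B2) - 2 * (n * q) * ((T + R) * B1))
      + ?l * (2 * (n * p) * (N * C2) - 2 * (n * q) * (N * C1))
      - 2 * b^2 * ((T - R) * A2) + 2 * a^2 * ((T + R) * B1)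
      = - 2 * \<nu> * ((T - R) * A2 - (T + R) * B1)"
  proof -
    have "2 * b^2 * ((T - R) * A2) = N * ((T + R) * F2 / 2) * A2"
      "2 * a^2 * ((T + R) * B1) = N * ((T - R) * F1 / 2) * B1" using a2N b2N by simp_all
    then show ?thesis using arg_cong[OF c6, of "\<lambda>x. N * x"]
      by (simp add: \<nu>_def field_simps)
  qed
  have "dG a b lam (\<omega>, \<alpha>, \<beta>) (variation (\<omega>, \<alpha>, \<beta>) \<delta> \<theta>)
      = \<nu> * dH (\<omega>, \<alpha>, \<beta>) (variation (\<omega>, \<alpha>, \<beta>) \<delta> \<theta>)" for \<delta> \<theta>
  proof -
    have \<omega>: "\<omega>$1 = n * p" "\<omega>$2 = n * q" "\<omega>$3 = n * w" by (simp_all add: z)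
    have \<alpha>: "\<alpha>$1 = (T - R) * A1" "\<alpha>$2 = (T - R) * A2" "\<alpha>$3 = (T - R) * A3"
      and \<beta>: "\<beta>$1 = (T + R) * B1" "\<beta>$2 = (T + R) * B2" "\<beta>$3 = (T + R) * B3" by (simp_all add: z)
    have "2 * dG a b lam (\<omega>, \<alpha>, \<beta>) (variation (\<omega>, \<alpha>, \<beta>) \<delta> \<theta>)
      = 2 * \<nu> * dH (\<omega>, \<alpha>, \<beta>) (variation (\<omega>, \<alpha>, \<beta>) \<delta> \<theta>)"
      unfolding dG_variation dH_variation \<omega> cross_components
      unfolding \<gamma> M\<alpha> M\<beta>
      unfolding \<alpha> \<beta>
      unfolding e1 e2 e3 e4 e5 e6 by (simp add: algebra_simps)
    then show ?thesis by simp
  qed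
  then show ?thesis
    unfolding state using tangent_eq_variations[OF P assms(2,3)] by (auto simp: state)
qed

section \<open>Critical points with nonzero horizontal angular velocity\<close>

text \<open>The equations are linear in \<open>\<alpha>\<^sub>3, \<beta>\<^sub>3\<close> and then in \<open>y\<^sub>1\<close>, and determine them from \<open>\<omega>\<close> and the complex
number \<open>R + i S\<close>, which is \<open>\<rho>/\<lambda>\<close>. The constraints give
\<open>R B = a\<^sup>2 - b\<^sup>2\<close> and \<open>S B = 2 \<alpha> \<bullet> \<beta> = 0\<close> with the same factor \<open>B\<close>. Since \<open>a \<noteq> b\<close>, this forces \<open>S = 0\<close> and
\<open>R \<noteq> 0\<close>.\<close>

lemma special_state_if_critical:
  fixes \<omega> \<alpha> \<beta> :: "real^3"
  assumes P: "(\<omega>, \<alpha>, \<beta>) \<in> P6 a b" and ab: "a > b" "b > 0" and lam: "lam \<noteq> 0"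
    and crit: "\<forall>v\<in>tangent (\<omega>, \<alpha>, \<beta>). dK lam (\<omega>, \<alpha>, \<beta>) v = 2 * \<mu> * dH (\<omega>, \<alpha>, \<beta>) v"
    and nz: "\<omega>$1 \<noteq> 0 \<or> \<omega>$2 \<noteq> 0"
  shows "\<exists>n R p q. n \<noteq> 0 \<and> R \<noteq> 0 \<and> (\<omega>, \<alpha>, \<beta>) = special_state lam n R p q"
proof -
  have "a > 0" using ab by simp
  note eqs = crit[unfolded dK_proportional_dH_iff[OF P \<open>a > 0\<close> \<open>b > 0\<close>]]
  have w: "(\<omega>$1)^2 + (\<omega>$2)^2 > 0" using nz by (simp add: sum_power2_gt_zero_iff)
  then have "\<mu> \<noteq> 0" using eqs lam by auto
  define n where "n = \<mu> / lam"
  have \<mu>: "\<mu> = lam * n" and n: "n \<noteq> 0" using lam \<open>\<mu> \<noteq> 0\<close> by (auto simp: n_def)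
  define p q where pq_def: "p = \<omega>$1 / n" "q = \<omega>$2 / n"
  have \<omega>: "\<omega>$1 = n * p" "\<omega>$2 = n * q" using n by (simp_all add: pq_def)
  have pq: "p^2 + q^2 \<noteq> 0"
    using w unfolding \<omega> by (auto simp: sum_power2_eq_zero_iff)
  have \<omega>3: "\<omega>$3 = n * (p^2 + q^2)"
  proof -
    have "lam * n * (n * (p^2 + q^2)) = lam * n * \<omega>$3"
      using eqs unfolding \<omega> \<mu> by (simp add: algebra_simps power2_eq_square)
    then show ?thesis using lam n by simp
  qed
  define T where "T = lam + n"
  define R S where RS: "R = (\<alpha>$1 - \<beta>$2 + T * n * (p^2 - q^2)) / lam" "S = (\<alpha>$2 + \<beta>$1 + 2 * T * n * p * q) / lam"
  define yr yi where y: "yr = \<alpha>$1 + \<beta>$2" "yi = \<alpha>$2 - \<beta>$1"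
  have x: "\<alpha>$1 - \<beta>$2 = lam * R - T * n * (p^2 - q^2)" "\<alpha>$2 + \<beta>$1 = lam * S - 2 * T * n * p * q"
    using lam by (simp_all add: RS)
  have XY: "(n * p)^2 - (n * q)^2 + \<alpha>$1 - \<beta>$2 = lam * (R - n * (p^2 - q^2))"
    "2 * (n * p) * (n * q) + \<alpha>$2 + \<beta>$1 = lam * (S - 2 * n * p * q)"
    using x unfolding T_def by (simp_all add: algebra_simps power2_eq_square)
  note eqs' = eqs[unfolded \<omega> \<omega>3 XY \<mu>]
  have "lam * (\<alpha>$3 - n * (T * p - R * p - S * q)) = 0" "lam * (\<beta>$3 - n * (T * q - S * p + R * q)) = 0"
    using eqs' unfolding T_def by (simp_all add: algebra_simps power2_eq_square)
  then have z: "\<alpha>$3 = n * (T * p - R * p - S * q)" "\<beta>$3 = n * (T * q - S * p + R * q)"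
    using lam by simp_all
  have d: "\<alpha>$1 = (lam * R - T * n * (p^2 - q^2) + yr) / 2" "\<beta>$2 = (yr - lam * R + T * n * (p^2 - q^2)) / 2"
    "\<alpha>$2 = (lam * S - 2 * T * n * p * q + yi) / 2" "\<beta>$1 = (lam * S - 2 * T * n * p * q - yi) / 2"
    using x by (simp_all add: y)
  have d2: "2 * \<alpha>$1 = lam * R - T * n * (p^2 - q^2) + yr" "2 * \<beta>$2 = yr - lam * R + T * n * (p^2 - q^2)"
    "2 * \<alpha>$2 = lam * S - 2 * T * n * p * q + yi" "2 * \<beta>$1 = lam * S - 2 * T * n * p * q - yi"
    unfolding d by simp_all
  have e4: "(S - 2 * n * p * q) * \<beta>$3 + (R - n * (p^2 - q^2)) * \<alpha>$3 + n * \<alpha>$3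
      = n * (p * (lam * R - T * n * (p^2 - q^2) + yr) + q * (lam * S - 2 * T * n * p * q - yi))"
  proof -
    have "lam * ((S - 2 * n * p * q) * \<beta>$3 + (R - n * (p^2 - q^2)) * \<alpha>$3 + n * \<alpha>$3)
        = lam * (2 * n * (p * \<alpha>$1 + q * \<beta>$1))"
      using eqs' by (simp add: algebra_simps)
    then have "(S - 2 * n * p * q) * \<beta>$3 + (R - n * (p^2 - q^2)) * \<alpha>$3 + n * \<alpha>$3 = 2 * n * (p * \<alpha>$1 + q * \<beta>$1)"
      using lam by (simp only: mult_cancel_left) simp
    also have "\<dots> = n * (p * (2 * \<alpha>$1) + q * (2 * \<beta>$1))" by simp
    finally show ?thesis unfolding d2 .
  qed
  have e5: "(S - 2 * n * p * q) * \<alpha>$3 - (R - n * (p^2 - q^2)) * \<beta>$3 + n * \<beta>$3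
      = n * (p * (lam * S - 2 * T * n * p * q + yi) + q * (yr - lam * R + T * n * (p^2 - q^2)))"
  proof -
    have "lam * ((S - 2 * n * p * q) * \<alpha>$3 - (R - n * (p^2 - q^2)) * \<beta>$3 + n * \<beta>$3)
        = lam * (2 * n * (p * \<alpha>$2 + q * \<beta>$2))"
      using eqs' by (simp add: algebra_simps)
    then have "(S - 2 * n * p * q) * \<alpha>$3 - (R - n * (p^2 - q^2)) * \<beta>$3 + n * \<beta>$3 = 2 * n * (p * \<alpha>$2 + q * \<beta>$2)"
      using lam by (simp only: mult_cancel_left) simp
    also have "\<dots> = n * (p * (2 * \<alpha>$2) + q * (2 * \<beta>$2))" by simp
    finally show ?thesis unfolding d2 .
  qed
  \<comment> \<open>In complex form this is \<open>w\<^sub>1 (y\<^sub>1 - ...) = 0\<close>; multiplication by \<open>w\<^sub>2\<close> separates the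
    real and the imaginary part of \<open>y\<^sub>1\<close>.\<close>
  have "n * (p^2 + q^2) * (yr - (n * T - R^2 - S^2 + n * (R * (p^2 - q^2) + 2 * S * p * q))) = 0"
    "n * (p^2 + q^2) * (yi - n * (2 * R * p * q - S * (p^2 - q^2))) = 0"
    using e4 e5 unfolding z T_def by algebra+
  then have yy: "yr = n * T - R^2 - S^2 + n * (R * (p^2 - q^2) + 2 * S * p * q)"
    "yi = n * (2 * R * p * q - S * (p^2 - q^2))"
    using n pq by auto
  define B where "B = T * n * (- 2 * n * (p^2 + q^2) + 2 * R * (p^2 - q^2) + 4 * S * p * q - n * (p^2 + q^2)^2)
    + lam * (n * T - R^2 - S^2)"
  have P': "(\<alpha>$1)^2 + (\<alpha>$2)^2 + (\<alpha>$3)^2 = a^2" "(\<beta>$1)^2 + (\<beta>$2)^2 + (\<beta>$3)^2 = b^2"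
    "\<alpha>$1 * \<beta>$1 + \<alpha>$2 * \<beta>$2 + \<alpha>$3 * \<beta>$3 = 0"
    using P unfolding P6_coordinates by auto
  have "S * B = 2 * (\<alpha>$1 * \<beta>$1 + \<alpha>$2 * \<beta>$2 + \<alpha>$3 * \<beta>$3)"
    unfolding d z yy B_def T_def by (simp add: field_simps) algebra
  then have SB: "S * B = 0" using P' by simp
  have "R * B = (\<alpha>$1)^2 + (\<alpha>$2)^2 + (\<alpha>$3)^2 - ((\<beta>$1)^2 + (\<beta>$2)^2 + (\<beta>$3)^2)"
    unfolding d z yy B_def T_def by (simp add: field_simps) algebra
  then have "R * B = a^2 - b^2" using P' by simp
  moreover have "b^2 < a^2" using ab by (intro power_strict_mono) auto
  ultimately have "R \<noteq> 0" "B \<noteq> 0" by auto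
  with SB have S: "S = 0" by simp
  have "(\<omega>, \<alpha>, \<beta>) = special_state lam n R p q"
    unfolding special_state_def
    by (simp add: vec_eq_iff forall_3 \<omega> \<omega>3 d z yy S T_def field_simps power2_eq_square)
  then show ?thesis using n \<open>R \<noteq> 0\<close> by blast
qed

section \<open>The special states in the complex coordinates\<close>

lemma rr_pp_squares:
  assumes "a > b" "b > 0"
  shows "(rr a b)^2 = a^2 - b^2" "(pp a b)^2 = a^2 + b^2" "a^2 - b^2 > 0"
    "(rr a b)^4 = (a^2 - b^2)^2" "(rr a b)^8 = (a^2 - b^2)^4"
proof -
  show "a^2 - b^2 > 0" using assms by (simp add: power_strict_mono)
  then show r: "(rr a b)^2 = a^2 - b^2" by (simp add: rr_def)
  show "(rr a b)^4 = (a^2 - b^2)^2" "(rr a b)^8 = (a^2 - b^2)^4"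
    unfolding r[symmetric] by (simp_all flip: power_mult)
qed (simp add: pp_def)

locale special_family =
  fixes a b lam n R :: real
  assumes ab: "a > b" "b > 0" and lam: "lam \<noteq> 0" and n: "n \<noteq> 0" and R: "R \<noteq> 0"
begin

abbreviation "\<sigma> \<equiv> lam * n"
definition "u = (a^2 - b^2) * lam^2 * n / R"

lemma u_nonzero: "u \<noteq> 0"
  unfolding u_def using rr_pp_squares(3)[OF ab] lam n R by simp

text \<open>The difference of the two constraints gives \<open>T Z\<close> and their sum gives
\<open>(T\<^sup>2 + R\<^sup>2) Z\<close>, where \<open>Z\<close> is the level. The first yields the generic formula for the coefficient after
division by \<open>T\<close>, the second its value at \<open>T = 0\<close>, that is, at \<open>\<lambda>\<^sup>2 + \<sigma> = 0\<close>.\<close>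

lemma const_coeff_special:
  assumes "special_state lam n R p q \<in> P6 a b"
  shows "const_coeff a b lam \<sigma> u = - (n^2 * level n R p q)"
proof -
  define T where "T = lam + n"
  define Z where "Z = level n R p q"
  define r2 where "r2 = a^2 - b^2"
  have r2: "r2 = R * (lam * (n * T - R^2) - T * Z)"
    unfolding r2_def T_def Z_def by (rule special_state_P6(1)[OF assms])
  have r2_nz: "r2 \<noteq> 0" using rr_pp_squares(3)[OF ab] unfolding r2_def by simp
  have p2: "a^2 + b^2 = (T^2 + R^2) * (n^2 + R^2 + Z) / 2 - 2 * T * n * R^2"
    unfolding T_def Z_def by (rule special_state_P6(2)[OF assms])
  have r4: "rr a b ^ 4 = r2^2"
    unfolding r2_def by (rule rr_pp_squares(4)[OF ab])
  have \<tau>: "lam^2 + \<sigma> = lam * T" by (simp add: T_def power2_eq_square algebra_simps)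
  have u: "u = r2 * lam^2 * n / R" by (simp add: u_def r2_def)
  show ?thesis
  proof (cases "T = 0")
    case False
    have TZ: "T * Z = lam * (n * T - R^2) - r2 / R" using r2 R by (simp add: field_simps)
    have "\<sigma> * (u^3 - lam * T * \<sigma>^2 * u^2 + r2^2 * lam^4 * \<sigma>^3)
        = - (n^2 * (T * Z) * lam * lam^2 * u^2)"
      unfolding TZ u using R by (simp add: field_simps power_numeral_reduce)
    then show ?thesis
      unfolding const_coeff_def Let_def r4 \<tau> Z_def[symmetric] using False lam u_nonzero
      by (simp add: field_simps)
  next
    case True
    then have nl: "n = - lam" by (simp add: T_def)
    have u': "u = - (r2 * lam^3 / R)"
      unfolding u by (simp add: nl power_numeral_reduce)
    have "lam^4 + r2^2 * lam^8 / u^2 - 2 * (a^2 + b^2) * u^2 / (r2^2 * lam^4) = - (n^2 * Z)"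
      unfolding p2 True u' unfolding nl using lam R r2_nz by (simp add: field_simps power_numeral_reduce)
    then show ?thesis
      unfolding const_coeff_def Let_def r4 \<tau> Z_def[symmetric] rr_pp_squares(2)[OF ab] using True by simp
  qed
qed

text \<open>Eliminating the level from the two constraints leaves one relation between \<open>n\<close> and \<open>R\<close>, the
fact \<open>bracket\<close> below. Substituting \<open>R = r\<^sup>2 \<lambda>\<^sup>2 n / u\<close> and clearing denominators turns it into the curve
equation.\<close>

lemma on_curve_special:
  assumes "special_state lam n R p q \<in> P6 a b"
  shows "on_curve a b lam \<sigma> u"
proof -
  define T where "T = lam + n"
  define Z where "Z = level n R p q"
  define r2 where "r2 = a^2 - b^2"
  have r2: "r2 = R * (lam * (n * T - R^2) - T * Z)"
    unfolding r2_def T_def Z_def by (rule special_state_P6(1)[OF assms])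
  have p2: "a^2 + b^2 = (T^2 + R^2) * (n^2 + R^2 + Z) / 2 - 2 * T * n * R^2"
    unfolding T_def Z_def by (rule special_state_P6(2)[OF assms])
  have r: "rr a b ^ 4 = r2^2" "rr a b ^ 8 = r2^4"
    unfolding r2_def by (rule rr_pp_squares[OF ab])+
  have \<tau>: "lam^2 + \<sigma> = lam * T" by (simp add: T_def power2_eq_square algebra_simps)
  have u: "u = r2 * lam^2 * n / R" by (simp add: u_def r2_def)
  have bracket: "r2 * (T^2 + R^2) + T * R * (2 * (a^2 + b^2) - n * T^3) + 2 * n * T^2 * R^3 - n * R^5 = 0"
    unfolding p2 unfolding r2 T_def by (simp add: field_simps) algebra
  have "R^5 * (lam^2 * (lam * T)^2 * u^5 + lam * T * (2 * (a^2 + b^2) * lam^4 - (lam * T)^3 * \<sigma>) * \<sigma> * u^4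
       + r2^2 * lam^6 * \<sigma>^2 * u^3 + 2 * r2^2 * lam^4 * \<sigma>^4 * (lam * T)^2 * u^2 - r2^4 * lam^8 * \<sigma>^6)
     = r2^4 * lam^14 * n^5 * (r2 * (T^2 + R^2) + T * R * (2 * (a^2 + b^2) - n * T^3) + 2 * n * T^2 * R^3 - n * R^5)"
    unfolding u using R by (simp add: field_simps power_numeral_reduce)
  then show ?thesis
    unfolding on_curve_def Let_def r \<tau> rr_pp_squares(2)[OF ab] bracket using R by simp
qed

text \<open>The numerator of \<open>Q\<close> is \<open>(\<lambda>\<^sup>2 + \<sigma>) \<lambda>\<^sup>2 u\<^sup>2\<close> times \<open>w\<^sup>2 + 2 n\<^sup>2 w\<close> plus the constant coefficient, so that
\<open>Q\<close> is expressed by the level. The result says \<open>2 Q w = w\<^sub>1\<^sup>2 + w\<^sub>2\<^sup>2\<close>, which is the equation for \<open>q(w)\<close>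
with \<open>q = w\<^sub>1 / \<surd>w\<close>.\<close>

lemma Qfun_special:
  assumes "special_state lam n R p q \<in> P6 a b" and pq: "p^2 + q^2 \<noteq> 0"
  defines "w \<equiv> n^2 * (p^2 + q^2)"
  shows "Qfun a b lam \<sigma> u w * w = n^2 * (p^2 - q^2)"
proof -
  define T where "T = lam + n"
  define c where "c = const_coeff a b lam \<sigma> u"
  define r2 where "r2 = a^2 - b^2"
  have r2: "r2 \<noteq> 0" using rr_pp_squares(3)[OF ab] unfolding r2_def by simp
  have r: "rr a b ^ 4 = r2^2" "rr a b ^ 2 = r2"
    unfolding r2_def by (rule rr_pp_squares[OF ab])+
  have \<tau>: "lam^2 + \<sigma> = lam * T" by (simp add: T_def power2_eq_square algebra_simps)
  have u: "u = r2 * lam^2 * n / R" by (simp add: u_def r2_def)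
  have w0: "w \<noteq> 0" using n pq by (simp add: w_def)
  have "Qfun a b lam \<sigma> u w = u * (w^2 + 2 * n^2 * w + c) / (2 * r2 * \<sigma>^2 * w)"
  proof (cases "T = 0")
    case False
    have c: "\<sigma> * (u^3 - lam * T * \<sigma>^2 * u^2 + r2^2 * lam^4 * \<sigma>^3) = c * (lam * T * lam^2 * u^2)"
      unfolding c_def const_coeff_def Let_def r \<tau> using False lam u_nonzero by simp
    have "\<sigma> * u^3 + lam * T * (lam^2 * w^2 + \<sigma>^2 * (2 * w - \<sigma>)) * u^2 + r2^2 * lam^4 * \<sigma>^4
      = lam * T * (lam^2 * w^2 + \<sigma>^2 * (2 * w)) * u^2
        + \<sigma> * (u^3 - lam * T * \<sigma>^2 * u^2 + r2^2 * lam^4 * \<sigma>^3)"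
      by (simp add: algebra_simps power_numeral_reduce)
    also have "\<dots> = (lam * T * lam^2 * u^2) * (w^2 + 2 * n^2 * w + c)"
      unfolding c by (simp add: algebra_simps power2_eq_square)
    finally show ?thesis
      unfolding Qfun_def Let_def r \<tau> using False lam u_nonzero
      by (simp add: divide_simps) (simp add: power2_eq_square power4_eq_xxxx)
  next
    case True
    then have "n = - lam" by (simp add: T_def)
    then show ?thesis
      unfolding Qfun_def Let_def r \<tau> c_def using True by (simp add: power_numeral_reduce)
  qed
  also have "w^2 + 2 * n^2 * w + c = 2 * n^3 * R * (p^2 - q^2)"
    unfolding c_def const_coeff_special[OF assms(1)] level_def w_def
    by (simp add: algebra_simps power_numeral_reduce)
  finally have "Qfun a b lam \<sigma> u w * w = u * (2 * n^3 * R * (p^2 - q^2)) / (2 * r2 * \<sigma>^2)"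
    using w0 by simp
  also have "\<dots> = n^2 * (p^2 - q^2)"
    unfolding u using R n lam r2 by (simp add: field_simps power_numeral_reduce)
  finally show ?thesis .
qed

end

context special_family
begin

text \<open>In terms of \<open>n\<close>, \<open>R\<close> and \<open>w\<^sub>1 = q \<surd>w\<close>, \<open>w\<^sub>2 = \<surd>w / q\<close> the coefficients of the phase-space equations
simplify, because \<open>r\<^sup>2 \<lambda>\<^sup>2 \<sigma> / u = \<lambda> R\<close>.\<close>

lemma special_point_iff:
  "special_point a b lam \<sigma> u k \<zeta> \<longleftrightarrow>
     ww \<zeta> > 0 \<and>
     k^4 - 2 * complex_of_real (Qfun a b lam \<sigma> u (ww \<zeta>)) * k^2 + 1 = 0 \<and>
     w1 \<zeta> = k * complex_of_real (sqrt (ww \<zeta>)) \<and>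
     w2 \<zeta> = complex_of_real (sqrt (ww \<zeta>)) / k \<and>
     w3 \<zeta> = ww \<zeta> / n \<and>
     x1 \<zeta> = of_real (lam * R) - of_real ((lam + n) / n) * w1 \<zeta> ^ 2 \<and>
     x2 \<zeta> = of_real (lam * R) - of_real ((lam + n) / n) * w2 \<zeta> ^ 2 \<and>
     y1 \<zeta> = of_real (n * (lam + n) - R^2) + of_real (R / n) * w1 \<zeta> ^ 2 \<and>
     y2 \<zeta> = of_real (n * (lam + n) - R^2) + of_real (R / n) * w2 \<zeta> ^ 2 \<and>
     z1 \<zeta> = of_real (lam + n) * w1 \<zeta> - of_real R * w2 \<zeta> \<and>
     z2 \<zeta> = of_real (lam + n) * w2 \<zeta> - of_real R * w1 \<zeta>"
    (is "_ \<longleftrightarrow> ?pos \<and> ?root \<and> ?w1 \<and> ?w2 \<and> ?rest")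
proof (cases "?pos \<and> ?w1 \<and> ?w2")
  case False
  then show ?thesis unfolding special_point_def Let_def by blast
next
  case True
  define w where "w = ww \<zeta>"
  define s where "s = complex_of_real (sqrt w)"
  have s: "s * s = of_real w" "s \<noteq> 0"
    using True unfolding s_def w_def by (simp_all flip: of_real_mult)
  have w12: "w1 \<zeta> = k * s" "w2 \<zeta> = s / k" using True unfolding s_def w_def by auto
  have sq: "k^2 * of_real w = w1 \<zeta> ^ 2" "of_real w / k^2 = w2 \<zeta> ^ 2"
    unfolding w12 s(1)[symmetric] by (simp_all add: power2_eq_square)
  have r2: "rr a b ^ 2 = a^2 - b^2" "rr a b ^ 4 = (a^2 - b^2)^2" "a^2 - b^2 \<noteq> 0"
    using rr_pp_squares[OF ab] by simp_all
  define r where "r = a^2 - b^2"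
  have rc: "complex_of_real (rr a b) ^ 2 = of_real r" "complex_of_real (rr a b) ^ 4 = of_real (r^2)"
    unfolding r_def r2(1,2)[symmetric] by simp_all
  have u: "u = r * lam^2 * n / R" and r0: "r \<noteq> 0" using r2(3) by (simp_all add: u_def r_def)
  define L N P where "L = complex_of_real lam" and "N = complex_of_real n" and "P = complex_of_real R"
  have nz: "L \<noteq> 0" "N \<noteq> 0" "P \<noteq> 0" "complex_of_real r \<noteq> 0"
    using lam n R r0 by (simp_all add: L_def N_def P_def)
  have U: "complex_of_real u = of_real r * L^2 * N / P" and S: "complex_of_real \<sigma> = L * N"
    unfolding u by (simp_all add: L_def N_def P_def)
  have x: "1 / (L * N * (of_real r * L^2 * N / P)) * (of_real r * L^2 * (L * N)^2
        - (L^2 + L * N) * (of_real r * L^2 * N / P) * z) = L * P - (L + N) / N * z" for z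
    using nz by (simp add: field_simps power2_eq_square)
  have y: "L * N * (1 + L * N / L^2 - of_real (r^2) * L^2 * (L * N) / (of_real r * L^2 * N / P)^2)
        + of_real r * L^2 / (of_real r * L^2 * N / P) * z = N * (L + N) - P^2 + P / N * z" for z
    using nz by (simp add: field_simps power2_eq_square)
  have z: "- (of_real r * L * (L * N) / (of_real r * L^2 * N / P)) * z + (L^2 + L * N) / L * z'
      = (L + N) * z' - P * z" for z z'
    using nz by (simp add: field_simps power2_eq_square)
  show ?thesis
    unfolding special_point_def Let_def rc S U L_def[symmetric]
    unfolding mult.assoc[of _ "k^2"] mult.assoc[of _ k] w_def[symmetric] s_def[symmetric] sq
      w12(1)[symmetric] w12(2)[symmetric] x y z
    using lam by (simp add: L_def N_def P_def)
qed

lemma special_point_special_state: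
  assumes P: "special_state lam n R p q \<in> P6 a b" and pq: "p^2 + q^2 \<noteq> 0"
  shows "\<exists>k. special_point a b lam \<sigma> u k (special_state lam n R p q)"
proof -
  let ?\<zeta> = "special_state lam n R p q"
  define w where "w = n^2 * (p^2 + q^2)"
  have "p^2 + q^2 > 0" using pq by (simp add: sum_power2_gt_zero_iff)
  then have w: "w > 0" using n by (simp add: w_def)
  have ww: "ww ?\<zeta> = w"
    by (simp add: ww_def w1_def w2_def special_state_def w_def power2_eq_square algebra_simps)
  define W where "W = Complex (n * p) (n * q)"
  have W0: "W \<noteq> 0" using pq n by (auto simp: W_def complex_eq_iff)
  have W: "w1 ?\<zeta> = W" "w2 ?\<zeta> = cnj W"
    by (simp_all add: w1_def w2_def special_state_def W_def complex_eq_iff)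
  define s where "s = complex_of_real (sqrt w)"
  have s: "s * s = W * cnj W" "s \<noteq> 0" "s * s = of_real w"
    using w unfolding s_def W_def w_def
    by (auto simp: complex_eq_iff power2_eq_square algebra_simps simp flip: of_real_mult)
  define k where "k = W / s"
  have k: "W = k * s" "cnj W = s / k" "k \<noteq> 0"
    using s W0 by (auto simp: k_def field_simps)
  have "k^4 - 2 * complex_of_real (Qfun a b lam \<sigma> u w) * k^2 + 1 = 0"
  proof -
    have "complex_of_real (2 * Qfun a b lam \<sigma> u w * w) = W^2 + cnj W ^ 2"
    proof -
      have "Qfun a b lam \<sigma> u w * w = n^2 * (p^2 - q^2)"
        unfolding w_def by (rule Qfun_special[OF P pq])
      then show ?thesis by (simp add: W_def complex_eq_iff power2_eq_square algebra_simps)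
    qed
    also have "\<dots> = s * s * (k^2 + 1 / k^2)"
      unfolding k(2) unfolding k(1) using k(3) by (simp add: field_simps power2_eq_square)
    finally have "s * s * (2 * of_real (Qfun a b lam \<sigma> u w)) = s * s * (k^2 + 1 / k^2)"
      unfolding s(3) by (simp add: algebra_simps)
    then have "2 * of_real (Qfun a b lam \<sigma> u w) = k^2 + 1 / k^2" using s(2) by simp
    then show ?thesis using k(3) by (simp add: field_simps power2_eq_square power4_eq_xxxx)
  qed
  moreover have "w3 ?\<zeta> = w / n"
    using n by (simp add: w3_def special_state_def w_def power2_eq_square)
  moreover have "x1 ?\<zeta> = of_real (lam * R) - of_real ((lam + n) / n) * W^2"
     "x2 ?\<zeta> = of_real (lam * R) - of_real ((lam + n) / n) * cnj W ^ 2"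
     "y1 ?\<zeta> = of_real (n * (lam + n) - R^2) + of_real (R / n) * W^2"
     "y2 ?\<zeta> = of_real (n * (lam + n) - R^2) + of_real (R / n) * cnj W ^ 2"
     "z1 ?\<zeta> = of_real (lam + n) * W - of_real R * cnj W"
     "z2 ?\<zeta> = of_real (lam + n) * cnj W - of_real R * W"
    using n
    by (simp_all add: x1_def x2_def y1_def y2_def z1_def z2_def special_state_def W_def complex_eq_iff
        power2_eq_square Re_divide Im_divide)
       (simp_all add: field_simps power2_eq_square)
  ultimately have "special_point a b lam \<sigma> u k ?\<zeta>"
    unfolding special_point_iff ww W using w k(1,2) by (simp flip: s_def)
  then show ?thesis by blast
qed

end

text \<open>The parameters \<open>n\<close> and \<open>R\<close> depend on \<open>\<sigma>\<close> and \<open>u\<close> only, hence are the same for all points of one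
motion.\<close>

lemma special_state_if_special_point:
  assumes sp: "special_point a b lam \<sigma> u k \<zeta>" and ab: "a > b" "b > 0" and lam: "lam \<noteq> 0"
    and \<sigma>: "\<sigma> \<noteq> 0" and u: "u \<noteq> 0"
  defines "n \<equiv> \<sigma> / lam" and "R \<equiv> (a^2 - b^2) * lam * \<sigma> / u"
  obtains p q where "\<zeta> = special_state lam n R p q" "p^2 + q^2 \<noteq> 0"
proof -
  have r: "a^2 - b^2 \<noteq> 0" using rr_pp_squares(3)[OF ab] by simp
  interpret special_family a b lam n R
    using ab lam \<sigma> u r by unfold_locales (auto simp: n_def R_def)
  have \<sigma>_eq: "\<sigma> = lam * n" using lam by (simp add: n_def)
  have u_eq: "u = special_family.u a b lam n R"
    unfolding u_def using r lam \<sigma> u by (simp add: n_def R_def field_simps power2_eq_square)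
  note sp = sp[unfolded u_eq \<sigma>_eq special_point_iff]
  obtain \<omega> \<alpha> \<beta> where \<zeta>: "\<zeta> = (\<omega>, \<alpha>, \<beta>)" by (cases \<zeta>) auto
  define p q where "p = \<omega>$1 / n" and "q = \<omega>$2 / n"
  have \<omega>: "\<omega>$1 = n * p" "\<omega>$2 = n * q" using n by (simp_all add: p_def q_def)
  have ww: "ww \<zeta> = n^2 * (p^2 + q^2)"
    by (simp add: ww_def w1_def w2_def \<zeta> \<omega> power2_eq_square algebra_simps)
  have W: "w1 \<zeta> = Complex (n * p) (n * q)" "w2 \<zeta> = Complex (n * p) (- (n * q))"
    by (simp_all add: w1_def w2_def \<zeta> \<omega>)
  have \<omega>3: "\<omega>$3 = n * (p^2 + q^2)"
    using sp n unfolding ww by (simp add: w3_def \<zeta> power2_eq_square)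
  have c: "\<alpha>$1 - \<beta>$2 = lam * R - (lam + n) * n * (p^2 - q^2)"
    "\<alpha>$2 + \<beta>$1 = - 2 * (lam + n) * n * p * q"
    "\<alpha>$1 + \<beta>$2 = n * (lam + n) - R^2 + R * n * (p^2 - q^2)"
    "\<alpha>$2 - \<beta>$1 = 2 * R * n * p * q"
    "\<alpha>$3 = (lam + n - R) * (n * p)" "\<beta>$3 = (lam + n + R) * (n * q)"
  proof -
    have "x1 \<zeta> = of_real (lam * R) - of_real ((lam + n) / n) * w1 \<zeta> ^ 2"
      "y1 \<zeta> = of_real (n * (lam + n) - R^2) + of_real (R / n) * w1 \<zeta> ^ 2"
      "z1 \<zeta> = of_real (lam + n) * w1 \<zeta> - of_real R * w2 \<zeta>"
      using sp by blast+
    then show "\<alpha>$1 - \<beta>$2 = lam * R - (lam + n) * n * (p^2 - q^2)"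
      "\<alpha>$2 + \<beta>$1 = - 2 * (lam + n) * n * p * q"
      "\<alpha>$1 + \<beta>$2 = n * (lam + n) - R^2 + R * n * (p^2 - q^2)"
      "\<alpha>$2 - \<beta>$1 = 2 * R * n * p * q"
      "\<alpha>$3 = (lam + n - R) * (n * p)" "\<beta>$3 = (lam + n + R) * (n * q)"
      using n unfolding W
      by (simp_all add: x1_def y1_def z1_def \<zeta> complex_eq_iff power2_eq_square Re_divide Im_divide)
         (simp_all add: field_simps)
  qed
  have d: "\<alpha>$1 = ((lam * R - (lam + n) * n * (p^2 - q^2)) + (n * (lam + n) - R^2 + R * n * (p^2 - q^2))) / 2"
    "\<beta>$2 = ((n * (lam + n) - R^2 + R * n * (p^2 - q^2)) - (lam * R - (lam + n) * n * (p^2 - q^2))) / 2"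
    "\<alpha>$2 = (- 2 * (lam + n) * n * p * q + 2 * R * n * p * q) / 2"
    "\<beta>$1 = (- 2 * (lam + n) * n * p * q - 2 * R * n * p * q) / 2"
    unfolding c(1-4)[symmetric] by simp_all
  have "\<zeta> = special_state lam n R p q"
    unfolding special_state_def \<zeta>
    by (simp add: vec_eq_iff forall_3 \<omega> \<omega>3 d c(5,6) field_simps power2_eq_square)
  moreover have "p^2 + q^2 \<noteq> 0" using sp unfolding ww by auto
  ultimately show ?thesis using that by blast
qed

section \<open>Motions and their limits\<close>

lemma vector_3_as_sum: "(vector [x, y, z] :: real^3) = x *\<^sub>R axis 1 1 + y *\<^sub>R axis 2 1 + z *\<^sub>R axis 3 1"
  by (simp add: vec_eq_iff forall_3 axis_def)

lemma has_vector_derivative_vector_3: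
  assumes "(f has_real_derivative f') (at t)" "(g has_real_derivative g') (at t)"
    "(h has_real_derivative h') (at t)"
  shows "((\<lambda>t. vector [f t, g t, h t] :: real^3) has_vector_derivative vector [f', g', h']) (at t)"
  unfolding vector_3_as_sum
  using assms by (auto intro!: derivative_eq_intros)

lemma tendsto_vector_3:
  assumes "(f \<longlongrightarrow> f') F" "(g \<longlongrightarrow> g') F" "(h \<longlongrightarrow> h') F"
  shows "((\<lambda>t. vector [f t, g t, h t] :: real^3) \<longlongrightarrow> vector [f', g', h']) F"
  unfolding vector_3_as_sum using assms by (intro tendsto_intros)

lemma isCont_gyro_field: "isCont (gyro_field lam) \<zeta>"
proof -
  have *: "((\<lambda>\<zeta>::state. fst \<zeta> $ i) \<longlongrightarrow> fst \<zeta> $ i) (at \<zeta>)"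
    "((\<lambda>\<zeta>::state. fst (snd \<zeta>) $ i) \<longlongrightarrow> fst (snd \<zeta>) $ i) (at \<zeta>)"
    "((\<lambda>\<zeta>::state. snd (snd \<zeta>) $ i) \<longlongrightarrow> snd (snd \<zeta>) $ i) (at \<zeta>)" for i
    by (intro tendsto_intros)+
  show ?thesis
    unfolding isCont_def gyro_field_def case_prod_beta cross3_def
    by (intro tendsto_Pair tendsto_vector_3 tendsto_intros *) auto
qed

lemma gyro_field_coordinates:
  assumes "(\<gamma> has_vector_derivative gyro_field lam (\<omega>, \<alpha>, \<beta>)) (at t)"
  shows "((\<lambda>t. fst (\<gamma> t) $ 1) has_real_derivative (\<omega>$2 * (\<omega>$3 - lam) + \<beta>$3) / 2) (at t)"
    "((\<lambda>t. fst (\<gamma> t) $ 2) has_real_derivative (- \<omega>$1 * (\<omega>$3 - lam) - \<alpha>$3) / 2) (at t)"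
    "((\<lambda>t. fst (snd (\<gamma> t))) has_vector_derivative \<alpha> \<times> \<omega>) (at t)"
    "((\<lambda>t. snd (snd (\<gamma> t))) has_vector_derivative \<beta> \<times> \<omega>) (at t)"
proof -
  have *: "((\<lambda>t. f (\<gamma> t)) has_vector_derivative f (gyro_field lam (\<omega>, \<alpha>, \<beta>))) (at t)"
    if "bounded_linear f" for f :: "state \<Rightarrow> 'b::real_normed_vector"
    by (rule bounded_linear.has_vector_derivative[OF that assms])
  show "((\<lambda>t. fst (\<gamma> t) $ 1) has_real_derivative (\<omega>$2 * (\<omega>$3 - lam) + \<beta>$3) / 2) (at t)"
    "((\<lambda>t. fst (\<gamma> t) $ 2) has_real_derivative (- \<omega>$1 * (\<omega>$3 - lam) - \<alpha>$3) / 2) (at t)"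
    using *[OF bounded_linear_compose[OF bounded_linear_vec_nth bounded_linear_fst], of 1]
      *[OF bounded_linear_compose[OF bounded_linear_vec_nth bounded_linear_fst], of 2]
    by (simp_all add: gyro_field_def has_real_derivative_iff_has_vector_derivative)
  show "((\<lambda>t. fst (snd (\<gamma> t))) has_vector_derivative \<alpha> \<times> \<omega>) (at t)"
    using *[OF bounded_linear_compose[OF bounded_linear_fst bounded_linear_snd]]
    by (simp add: gyro_field_def)
  show "((\<lambda>t. snd (snd (\<gamma> t))) has_vector_derivative \<beta> \<times> \<omega>) (at t)"
    using *[OF bounded_linear_compose[OF bounded_linear_snd bounded_linear_snd]]
    by (simp add: gyro_field_def)
qed

lemma inner_constant_if_rotating:
  fixes x y \<omega> :: "real \<Rightarrow> real^3"
  assumes "\<And>t. (x has_vector_derivative x t \<times> \<omega> t) (at t)" "\<And>t. (y has_vector_derivative y t \<times> \<omega> t) (at t)"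
  shows "x t \<bullet> y t = x s \<bullet> y s"
proof -
  have "((\<lambda>t. x t \<bullet> y t) has_real_derivative 0) (at t)" for t
  proof -
    have "((\<lambda>t. x t \<bullet> y t) has_vector_derivative x t \<bullet> (y t \<times> \<omega> t) + (x t \<times> \<omega> t) \<bullet> y t) (at t)"
      using bounded_bilinear.has_vector_derivative[OF bounded_bilinear_inner assms] by simp
    moreover have "x t \<bullet> (y t \<times> \<omega> t) + (x t \<times> \<omega> t) \<bullet> y t = 0"
      by (simp add: cross3_simps)
    ultimately show ?thesis by (simp add: has_real_derivative_iff_has_vector_derivative)
  qed
  then show ?thesis using DERIV_isconst_all[of "\<lambda>t. x t \<bullet> y t" t s] by blast
qed

text \<open>Both fields rotate with the same angular velocity, so their inner products are constant and the
constraints need to be checked at one time only.\<close>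

lemma motionI:
  assumes der: "\<And>t. (\<gamma> has_vector_derivative gyro_field lam (\<gamma> t)) (at t)" and P: "\<gamma> 0 \<in> P6 a b"
  shows "motion a b lam \<gamma>"
proof -
  have "\<gamma> t \<in> P6 a b" for t
  proof -
    define \<omega> \<alpha> \<beta> where d: "\<omega> = (\<lambda>t. fst (\<gamma> t))" "\<alpha> = (\<lambda>t. fst (snd (\<gamma> t)))" "\<beta> = (\<lambda>t. snd (snd (\<gamma> t)))"
    have \<gamma>: "\<gamma> t = (\<omega> t, \<alpha> t, \<beta> t)" for t by (simp add: d)
    have "(\<gamma> has_vector_derivative gyro_field lam (\<omega> t, \<alpha> t, \<beta> t)) (at t)" for t
      using der[of t] \<gamma> by simp
    from gyro_field_coordinates(3,4)[OF this]
    have \<alpha>: "(\<alpha> has_vector_derivative \<alpha> t \<times> \<omega> t) (at t)"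
      and \<beta>: "(\<beta> has_vector_derivative \<beta> t \<times> \<omega> t) (at t)" for t
      unfolding d by auto
    show ?thesis
      using P inner_constant_if_rotating[OF \<alpha> \<alpha>, of t 0] inner_constant_if_rotating[OF \<beta> \<beta>, of t 0]
        inner_constant_if_rotating[OF \<alpha> \<beta>, of t 0]
      unfolding \<gamma> P6_def by simp
  qed
  then show ?thesis using der unfolding motion_def by blast
qed

lemma closed_P6: "closed (P6 a b)"
proof -
  have "continuous_on UNIV constraints"
    using has_derivative_continuous[OF constraints_has_derivative]
    by (simp add: continuous_at_imp_continuous_on)
  then have "closed (constraints -` {(a^2, b^2, 0)})"
    by (intro closed_vimage) auto
  moreover have "constraints -` {(a^2, b^2, 0)} = P6 a b"
    by (auto simp: constraints_def P6_def)
  ultimately show ?thesis by simp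
qed

lemma limit_of_motion:
  assumes m: "motion a b lam \<gamma>" and lim: "(\<gamma> \<longlongrightarrow> \<epsilon>) at_top"
  shows "gyro_field lam \<epsilon> = 0" "\<epsilon> \<in> P6 a b"
proof -
  show "gyro_field lam \<epsilon> = 0"
    using limit_of_solution_is_equilibrium[OF _ lim isCont_gyro_field] m unfolding motion_def by blast
  show "\<epsilon> \<in> P6 a b"
    by (rule Lim_in_closed_set[OF closed_P6 _ _ lim]) (use m in \<open>auto simp: motion_def\<close>)
qed

lemma limit_of_motion_at_bot:
  assumes m: "motion a b lam \<gamma>" and lim: "((\<lambda>t. \<gamma> (0 - t)) \<longlongrightarrow> \<epsilon>) at_top"
  shows "gyro_field lam \<epsilon> = 0" "\<epsilon> \<in> P6 a b"
proof -
  have "((\<lambda>t. \<gamma> (0 - t)) has_vector_derivative - gyro_field lam (\<gamma> (0 - t))) (at t)" for t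
    using m unfolding motion_def by (intro time_reversed_solution) blast
  then have "- gyro_field lam \<epsilon> = 0"
    by (rule limit_of_solution_is_equilibrium[OF _ lim]) (intro continuous_intros isCont_gyro_field)
  then show "gyro_field lam \<epsilon> = 0" by simp
  show "\<epsilon> \<in> P6 a b"
    by (rule Lim_in_closed_set[OF closed_P6 _ _ lim]) (use m in \<open>auto simp: motion_def\<close>)
qed

lemma nonconstant_if_not_equilibrium:
  assumes "motion a b lam \<gamma>" "gyro_field lam (\<gamma> t) \<noteq> 0"
  shows "\<not> \<gamma> constant_on UNIV"
proof
  assume "\<gamma> constant_on UNIV"
  then obtain c where "\<And>t. \<gamma> t = c" unfolding constant_on_def by blast
  then have "\<gamma> = (\<lambda>_. c)" by (rule ext)
  then have "(\<gamma> has_vector_derivative 0) (at t)" by (auto intro!: derivative_eq_intros)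
  moreover have "(\<gamma> has_vector_derivative gyro_field lam (\<gamma> t)) (at t)"
    using assms(1) by (simp add: motion_def)
  ultimately show False using assms(2) vector_derivative_unique_at by blast
qed

text \<open>Boundedness is included because the Lipschitz constant of a product involves bounds of the factors; the
combination is inherited by polynomials.\<close>

definition lipschitz_bounded :: "'a::metric_space set \<Rightarrow> ('a \<Rightarrow> real) \<Rightarrow> bool" where
  "lipschitz_bounded S f \<longleftrightarrow> (\<exists>L. L-lipschitz_on S f) \<and> (\<exists>B. \<forall>x\<in>S. \<bar>f x\<bar> \<le> B)"

lemma lipschitz_bounded_const: "lipschitz_bounded S (\<lambda>_. c)"
  unfolding lipschitz_bounded_def by (auto intro: lipschitz_intros)

lemma lipschitz_bounded_add:
  assumes "lipschitz_bounded S f" "lipschitz_bounded S g"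
  shows "lipschitz_bounded S (\<lambda>x. f x + g x)"
proof -
  obtain A B where "\<forall>x\<in>S. \<bar>f x\<bar> \<le> A" "\<forall>x\<in>S. \<bar>g x\<bar> \<le> B"
    using assms unfolding lipschitz_bounded_def by blast
  then have "\<forall>x\<in>S. \<bar>f x + g x\<bar> \<le> A + B" by fastforce
  moreover obtain L M where "L-lipschitz_on S f" "M-lipschitz_on S g"
    using assms unfolding lipschitz_bounded_def by blast
  then have "(L + M)-lipschitz_on S (\<lambda>x. f x + g x)" by (rule lipschitz_on_add)
  ultimately show ?thesis unfolding lipschitz_bounded_def by blast
qed

lemma lipschitz_bounded_mult:
  assumes "lipschitz_bounded S f" "lipschitz_bounded S g"
  shows "lipschitz_bounded S (\<lambda>x. f x * g x)"
proof -
  obtain A B where A: "\<And>x. x \<in> S \<Longrightarrow> \<bar>f x\<bar> \<le> A" and B: "\<And>x. x \<in> S \<Longrightarrow> \<bar>g x\<bar> \<le> B"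
    using assms unfolding lipschitz_bounded_def by blast
  obtain L M where L: "L-lipschitz_on S f" and M: "M-lipschitz_on S g"
    using assms unfolding lipschitz_bounded_def by blast
  have "\<bar>f x * g x\<bar> \<le> \<bar>A\<bar> * \<bar>B\<bar>" if "x \<in> S" for x
    unfolding abs_mult using A[OF that] B[OF that] by (intro mult_mono) auto
  moreover have "(\<bar>A\<bar> * M + L * \<bar>B\<bar>)-lipschitz_on S (\<lambda>x. f x * g x)"
  proof (rule lipschitz_onI)
    fix x y assume x: "x \<in> S" and y: "y \<in> S"
    have "f x * g x - f y * g y = f x * (g x - g y) + (f x - f y) * g y" by (simp add: algebra_simps)
    then have "\<bar>f x * g x - f y * g y\<bar> \<le> \<bar>f x\<bar> * \<bar>g x - g y\<bar> + \<bar>f x - f y\<bar> * \<bar>g y\<bar>"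
      by (metis abs_mult abs_triangle_ineq)
    also have "\<dots> \<le> \<bar>A\<bar> * (M * dist x y) + (L * dist x y) * \<bar>B\<bar>"
      using A[OF x] B[OF y] lipschitz_onD[OF L x y] lipschitz_onD[OF M x y]
        lipschitz_on_nonneg[OF L] lipschitz_on_nonneg[OF M]
      by (intro add_mono mult_mono) (auto simp: dist_real_def)
    finally show "dist (f x * g x) (f y * g y) \<le> (\<bar>A\<bar> * M + L * \<bar>B\<bar>) * dist x y"
      by (simp add: dist_real_def algebra_simps)
  qed (use lipschitz_on_nonneg[OF L] lipschitz_on_nonneg[OF M] in auto)
  ultimately show ?thesis unfolding lipschitz_bounded_def by blast
qed

lemma lipschitz_bounded_coordinates:
  "lipschitz_bounded (cball (0::real \<times> real) r) fst" "lipschitz_bounded (cball (0::real \<times> real) r) snd"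
proof -
  have "\<bar>fst x\<bar> \<le> r" "\<bar>snd x\<bar> \<le> r" if "x \<in> cball (0::real \<times> real) r" for x
    using that norm_fst_le[of "fst x" "snd x"] norm_snd_le[of "snd x" "fst x"] by auto
  moreover have "1-lipschitz_on (cball (0::real \<times> real) r) fst" "1-lipschitz_on (cball (0::real \<times> real) r) snd"
    by (intro lipschitz_onI; simp only: mult_1 dist_fst_le dist_snd_le zero_le_one)+
  ultimately show "lipschitz_bounded (cball (0::real \<times> real) r) fst"
    "lipschitz_bounded (cball (0::real \<times> real) r) snd"
    unfolding lipschitz_bounded_def by blast+
qed

section \<open>The planar flow of the special states\<close>

text \<open>The equations \<open>2 \<omega>\<^sub>1' = \<omega>\<^sub>2 (\<omega>\<^sub>3 - \<lambda>) + \<beta>\<^sub>3\<close> and \<open>2 \<omega>\<^sub>2' = - \<omega>\<^sub>1 (\<omega>\<^sub>3 - \<lambda>) - \<alpha>\<^sub>3\<close> on the special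
states, divided by \<open>n\<close>.\<close>

definition special_flow :: "real \<Rightarrow> real \<Rightarrow> real \<times> real \<Rightarrow> real \<times> real" where
  "special_flow n R = (\<lambda>(p, q). (q * (n * (p^2 + q^2) + n + R) / 2, - p * (n * (p^2 + q^2) + n - R) / 2))"

lemma special_flow_lipschitz: "\<exists>L. L-lipschitz_on (cball 0 r) (special_flow n R)"
proof -
  have "lipschitz_bounded (cball 0 r)
      (\<lambda>x::real\<times>real. snd x * (n * (fst x * fst x + snd x * snd x) + (n + R)) * (1/2))"
    "lipschitz_bounded (cball 0 r)
      (\<lambda>x::real\<times>real. fst x * (n * (fst x * fst x + snd x * snd x) + (n + - R)) * (-1/2))"
    by (intro lipschitz_bounded_mult lipschitz_bounded_add lipschitz_bounded_const
        lipschitz_bounded_coordinates)+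
  then obtain L M where
    "L-lipschitz_on (cball 0 r)
      (\<lambda>x::real\<times>real. snd x * (n * (fst x * fst x + snd x * snd x) + (n + R)) * (1/2))"
    "M-lipschitz_on (cball 0 r)
      (\<lambda>x::real\<times>real. fst x * (n * (fst x * fst x + snd x * snd x) + (n + - R)) * (-1/2))"
    unfolding lipschitz_bounded_def by blast
  from lipschitz_on_Pair[OF this] show ?thesis
    unfolding special_flow_def case_prod_beta by (auto simp: power2_eq_square add.assoc add_diff_eq)
qed

text \<open>The quartic term \<open>n\<^sup>2 (p\<^sup>2 + q\<^sup>2)\<^sup>2\<close> of the level dominates \<open>2 n R (p\<^sup>2 - q\<^sup>2)\<close>, so level sets are bounded.\<close>

lemma level_bound:
  assumes n: "n \<noteq> 0"
  shows "p^2 + q^2 \<le> 2 * \<bar>R\<bar> / \<bar>n\<bar> + \<bar>level n R p q\<bar> / n^2 + 1"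
proof -
  define V where "V = level n R p q"
  define w where "w = p^2 + q^2"
  define c where "c = 2 * \<bar>R\<bar> / \<bar>n\<bar> + \<bar>V\<bar> / n^2 + 1"
  have c: "c \<ge> 1" by (simp add: c_def)
  have w0: "w \<ge> 0" by (simp add: w_def)
  have "w \<le> c"
  proof (rule ccontr)
    assume "\<not> w \<le> c"
    then have "w > c" "w > 1" using c by auto
    have e: "\<bar>p^2 - q^2\<bar> \<le> w" unfolding w_def by (simp add: abs_le_iff)
    have "n^2 * w^2 = V - 2 * n^2 * w + 2 * n * R * (p^2 - q^2)"
      unfolding V_def level_def w_def by simp
    also have "\<dots> \<le> \<bar>V\<bar> + \<bar>2 * n * R * (p^2 - q^2)\<bar>"
    proof -
      have "0 \<le> 2 * n^2 * w" using w0 by simp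
      then show ?thesis by linarith
    qed
    also have "\<dots> \<le> \<bar>V\<bar> + 2 * \<bar>n\<bar> * \<bar>R\<bar> * w"
      using e by (simp add: abs_mult mult_left_mono)
    also have "\<dots> \<le> \<bar>V\<bar> * w + 2 * \<bar>n\<bar> * \<bar>R\<bar> * w"
      using \<open>w > 1\<close> by (simp add: mult_le_cancel_left1)
    also have "\<dots> = n^2 * (c - 1) * w"
    proof -
      have "n^2 * (c - 1) = \<bar>V\<bar> + 2 * \<bar>n\<bar> * \<bar>R\<bar>"
        unfolding c_def using n by (simp add: field_simps power2_eq_square flip: abs_mult)
      then show ?thesis by (simp add: algebra_simps)
    qed
    finally have "n^2 * (w * w) \<le> n^2 * ((c - 1) * w)" by (simp add: power2_eq_square mult.assoc)
    then have "w * w \<le> (c - 1) * w"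
      by (subst (asm) mult_le_cancel_left_pos) (use n in auto)
    then show False using \<open>w > c\<close> \<open>w > 1\<close> by simp
  qed
  then show ?thesis by (simp add: w_def c_def V_def)
qed

lemma special_flow_solution:
  assumes n: "n \<noteq> 0"
  shows "\<exists>x. x 0 = x0 \<and> (\<forall>t. (x has_vector_derivative special_flow n R (x t)) (at t))"
proof (rule ode_global_solution_conserved[OF special_flow_lipschitz])
  let ?V = "\<lambda>x::real\<times>real. level n R (fst x) (snd x)"
  let ?V' = "\<lambda>(x::real\<times>real) v. 4 * n^2 * (fst x ^ 2 + snd x ^ 2 + 1) * (fst x * fst v + snd x * snd v)
    - 4 * n * R * (fst x * fst v - snd x * snd v)"
  show "(?V has_derivative ?V' x) (at x)" for x
    unfolding level_def
    by (rule has_derivative_eq_rhs, (rule derivative_intros)+) (auto simp: fun_eq_iff algebra_simps power2_eq_square)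
  show "?V' x (special_flow n R x) = 0" for x
    unfolding special_flow_def case_prod_beta by (simp add: field_simps) algebra
  fix x :: "real \<times> real" assume "?V x = ?V x0"
  then have w: "fst x ^ 2 + snd x ^ 2 \<le> 2 * \<bar>R\<bar> / \<bar>n\<bar> + \<bar>?V x0\<bar> / n^2 + 1"
    using level_bound[OF n, of "fst x" "snd x" R] by simp
  have sqrt_le: "sqrt z \<le> z + 1" if "z \<ge> 0" for z
    by (intro real_le_lsqrt) (use that in \<open>auto simp: power2_eq_square algebra_simps\<close>)
  have "norm x = sqrt (fst x ^ 2 + snd x ^ 2)" by (simp add: norm_prod_def)
  also have "\<dots> \<le> (fst x ^ 2 + snd x ^ 2) + 1"
    by (rule sqrt_le) simp
  finally show "norm x \<le> 2 * \<bar>R\<bar> / \<bar>n\<bar> + \<bar>?V x0\<bar> / n^2 + 2" using w by simp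
qed

lemma has_real_derivative_coordinates:
  assumes "(x has_vector_derivative v) (at t)"
  shows "((\<lambda>t. fst (x t)) has_real_derivative fst v) (at t)"
    "((\<lambda>t. snd (x t)) has_real_derivative snd v) (at t)"
  unfolding has_real_derivative_iff_has_vector_derivative
  using bounded_linear.has_vector_derivative[OF bounded_linear_fst assms]
    bounded_linear.has_vector_derivative[OF bounded_linear_snd assms] by simp_all

lemma special_state_vectors:
  "special_state lam n R p q = (vector [n * p, n * q, n * (p^2 + q^2)],
     vector [(lam + n - R) * ((n + R - n * (p^2 - q^2)) / 2), (lam + n - R) * (- n * p * q), (lam + n - R) * (n * p)],
     vector [(lam + n + R) * (- n * p * q), (lam + n + R) * ((n - R + n * (p^2 - q^2)) / 2), (lam + n + R) * (n * q)])"
  by (simp add: special_state_def vec_eq_iff forall_3)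

text \<open>The family is invariant under the equations of motion: a polynomial identity in
\<open>\<lambda>, n, R, p, q\<close>, which are free because the constraints only express \<open>a\<close> and \<open>b\<close> through them.\<close>

lemma special_state_flow:
  assumes x: "(x has_vector_derivative special_flow n R (x t)) (at t)"
  shows "((\<lambda>t. special_state lam n R (fst (x t)) (snd (x t))) has_vector_derivative
    gyro_field lam (special_state lam n R (fst (x t)) (snd (x t)))) (at t)"
proof -
  define p q where "p = (\<lambda>t. fst (x t))" and "q = (\<lambda>t. snd (x t))"
  define dp dq where "dp = q t * (n * (p t ^ 2 + q t ^ 2) + n + R) / 2"
    and "dq = - p t * (n * (p t ^ 2 + q t ^ 2) + n - R) / 2"
  have p: "(p has_real_derivative dp) (at t)" and q: "(q has_real_derivative dq) (at t)"
    using has_real_derivative_coordinates[OF x]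
    by (simp_all add: p_def q_def dp_def dq_def special_flow_def case_prod_beta)
  have field: "gyro_field lam (special_state lam n R (p t) (q t)) =
      (vector [n * dp, n * dq, n * (2 * p t * dp + 2 * q t * dq)],
       vector [(lam + n - R) * (- n * (2 * p t * dp - 2 * q t * dq) / 2), (lam + n - R) * (- n * (dp * q t + p t * dq)),
         (lam + n - R) * (n * dp)],
       vector [(lam + n + R) * (- n * (dp * q t + p t * dq)), (lam + n + R) * (n * (2 * p t * dp - 2 * q t * dq) / 2),
         (lam + n + R) * (n * dq)])"
    unfolding special_state_vectors gyro_field_def prod.case cross3_def vector_3 dp_def dq_def
    by (simp only: prod.inject vec_eq_iff forall_3 vector_3, intro conjI; simp add: field_simps; algebra)
  show ?thesis
    unfolding p_def[symmetric] q_def[symmetric]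
    unfolding fun_cong[OF p_def, symmetric] fun_cong[OF q_def, symmetric] field
    unfolding special_state_vectors
    by (intro has_vector_derivative_Pair has_vector_derivative_vector_3)
       (rule derivative_eq_intros p q refl | simp add: field_simps)+
qed

context special_family
begin

text \<open>Along the planar flow \<open>w' = 2 n\<^sup>2 R p q\<close>, while \<open>P\<^sub>\<plusminus>(w) = 2 n\<^sup>3 R ((p\<^sup>2 - q\<^sup>2) \<plusminus> (p\<^sup>2 + q\<^sup>2))\<close>. The product
\<open>P\<^sub>+ P\<^sub>-\<close> is therefore \<open>- 16 n\<^sup>6 R\<^sup>2 p\<^sup>2 q\<^sup>2\<close>.\<close>

lemma special_point_deriv:
  assumes x: "\<And>t. (x has_vector_derivative special_flow n R (x t)) (at t)"
    and \<gamma>: "\<And>t. \<gamma> t = special_state lam n R (fst (x t)) (snd (x t))" and P: "\<gamma> t \<in> P6 a b"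
  shows "(deriv (\<lambda>s. ww (\<gamma> s)) t)^2
    = - (lam^2 / (4 * \<sigma>^2)) * Ppm 1 a b lam \<sigma> u (ww (\<gamma> t)) * Ppm (- 1) a b lam \<sigma> u (ww (\<gamma> t))"
proof -
  define p q where "p = fst (x t)" and "q = snd (x t)"
  define w where "w = n^2 * (p^2 + q^2)"
  have ww: "ww (\<gamma> s) = n^2 * (fst (x s) ^ 2 + snd (x s) ^ 2)" for s
    unfolding \<gamma> by (simp add: ww_def w1_def w2_def special_state_def power2_eq_square algebra_simps)
  have "((\<lambda>s. ww (\<gamma> s)) has_real_derivative 2 * n^2 * p * q * R) (at t)"
    unfolding ww p_def q_def
    by (rule derivative_eq_intros has_real_derivative_coordinates[OF x] refl)+
       (simp add: special_flow_def case_prod_beta field_simps power2_eq_square)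
  then have "deriv (\<lambda>s. ww (\<gamma> s)) t = 2 * n^2 * p * q * R" by (rule DERIV_imp_deriv)
  moreover have Ppm: "Ppm s a b lam \<sigma> u w = 2 * n^3 * R * ((p^2 - q^2) + s * (p^2 + q^2))" if "s = 1 \<or> s = -1" for s
  proof -
    have r: "a^2 - b^2 \<noteq> 0" using rr_pp_squares(3)[OF ab] by simp
    have "2 * \<sigma>^2 * ((u + s * (a^2 - b^2) * lam^2) / (lam^2 * u)) * w = 2 * n^2 * w + 2 * n * R * s * w"
      unfolding u_def using r lam n R by (simp add: field_simps power2_eq_square)
    moreover have "const_coeff a b lam \<sigma> u = - (n^2 * level n R p q)"
      by (rule const_coeff_special) (use P in \<open>simp add: \<gamma> p_def q_def\<close>)
    ultimately show ?thesis
      unfolding Ppm_def rr_pp_squares(1)[OF ab] level_def w_def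
      by (simp add: algebra_simps power_numeral_reduce)
  qed
  moreover have "ww (\<gamma> t) = w" by (simp add: ww w_def p_def q_def)
  ultimately show ?thesis
    using lam n Ppm[of 1] Ppm[of "-1"] by (simp add: field_simps power_numeral_reduce)
qed

lemma special_motion_through:
  assumes P: "special_state lam n R p0 q0 \<in> P6 a b" and nz: "p0^2 + q0^2 \<noteq> 0"
  shows "\<exists>\<gamma>. special_motion a b lam \<gamma> \<and> \<gamma> 0 = special_state lam n R p0 q0"
proof -
  obtain x where x0: "x 0 = (p0, q0)" and x: "\<And>t. (x has_vector_derivative special_flow n R (x t)) (at t)"
    using special_flow_solution[OF n, of "(p0, q0)" R] by blast
  define \<gamma> where "\<gamma> t = special_state lam n R (fst (x t)) (snd (x t))" for t
  have "motion a b lam \<gamma>"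
    by (rule motionI) (use special_state_flow[OF x] P x0 in \<open>simp_all add: \<gamma>_def[abs_def]\<close>)
  then have inP: "\<gamma> t \<in> P6 a b" for t by (simp add: motion_def)
  \<comment> \<open>The origin is an equilibrium of the planar flow, so uniqueness keeps other solutions away from it.\<close>
  have nz': "fst (x t) ^ 2 + snd (x t) ^ 2 \<noteq> 0" for t
  proof
    assume "fst (x t) ^ 2 + snd (x t) ^ 2 = 0"
    then have "x t = (0, 0)" by (simp add: sum_power2_eq_zero_iff prod_eq_iff)
    moreover have "special_flow n R (0, 0) = 0" by (simp add: special_flow_def zero_prod_def)
    then have "((\<lambda>_. (0, 0)) has_vector_derivative special_flow n R (0, 0)) (at t)" for t
      by simp
    ultimately have "x 0 = (0, 0)"
      using ode_unique[where x=x and y="\<lambda>_. (0, 0)" and ?t0.0=t and t=0, OF special_flow_lipschitz x] by simp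
    then show False using x0 nz by simp
  qed
  have "special_motion a b lam \<gamma>"
    unfolding special_motion_def
  proof (rule conjI, fact, rule exI[of _ \<sigma>], rule exI[of _ u], intro conjI allI)
    show "\<sigma> \<noteq> 0" using lam n by simp
    show "u \<noteq> 0" by (rule u_nonzero)
    show "on_curve a b lam \<sigma> u" by (rule on_curve_special[OF P])
    show "\<exists>k. special_point a b lam \<sigma> u k (\<gamma> t)" for t
      using special_point_special_state inP nz' unfolding \<gamma>_def by blast
    show "(deriv (\<lambda>s. ww (\<gamma> s)) t)^2
      = - (lam^2 / (4 * \<sigma>^2)) * Ppm 1 a b lam \<sigma> u (ww (\<gamma> t)) * Ppm (- 1) a b lam \<sigma> u (ww (\<gamma> t))" for t
      by (rule special_point_deriv[OF x \<gamma>_def inP])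
  qed
  then show ?thesis using x0 by (auto simp: \<gamma>_def)
qed

end

section \<open>Special motions are periodic or separatrices\<close>

lemma planar_solution_of_special_motion:
  assumes m: "special_motion a b lam \<gamma>" and ab: "a > b" "b > 0" and lam: "lam \<noteq> 0"
  shows "\<exists>n R x. special_family a b lam n R \<and>
    (\<forall>t. \<gamma> t = special_state lam n R (fst (x t)) (snd (x t))
       \<and> (x has_vector_derivative special_flow n R (x t)) (at t))"
proof -
  from m obtain \<sigma> u where mot: "motion a b lam \<gamma>" and \<sigma>: "\<sigma> \<noteq> 0" and u: "u \<noteq> 0"
    and sp: "\<And>t. \<exists>k. special_point a b lam \<sigma> u k (\<gamma> t)"
    unfolding special_motion_def by blast
  define n where "n = \<sigma> / lam"
  define R where "R = (a^2 - b^2) * lam * \<sigma> / u"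
  have fam: "special_family a b lam n R"
    using ab lam \<sigma> u rr_pp_squares(3)[OF ab] by unfold_locales (auto simp: n_def R_def)
  have n: "n \<noteq> 0" using \<sigma> lam by (simp add: n_def)
  define x where "x t = (fst (\<gamma> t) $ 1 / n, fst (\<gamma> t) $ 2 / n)" for t
  have \<gamma>: "\<gamma> t = special_state lam n R (fst (x t)) (snd (x t))" for t
  proof -
    obtain k where "special_point a b lam \<sigma> u k (\<gamma> t)" using sp by blast
    then obtain p q where pq: "\<gamma> t = special_state lam n R p q"
      unfolding n_def R_def by (rule special_state_if_special_point[OF _ ab lam \<sigma> u])
    then have "x t = (p, q)" using n by (simp add: x_def special_state_def)
    then show ?thesis using pq by simp
  qed
  have "(x has_vector_derivative special_flow n R (x t)) (at t)" for t
  proof -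
    define p q where "p = fst (x t)" and "q = snd (x t)"
    have "(\<gamma> has_vector_derivative gyro_field lam (\<gamma> t)) (at t)"
      using mot by (simp add: motion_def)
    note d = gyro_field_coordinates(1,2)[OF this[unfolded \<gamma>[of t] special_state_vectors], unfolded vector_3,
        folded p_def q_def]
    have "((\<lambda>t. (fst (\<gamma> t) $ 1 / n, fst (\<gamma> t) $ 2 / n)) has_vector_derivative special_flow n R (p, q)) (at t)"
      unfolding special_flow_def prod.case
      by (intro has_vector_derivative_Pair;
          unfold has_real_derivative_iff_has_vector_derivative[symmetric];
          rule DERIV_cong[OF DERIV_cdivide[OF d(1)]] DERIV_cong[OF DERIV_cdivide[OF d(2)]])
         (use n in \<open>simp_all add: field_simps\<close>)
    then show ?thesis unfolding x_def[abs_def] by (simp add: p_def q_def x_def)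
  qed
  with fam \<gamma> show ?thesis by blast
qed

text \<open>The planar flow is reversed by \<open>(p, q) \<mapsto> (- p, q)\<close> (for \<open>e = -1\<close>) and by \<open>(p, q) \<mapsto> (p, - q)\<close> (for \<open>e = 1\<close>).
At a time when the solution is fixed by one of them, uniqueness turns the reversal into a symmetry of
the solution.\<close>

lemma special_flow_reflection:
  assumes x: "\<And>t. (x has_vector_derivative special_flow n R (x t)) (at t)" and e: "e * e = 1"
    and fixed: "x t0 = (e * fst (x t0), - e * snd (x t0))"
  shows "x (2 * t0 - t) = (e * fst (x t), - e * snd (x t))"
proof -
  let ?y = "\<lambda>t. (e * fst (x (2 * t0 - t)), - e * snd (x (2 * t0 - t)))"
  have "(?y has_vector_derivative special_flow n R (?y s)) (at s)" for s
  proof -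
    have sq: "(e * z)^2 = z^2" "(- e * z)^2 = z^2" for z
      using e by (simp_all add: power2_eq_square algebra_simps)
    note d = has_real_derivative_coordinates[OF time_reversed_solution[where x=x and c="2 * t0" and t=s, OF x]]
    have "(?y has_vector_derivative (e * fst (- special_flow n R (x (2 * t0 - s))),
        - e * snd (- special_flow n R (x (2 * t0 - s))))) (at s)"
      by (intro has_vector_derivative_Pair;
          simp only: has_real_derivative_iff_has_vector_derivative[symmetric];
          intro DERIV_cmult d)
    also have "(e * fst (- special_flow n R (x (2 * t0 - s))), - e * snd (- special_flow n R (x (2 * t0 - s))))
        = special_flow n R (?y s)"
      unfolding special_flow_def case_prod_beta fst_conv snd_conv sq by (simp add: field_simps)
    finally show ?thesis .
  qed
  then have "x t = ?y t"
    using ode_unique[where x=x and y="?y" and ?t0.0=t0 and t=t, OF special_flow_lipschitz x] fixed by simp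
  then have "fst (x t) = e * fst (x (2 * t0 - t))" "snd (x t) = - e * snd (x (2 * t0 - t))"
    by (metis fst_conv, metis snd_conv)
  then show ?thesis
    using e by (simp add: prod_eq_iff flip: mult.assoc)
qed

text \<open>As long as \<open>p q \<noteq> 0\<close> the function \<open>p\<^sup>2 + q\<^sup>2\<close> is monotone, and it is bounded on the level set. The level
then determines the limit of \<open>p\<^sup>2 - q\<^sup>2\<close>, and \<open>p\<close> and \<open>q\<close> keep their signs. The factor \<open>k\<close> is left free to
cover the reversed flow.\<close>

lemma special_flow_convergent:
  fixes p q :: "real \<Rightarrow> real"
  assumes cont: "continuous_on UNIV p" "continuous_on UNIV q"
    and d: "\<And>t. ((\<lambda>t. p t ^ 2 + q t ^ 2) has_real_derivative k * (p t * q t)) (at t)" and k: "k \<noteq> 0"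
    and lev: "\<And>t. level n R (p t) (q t) = V" and n: "n \<noteq> 0" and R: "R \<noteq> 0"
    and nz: "\<And>t. t \<ge> c \<Longrightarrow> p t * q t \<noteq> 0"
  shows "\<exists>P Q. (p \<longlongrightarrow> P) at_top \<and> (q \<longlongrightarrow> Q) at_top"
proof -
  have "\<bar>p t ^ 2 + q t ^ 2\<bar> \<le> 2 * \<bar>R\<bar> / \<bar>n\<bar> + \<bar>V\<bar> / n^2 + 1" for t
    using level_bound[OF n, of "p t" "q t" R] lev by simp
  then obtain l where l: "((\<lambda>t. p t ^ 2 + q t ^ 2) \<longlongrightarrow> l) at_top"
    using k nz by (rule_tac convergent_if_derivative_nonzero[OF d, of c])
      (auto intro!: continuous_intros cont)
  have e: "p t ^ 2 - q t ^ 2 = (n^2 * (p t ^ 2 + q t ^ 2)^2 + 2 * n^2 * (p t ^ 2 + q t ^ 2) - V) / (2 * n * R)" for t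
    using lev[of t] n R unfolding level_def by (simp add: field_simps)
  define l' where "l' = (n^2 * l^2 + 2 * n^2 * l - V) / (2 * n * R)"
  have l': "((\<lambda>t. p t ^ 2 - q t ^ 2) \<longlongrightarrow> l') at_top"
    unfolding e l'_def using n R by (intro tendsto_intros l) auto
  have "((\<lambda>t. ((p t ^ 2 + q t ^ 2) + (p t ^ 2 - q t ^ 2)) / 2) \<longlongrightarrow> (l + l') / 2) at_top"
    "((\<lambda>t. ((p t ^ 2 + q t ^ 2) - (p t ^ 2 - q t ^ 2)) / 2) \<longlongrightarrow> (l - l') / 2) at_top"
    by (intro tendsto_intros l l'; simp)+
  then have "((\<lambda>t. p t ^ 2) \<longlongrightarrow> (l + l') / 2) at_top" "((\<lambda>t. q t ^ 2) \<longlongrightarrow> (l - l') / 2) at_top"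
    by simp_all
  then show ?thesis
    using convergent_if_square_convergent[OF cont(1), of c] convergent_if_square_convergent[OF cont(2), of c] nz
    by (metis mult_zero_left mult_zero_right)
qed

lemma tendsto_special_state:
  assumes "(p \<longlongrightarrow> P) F" "(q \<longlongrightarrow> Q) F"
  shows "((\<lambda>t. special_state lam n R (p t) (q t)) \<longlongrightarrow> special_state lam n R P Q) F"
  unfolding special_state_vectors using assms by (intro tendsto_Pair tendsto_vector_3 tendsto_intros) auto

lemma equilibrium_special_state:
  assumes "gyro_field lam (special_state lam n R p q) = 0" "special_state lam n R p q \<in> P6 a b"
    and "a > 0" "b > 0" and n: "n \<noteq> 0"
  shows "p = 0" "q = 0"
proof -
  have "vector [n * p, n * q, n * (p^2 + q^2)] = (0 :: real^3)"
    using assms(1,2) unfolding special_state_vectors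
    by (subst (asm) equilibrium_iff[OF _ assms(3,4)]) auto
  then show "p = 0" "q = 0" using n by (auto simp: vec_eq_iff forall_3)
qed

text \<open>Both limits of a motion that does not return are equilibria in the family, that is, the state
with \<open>p = q = 0\<close>, which depends on the parameters \<open>n\<close> and \<open>R\<close> only.\<close>

lemma special_motion_periodic_or_separatrix:
  assumes m: "special_motion a b lam \<gamma>" and ab: "a > b" "b > 0" and lam: "lam \<noteq> 0"
  shows "periodic \<gamma> \<or> separatrix lam \<gamma>"
proof -
  obtain n R x where fam: "special_family a b lam n R"
    and \<gamma>: "\<And>t. \<gamma> t = special_state lam n R (fst (x t)) (snd (x t))"
    and x: "\<And>t. (x has_vector_derivative special_flow n R (x t)) (at t)"
    using planar_solution_of_special_motion[OF assms] by blast
  interpret special_family a b lam n R by (rule fam)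
  have a0: "a > 0" using ab by simp
  have mot: "motion a b lam \<gamma>" using m by (simp add: special_motion_def)
  then have inP: "special_state lam n R (fst (x t)) (snd (x t)) \<in> P6 a b" for t
    using \<gamma> by (metis motion_def)
  define p q where "p t = fst (x t)" and "q t = snd (x t)" for t
  note d = has_real_derivative_coordinates[OF x, folded p_def q_def]
  have cont: "continuous_on UNIV p" "continuous_on UNIV q"
    using d DERIV_isCont unfolding p_def[abs_def] q_def[abs_def] by (blast intro: continuous_at_imp_continuous_on)+
  show ?thesis
  proof (cases "\<exists>t0 t1. t0 < t1 \<and> p t0 * q t0 = 0 \<and> p t1 * q t1 = 0")
    case True
    then obtain t0 t1 where t: "t0 < t1" "p t0 * q t0 = 0" "p t1 * q t1 = 0" by blast
    have refl: "\<exists>e. e * e = 1 \<and> (\<forall>t. x (2 * s - t) = (e * fst (x t), - e * snd (x t)))"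
      if "p s * q s = 0" for s
    proof (cases "p s = 0")
      case True
      then have "x s = (- 1 * fst (x s), - (- 1) * snd (x s))" by (simp add: p_def prod_eq_iff)
      from special_flow_reflection[OF x _ this] show ?thesis by (intro exI[of _ "-1"]) simp
    next
      case False
      then have "x s = (1 * fst (x s), - 1 * snd (x s))" using that by (simp add: q_def prod_eq_iff)
      from special_flow_reflection[OF x _ this] show ?thesis by (intro exI[of _ "1"]) simp
    qed
    obtain e0 where e0: "e0 * e0 = 1" "\<And>t. x (2 * t0 - t) = (e0 * fst (x t), - e0 * snd (x t))"
      using refl[OF t(2)] by blast
    obtain e1 where e1: "e1 * e1 = 1" "\<And>t. x (2 * t1 - t) = (e1 * fst (x t), - e1 * snd (x t))"
      using refl[OF t(3)] by blast
    have shift: "x (t + 2 * (t1 - t0)) = (e1 * e0 * fst (x t), e1 * e0 * snd (x t))" for t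
      using e1(2)[of "2 * t0 - t"] e0(2)[of t] by (simp add: algebra_simps)
    \<comment> \<open>The two reflections commute and are involutions, so twice the shift is the identity. A single shift
      is not, if they differ.\<close>
    have "x (t + 4 * (t1 - t0)) = x t" for t
    proof -
      have "x (t + 4 * (t1 - t0)) = x ((t + 2 * (t1 - t0)) + 2 * (t1 - t0))"
        by (simp add: algebra_simps)
      also have "\<dots> = ((e1 * e1) * (e0 * e0) * fst (x t), (e1 * e1) * (e0 * e0) * snd (x t))"
        unfolding shift by (simp add: algebra_simps)
      finally show ?thesis using e0(1) e1(1) by simp
    qed
    then have "\<gamma> (t + 4 * (t1 - t0)) = \<gamma> t" for t by (simp add: \<gamma>)
    then have "periodic \<gamma>"
      unfolding periodic_def using t(1) by (intro exI[of _ "4 * (t1 - t0)"]) simp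
    then show ?thesis by simp
  next
    case False
    have "\<exists>c. \<forall>t. \<bar>t\<bar> \<ge> c \<longrightarrow> p t * q t \<noteq> 0"
    proof (cases "\<exists>s. p s * q s = 0")
      case True
      then obtain s where "p s * q s = 0" by blast
      then have "p t * q t \<noteq> 0" if "\<bar>t\<bar> \<ge> \<bar>s\<bar> + 1" for t
        using False that by (cases t s rule: linorder_cases) auto
      then show ?thesis by blast
    qed auto
    then obtain c where c: "\<And>t. \<bar>t\<bar> \<ge> c \<Longrightarrow> p t * q t \<noteq> 0" by blast
    have nzc: "p t * q t \<noteq> 0" "p (0 - t) * q (0 - t) \<noteq> 0" if "t \<ge> \<bar>c\<bar>" for t
      using c[of t] c[of "0 - t"] that by auto
    define V where "V = level n R (p 0) (q 0)"
    have lev: "level n R (p t) (q t) = V" for t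
    proof -
      \<comment> \<open>The sum of the squared lengths of the fields is an affine function of the level with this
        positive slope (up to the factor 2).\<close>
      have "((lam + n)^2 + R^2) * level n R (p t) (q t) = ((lam + n)^2 + R^2) * V"
        using special_state_P6(2)[OF inP[of t]] special_state_P6(2)[OF inP[of 0]]
        unfolding V_def p_def q_def by (simp add: algebra_simps)
      moreover have "(lam + n)^2 + R^2 \<noteq> 0" using R by (simp add: sum_power2_eq_zero_iff)
      ultimately show ?thesis by (simp only: mult_cancel_left) simp
    qed
    have dw: "((\<lambda>t. p t ^ 2 + q t ^ 2) has_real_derivative (2 * R) * (p t * q t)) (at t)" for t
      by (rule derivative_eq_intros d refl)+
         (simp add: special_flow_def case_prod_beta field_simps power2_eq_square p_def q_def)
    have dw': "((\<lambda>t. p (0 - t) ^ 2 + q (0 - t) ^ 2) has_real_derivative (- 2 * R) * (p (0 - t) * q (0 - t))) (at t)" for t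
    proof -
      have "((\<lambda>t. 0 - t) has_real_derivative - 1) (at t)" by (auto intro!: derivative_eq_intros)
      from DERIV_chain2[where f="\<lambda>t. p t ^ 2 + q t ^ 2" and g="\<lambda>t. 0 - t", OF dw this]
      show ?thesis by simp
    qed
    obtain P Q where "(p \<longlongrightarrow> P) at_top" "(q \<longlongrightarrow> Q) at_top"
      using special_flow_convergent[where c="\<bar>c\<bar>", OF cont dw _ lev n R] nzc(1) R by auto
    then have lim: "(\<gamma> \<longlongrightarrow> special_state lam n R P Q) at_top"
      unfolding \<gamma>[abs_def] p_def[abs_def] q_def[abs_def] by (rule tendsto_special_state)
    have cont': "continuous_on UNIV (\<lambda>t. p (0 - t))" "continuous_on UNIV (\<lambda>t. q (0 - t))"
      by (intro continuous_on_compose2[OF cont(1)] continuous_on_compose2[OF cont(2)] continuous_intros; simp)+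
    obtain P' Q' where "((\<lambda>t. p (0 - t)) \<longlongrightarrow> P') at_top" "((\<lambda>t. q (0 - t)) \<longlongrightarrow> Q') at_top"
      using special_flow_convergent[where c="\<bar>c\<bar>", OF cont' dw' _ lev n R] nzc(2) R by auto
    then have lim': "((\<lambda>t. \<gamma> (0 - t)) \<longlongrightarrow> special_state lam n R P' Q') at_top"
      unfolding \<gamma> p_def[abs_def] q_def[abs_def] by (rule tendsto_special_state)
    have "P = 0" "Q = 0"
      using equilibrium_special_state[OF limit_of_motion[OF mot lim] a0 ab(2) n] by auto
    moreover have "P' = 0" "Q' = 0"
      using equilibrium_special_state[OF limit_of_motion_at_bot[OF mot lim'] a0 ab(2) n] by auto
    ultimately have "separatrix lam \<gamma>"
      unfolding separatrix_def using lim lim' limit_of_motion(1)[OF mot lim]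
      by (intro exI[of _ "special_state lam n R 0 0"]) (auto simp: filterlim_at_bot_mirror)
    then show ?thesis by simp
  qed
qed

section \<open>Pendulum motions\<close>

text \<open>If \<open>\<omega>\<close> is vertical and the fields are horizontal, \<open>K\<close> is critical: its \<open>\<lambda>\<close>-part is of second order in the
vanishing coordinates, and the rest, \<open>x\<^sub>1 x\<^sub>2\<close>, is invariant under rotations about the vertical axis. The
factor between \<open>dG\<close> and \<open>dH\<close> is the vertical component of \<open>\<alpha> \<times> \<beta>\<close>, equal to \<open>\<plusminus> a b\<close>.\<close>

lemma planar_point_dK_dG:
  assumes P: "(\<omega>, \<alpha>, \<beta>) \<in> P6 a b" and "a > 0" "b > 0"
    and z: "\<omega>$1 = 0" "\<omega>$2 = 0" "\<alpha>$3 = 0" "\<beta>$3 = 0" and v: "v \<in> tangent (\<omega>, \<alpha>, \<beta>)"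
  shows "dK lam (\<omega>, \<alpha>, \<beta>) v = 0"
    "dG a b lam (\<omega>, \<alpha>, \<beta>) v = (\<alpha>$1 * \<beta>$2 - \<beta>$1 * \<alpha>$2) * dH (\<omega>, \<alpha>, \<beta>) v"
proof -
  obtain \<delta> \<theta> where v: "v = variation (\<omega>, \<alpha>, \<beta>) \<delta> \<theta>"
    using v tangent_eq_variations[OF assms(1-3)] by auto
  have P': "(\<alpha>$1)^2 + (\<alpha>$2)^2 = a^2" "(\<beta>$1)^2 + (\<beta>$2)^2 = b^2" "\<alpha>$1 * \<beta>$1 + \<alpha>$2 * \<beta>$2 = 0"
    using P z unfolding P6_coordinates by simp_all
  show "dK lam (\<omega>, \<alpha>, \<beta>) v = 0"
    unfolding v dK_variation z by simp
  have "b^2 * \<alpha>$2 - a^2 * \<beta>$1 = (\<alpha>$1 * \<beta>$2 - \<beta>$1 * \<alpha>$2) * (\<alpha>$2 - \<beta>$1)"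
    using P'(3) unfolding P'(1,2)[symmetric] by algebra
  then have "2 * dG a b lam (\<omega>, \<alpha>, \<beta>) v
      = 2 * ((\<alpha>$1 * \<beta>$2 - \<beta>$1 * \<alpha>$2) * dH (\<omega>, \<alpha>, \<beta>) v)"
    unfolding v dG_variation dH_variation z cross_components by simp algebra
  then show "dG a b lam (\<omega>, \<alpha>, \<beta>) v = (\<alpha>$1 * \<beta>$2 - \<beta>$1 * \<alpha>$2) * dH (\<omega>, \<alpha>, \<beta>) v"
    by simp
qed

text \<open>The position is given by independent numbers \<open>c\<close>, \<open>d\<close> in place of the cosine and sine of the angle, because
limits of motions are described without a limit of the angle itself.\<close>

definition pendulum_state :: "real \<Rightarrow> real \<Rightarrow> real \<Rightarrow> real \<Rightarrow> real \<Rightarrow> real \<Rightarrow> state" where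
  "pendulum_state a b s c d \<psi> =
     (vector [0, 0, \<psi>], vector [a * c, - (a * d), 0], vector [s * b * d, s * b * c, 0])"

lemma pendulum_state_axes:
  "pendulum_state a b s c d \<psi> =
     (\<psi> *\<^sub>R e3, a *\<^sub>R (c *\<^sub>R e1 - d *\<^sub>R e2), (s * b) *\<^sub>R (d *\<^sub>R e1 + c *\<^sub>R e2))"
  by (simp add: pendulum_state_def vec_eq_iff forall_3 axis_def)

lemma planar_point_is_pendulum_state:
  assumes P: "(\<omega>, \<alpha>, \<beta>) \<in> P6 a b" and a: "a > 0" and b: "b > 0"
    and z: "\<omega>$1 = 0" "\<omega>$2 = 0" "\<alpha>$3 = 0" "\<beta>$3 = 0"
  shows "\<exists>s\<in>{1, -1}. \<exists>\<phi>. (\<omega>, \<alpha>, \<beta>) = pendulum_state a b s (cos \<phi>) (sin \<phi>) (\<omega>$3)"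
proof -
  have P': "(\<alpha>$1)^2 + (\<alpha>$2)^2 = a^2" "(\<beta>$1)^2 + (\<beta>$2)^2 = b^2" "\<alpha>$1 * \<beta>$1 + \<alpha>$2 * \<beta>$2 = 0"
    using P z unfolding P6_coordinates by simp_all
  have "(\<alpha>$1 / a)^2 + (- \<alpha>$2 / a)^2 = 1"
    using P'(1) a by (simp add: power_divide flip: add_divide_distrib)
  then obtain \<phi> where \<phi>: "\<alpha>$1 / a = cos \<phi>" "- \<alpha>$2 / a = sin \<phi>"
    using sincos_total_2pi by metis
  then have \<alpha>: "\<alpha>$1 = a * cos \<phi>" "\<alpha>$2 = - (a * sin \<phi>)" using a by (auto simp: field_simps)
  define k where "k = \<beta>$1 * sin \<phi> + \<beta>$2 * cos \<phi>"
  have sc: "(sin \<phi>)^2 + (cos \<phi>)^2 = 1" by simp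
  have orth: "\<beta>$1 * cos \<phi> = \<beta>$2 * sin \<phi>" using P'(3) a unfolding \<alpha> by (simp add: algebra_simps)
  have \<beta>: "\<beta>$1 = k * sin \<phi>" "\<beta>$2 = k * cos \<phi>"
    using sc orth unfolding k_def by algebra+
  have "k^2 = b^2" using P'(2) sc unfolding \<beta> by algebra
  then have "k = b \<or> k = - b" by (simp add: power2_eq_iff)
  then have "\<exists>s\<in>{1, -1}. k = s * b" by auto
  then obtain s where s: "s \<in> {1, -1}" "k = s * b" by blast
  have "(\<omega>, \<alpha>, \<beta>) = pendulum_state a b s (cos \<phi>) (sin \<phi>) (\<omega>$3)"
    by (simp add: pendulum_state_def vec_eq_iff forall_3 z \<alpha> \<beta> s(2))
  then show ?thesis using s(1) by blast
qed

definition pendulum_flow :: "real \<Rightarrow> real \<times> real \<Rightarrow> real \<times> real" where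
  "pendulum_flow k = (\<lambda>(\<phi>, \<psi>). (\<psi>, - k * sin \<phi>))"

lemma pendulum_flow_lipschitz: "\<exists>L. L-lipschitz_on UNIV (pendulum_flow k)"
proof -
  have sin: "\<bar>sin x - sin y\<bar> \<le> \<bar>x - y\<bar>" for x y :: real
  proof -
    have "\<bar>sin x - sin y\<bar> = 2 * \<bar>sin ((x - y) / 2)\<bar> * \<bar>cos ((x + y) / 2)\<bar>"
      by (simp add: sin_diff_sin abs_mult)
    also have "\<dots> \<le> 2 * \<bar>(x - y) / 2\<bar> * 1"
      by (intro mult_mono abs_sin_x_le_abs_x) auto
    finally show ?thesis by simp
  qed
  have "1-lipschitz_on UNIV (\<lambda>x::real\<times>real. snd x)"
    by (intro lipschitz_onI; simp only: mult_1 dist_snd_le zero_le_one)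
  moreover have "\<bar>k\<bar>-lipschitz_on UNIV (\<lambda>x::real\<times>real. - k * sin (fst x))"
  proof (rule lipschitz_onI)
    fix x y :: "real \<times> real"
    have "dist (- k * sin (fst x)) (- k * sin (fst y)) = \<bar>k\<bar> * \<bar>sin (fst x) - sin (fst y)\<bar>"
      by (simp add: dist_real_def abs_mult[symmetric] algebra_simps abs_minus_commute)
    also have "\<dots> \<le> \<bar>k\<bar> * dist (fst x) (fst y)"
      using sin by (simp add: dist_real_def mult_left_mono)
    also have "\<dots> \<le> \<bar>k\<bar> * dist x y" by (intro mult_left_mono dist_fst_le) simp
    finally show "dist (- k * sin (fst x)) (- k * sin (fst y)) \<le> \<bar>k\<bar> * dist x y" .
  qed simp
  ultimately show ?thesis
    unfolding pendulum_flow_def case_prod_beta using lipschitz_on_Pair by blast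
qed

lemma pendulum_flow_locally_lipschitz: "\<exists>L. L-lipschitz_on (cball 0 r) (pendulum_flow k)"
  using pendulum_flow_lipschitz lipschitz_on_subset by blast

lemma has_vector_derivative_planar:
  fixes x :: "real \<Rightarrow> real \<times> real"
  shows "(x has_vector_derivative v) (at t) \<longleftrightarrow>
    ((\<lambda>t. fst (x t)) has_real_derivative fst v) (at t) \<and> ((\<lambda>t. snd (x t)) has_real_derivative snd v) (at t)"
proof
  assume "((\<lambda>t. fst (x t)) has_real_derivative fst v) (at t) \<and> ((\<lambda>t. snd (x t)) has_real_derivative snd v) (at t)"
  then have "((\<lambda>t. (fst (x t), snd (x t))) has_vector_derivative (fst v, snd v)) (at t)"
    unfolding has_real_derivative_iff_has_vector_derivative by (intro has_vector_derivative_Pair) auto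
  then show "(x has_vector_derivative v) (at t)" by simp
qed (auto intro: has_real_derivative_coordinates)

lemma pendulum_state_flow:
  assumes x: "(x has_vector_derivative pendulum_flow (a + s * b) (x t)) (at t)"
  shows "((\<lambda>t. pendulum_state a b s (cos (fst (x t))) (sin (fst (x t))) (snd (x t))) has_vector_derivative
    gyro_field lam (pendulum_state a b s (cos (fst (x t))) (sin (fst (x t))) (snd (x t)))) (at t)"
proof -
  define \<phi> \<psi> where "\<phi> = (\<lambda>t. fst (x t))" and "\<psi> = (\<lambda>t. snd (x t))"
  have d: "(\<phi> has_real_derivative \<psi> t) (at t)" "(\<psi> has_real_derivative - (a + s * b) * sin (\<phi> t)) (at t)"
    using x unfolding has_vector_derivative_planar
    by (simp_all add: pendulum_flow_def case_prod_beta \<phi>_def \<psi>_def)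
  have field: "gyro_field lam (pendulum_state a b s (cos (\<phi> t)) (sin (\<phi> t)) (\<psi> t)) =
      (vector [0, 0, - (a + s * b) * sin (\<phi> t)],
       vector [- a * sin (\<phi> t) * \<psi> t, - a * cos (\<phi> t) * \<psi> t, 0],
       vector [s * b * cos (\<phi> t) * \<psi> t, - s * b * sin (\<phi> t) * \<psi> t, 0])"
    by (simp add: gyro_field_def pendulum_state_def cross3_def vec_eq_iff forall_3 algebra_simps)
  show ?thesis
    unfolding fun_cong[OF \<phi>_def, symmetric] fun_cong[OF \<psi>_def, symmetric] field
    unfolding pendulum_state_def
    by (intro has_vector_derivative_Pair has_vector_derivative_vector_3)
       (rule derivative_eq_intros d refl | simp)+
qed

lemma pendulum_motion_iff:
  "pendulum_motion a b lam \<gamma> \<longleftrightarrow> motion a b lam \<gamma> \<and> (\<exists>s\<in>{1, -1}. \<exists>x. \<forall>t.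
     (x has_vector_derivative pendulum_flow (a + s * b) (x t)) (at t) \<and>
     \<gamma> t = pendulum_state a b s (cos (fst (x t))) (sin (fst (x t))) (snd (x t)))"
    (is "?L \<longleftrightarrow> ?R")
proof
  assume ?L
  then obtain s \<phi> \<phi>' where m: "motion a b lam \<gamma>" and s: "s \<in> {1, -1}" and
    "\<forall>t. (\<phi> has_real_derivative \<phi>' t) (at t) \<and>
        (\<phi>' has_real_derivative - (a + s * b) * sin (\<phi> t)) (at t) \<and>
        (case \<gamma> t of (\<omega>, \<alpha>, \<beta>) \<Rightarrow>
           \<omega> = \<phi>' t *\<^sub>R e3 \<and>
           \<alpha> \<times> \<beta> = (s * (a * b)) *\<^sub>R e3 \<and>
           \<alpha> = a *\<^sub>R (cos (\<phi> t) *\<^sub>R e1 - sin (\<phi> t) *\<^sub>R e2) \<and>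
           \<beta> = (s * b) *\<^sub>R (sin (\<phi> t) *\<^sub>R e1 + cos (\<phi> t) *\<^sub>R e2))"
    unfolding pendulum_motion_def by blast
  then have "((\<lambda>t. (\<phi> t, \<phi>' t)) has_vector_derivative pendulum_flow (a + s * b) (\<phi> t, \<phi>' t)) (at t)"
    "\<gamma> t = pendulum_state a b s (cos (\<phi> t)) (sin (\<phi> t)) (\<phi>' t)" for t
    unfolding has_vector_derivative_planar pendulum_state_axes
    by (auto simp: pendulum_flow_def case_prod_beta prod_eq_iff)
  then show ?R using m s by (intro conjI bexI[of _ s] exI[of _ "\<lambda>t. (\<phi> t, \<phi>' t)"]) auto
next
  assume ?R
  then obtain s x where m: "motion a b lam \<gamma>" and s: "s \<in> {1, -1}"
    and x: "\<And>t. (x has_vector_derivative pendulum_flow (a + s * b) (x t)) (at t)"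
    and \<gamma>: "\<And>t. \<gamma> t = pendulum_state a b s (cos (fst (x t))) (sin (fst (x t))) (snd (x t))" by blast
  have cross: "(a *\<^sub>R (cos \<phi> *\<^sub>R e1 - sin \<phi> *\<^sub>R e2)) \<times> ((s * b) *\<^sub>R (sin \<phi> *\<^sub>R e1 + cos \<phi> *\<^sub>R e2))
      = (s * (a * b)) *\<^sub>R e3" for \<phi>
  proof -
    have "a * cos \<phi> * (s * b * cos \<phi>) + a * sin \<phi> * (s * b * sin \<phi>) = s * (a * b) * ((cos \<phi>)^2 + (sin \<phi>)^2)"
      by algebra
    then show ?thesis
      by (simp add: vec_eq_iff forall_3 cross_components axis_def algebra_simps)
  qed
  show ?L
    unfolding pendulum_motion_def
  proof (rule conjI, rule m, rule bexI[OF _ s], rule exI[of _ "\<lambda>t. fst (x t)"],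
      rule exI[of _ "\<lambda>t. snd (x t)"], intro conjI allI)
    fix t
    show "((\<lambda>t. fst (x t)) has_real_derivative snd (x t)) (at t)"
      "((\<lambda>t. snd (x t)) has_real_derivative - (a + s * b) * sin (fst (x t))) (at t)"
      using x unfolding has_vector_derivative_planar by (simp_all add: pendulum_flow_def case_prod_beta)
    show "case \<gamma> t of (\<omega>, \<alpha>, \<beta>) \<Rightarrow>
           \<omega> = snd (x t) *\<^sub>R e3 \<and>
           \<alpha> \<times> \<beta> = (s * (a * b)) *\<^sub>R e3 \<and>
           \<alpha> = a *\<^sub>R (cos (fst (x t)) *\<^sub>R e1 - sin (fst (x t)) *\<^sub>R e2) \<and>
           \<beta> = (s * b) *\<^sub>R (sin (fst (x t)) *\<^sub>R e1 + cos (fst (x t)) *\<^sub>R e2)"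
      unfolding \<gamma> pendulum_state_axes prod.case by (intro conjI refl cross)
  qed
qed

lemma pendulum_motion_through:
  assumes P: "pendulum_state a b s (cos \<phi>) (sin \<phi>) \<psi> \<in> P6 a b" and s: "s \<in> {1, -1}"
  shows "\<exists>\<gamma>. pendulum_motion a b lam \<gamma> \<and> \<gamma> 0 = pendulum_state a b s (cos \<phi>) (sin \<phi>) \<psi>"
proof -
  obtain L where "L-lipschitz_on UNIV (pendulum_flow (a + s * b))" using pendulum_flow_lipschitz by blast
  from lipschitz_ode_global_solution[OF this, of "(\<phi>, \<psi>)"]
  obtain x where x0: "x 0 = (\<phi>, \<psi>)"
    and x: "\<And>t. (x has_vector_derivative pendulum_flow (a + s * b) (x t)) (at t)" by blast
  define \<gamma> where "\<gamma> t = pendulum_state a b s (cos (fst (x t))) (sin (fst (x t))) (snd (x t))" for t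
  have "motion a b lam \<gamma>"
    by (rule motionI) (use pendulum_state_flow[OF x] P x0 in \<open>simp_all add: \<gamma>_def[abs_def]\<close>)
  then have "pendulum_motion a b lam \<gamma>"
    unfolding pendulum_motion_iff using s x \<gamma>_def by blast
  then show ?thesis using x0 by (auto simp: \<gamma>_def)
qed

lemma equilibrium_pendulum_state:
  assumes "gyro_field lam (pendulum_state a b s c d \<psi>) = 0" "pendulum_state a b s c d \<psi> \<in> P6 a b"
    and ab: "a > b" "b > 0" and s: "s \<in> {1, -1}"
  shows "d = 0" "\<psi> = 0"
proof -
  have "vector [0, 0, \<psi>] = (0 :: real^3)" "- (a * d) = s * b * d"
    using assms(1,2) ab unfolding pendulum_state_def
    by (subst (asm) equilibrium_iff[where a=a and b=b]; simp)+
  then have "\<psi> = 0" "(a + s * b) * d = 0" by (auto simp: vec_eq_iff forall_3 algebra_simps)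
  moreover have "a + s * b \<noteq> 0" using ab s by auto
  ultimately show "d = 0" "\<psi> = 0" by auto
qed

text \<open>The flow is reversed by the reflection of the angle at a multiple of \<open>\<pi>\<close>. The state depends on the angle
modulo \<open>2 \<pi>\<close> only, and so two reflections, at whatever multiples, compose to a period.\<close>

lemma pendulum_flow_reflection:
  assumes x: "\<And>t. (x has_vector_derivative pendulum_flow k (x t)) (at t)" and s0: "sin (fst (x t0)) = 0"
  shows "x (2 * t0 - t) = (2 * fst (x t0) - fst (x t), snd (x t))"
proof -
  let ?y = "\<lambda>t. (2 * fst (x t0) - fst (x (2 * t0 - t)), snd (x (2 * t0 - t)))"
  have twice: "sin (2 * fst (x t0)) = 0" "cos (2 * fst (x t0)) = 1"
    using s0 by (simp_all add: sin_double cos_double_sin)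
  have "(?y has_vector_derivative pendulum_flow k (?y r)) (at r)" for r
    using time_reversed_solution[where x=x and c="2 * t0" and t=r, OF x]
    unfolding has_vector_derivative_planar
    by (auto intro!: derivative_eq_intros simp: pendulum_flow_def case_prod_beta sin_diff twice)
  then have y: "x t = ?y t" for t
    using ode_unique[where x=x and y="?y" and ?t0.0=t0 and t=t, OF pendulum_flow_locally_lipschitz x] by simp
  have "x (2 * t0 - t) = ?y (2 * t0 - t)" by (rule y)
  then show ?thesis by simp
qed

text \<open>As long as \<open>sin \<phi> \<noteq> 0\<close> the velocity \<open>\<psi>\<close> is monotone, and the energy bounds it. The energy then gives the
limit of \<open>cos \<phi>\<close>, hence of \<open>(sin \<phi>)\<^sup>2\<close>, and \<open>sin \<phi>\<close> keeps its sign.\<close>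

lemma pendulum_flow_convergent:
  fixes \<phi> \<psi> :: "real \<Rightarrow> real"
  assumes cont: "continuous_on UNIV \<phi>" and d: "\<And>t. (\<psi> has_real_derivative l * sin (\<phi> t)) (at t)"
    and E: "\<And>t. \<psi> t ^ 2 / 2 - k * cos (\<phi> t) = E" and l: "l \<noteq> 0" and k: "k \<noteq> 0"
    and nz: "\<And>t. t \<ge> c \<Longrightarrow> sin (\<phi> t) \<noteq> 0"
  shows "\<exists>C S Y. ((\<lambda>t. cos (\<phi> t)) \<longlongrightarrow> C) at_top \<and> ((\<lambda>t. sin (\<phi> t)) \<longlongrightarrow> S) at_top \<and> (\<psi> \<longlongrightarrow> Y) at_top"
proof -
  have "\<bar>\<psi> t\<bar> \<le> 2 * (\<bar>E\<bar> + \<bar>k\<bar>) + 1" for t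
  proof -
    have "\<bar>k * cos (\<phi> t)\<bar> \<le> \<bar>k\<bar> * 1" unfolding abs_mult by (intro mult_left_mono) auto
    then have "\<psi> t ^ 2 \<le> 2 * (\<bar>E\<bar> + \<bar>k\<bar>)" using E[of t] by (simp add: abs_le_iff) linarith
    moreover have "\<bar>\<psi> t\<bar> \<le> \<psi> t ^ 2 + 1"
      using zero_le_power2[of "\<bar>\<psi> t\<bar> - 1"] by (simp add: power2_diff)
    ultimately show ?thesis by simp
  qed
  then obtain Y where Y: "(\<psi> \<longlongrightarrow> Y) at_top"
    using l nz by (rule_tac convergent_if_derivative_nonzero[OF d, of c])
      (auto intro!: continuous_intros cont)
  have "cos (\<phi> t) = (\<psi> t ^ 2 / 2 - E) / k" for t using E[of t] k by (simp add: field_simps)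
  then have C: "((\<lambda>t. cos (\<phi> t)) \<longlongrightarrow> (Y ^ 2 / 2 - E) / k) at_top"
    using k by (auto intro!: tendsto_intros Y)
  have "(sin (\<phi> t))\<^sup>2 = 1 - (cos (\<phi> t))\<^sup>2" for t by (simp add: sin_squared_eq)
  then have "((\<lambda>t. (sin (\<phi> t))\<^sup>2) \<longlongrightarrow> 1 - ((Y ^ 2 / 2 - E) / k)\<^sup>2) at_top"
    by (auto intro!: tendsto_intros C)
  then obtain S where "((\<lambda>t. sin (\<phi> t)) \<longlongrightarrow> S) at_top"
    using nz by (rule_tac convergent_if_square_convergent[of "\<lambda>t. sin (\<phi> t)" c])
      (auto intro!: continuous_intros cont)
  with C Y show ?thesis by blast
qed

lemma pendulum_flow_energy:
  assumes x: "\<And>t. (x has_vector_derivative pendulum_flow k (x t)) (at t)"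
  shows "snd (x t) ^ 2 / 2 - k * cos (fst (x t)) = snd (x 0) ^ 2 / 2 - k * cos (fst (x 0))"
proof -
  have "((\<lambda>t. snd (x t) ^ 2 / 2 - k * cos (fst (x t))) has_real_derivative 0) (at t)" for t
    using x[of t] unfolding has_vector_derivative_planar
    by (auto intro!: derivative_eq_intros simp: pendulum_flow_def case_prod_beta)
  then show ?thesis using DERIV_isconst_all[of "\<lambda>t. snd (x t) ^ 2 / 2 - k * cos (fst (x t))" t 0] by blast
qed

lemma tendsto_pendulum_state:
  assumes "(f \<longlongrightarrow> C) F" "(g \<longlongrightarrow> S) F" "(h \<longlongrightarrow> Y) F"
  shows "((\<lambda>t. pendulum_state a b s (f t) (g t) (h t)) \<longlongrightarrow> pendulum_state a b s C S Y) F"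
  unfolding pendulum_state_def using assms by (intro tendsto_Pair tendsto_vector_3 tendsto_intros)

text \<open>At an equilibrium \<open>\<psi> = 0\<close> and \<open>sin \<phi> = 0\<close>, and the energy fixes \<open>cos \<phi>\<close>; so both ends of a motion
that does not return are at the same equilibrium.\<close>

lemma pendulum_motion_periodic_or_separatrix:
  assumes m: "pendulum_motion a b lam \<gamma>" and ab: "a > b" "b > 0"
  shows "periodic \<gamma> \<or> separatrix lam \<gamma>"
proof -
  obtain s x where mot: "motion a b lam \<gamma>" and s: "s \<in> {1, -1}"
    and x: "\<And>t. (x has_vector_derivative pendulum_flow (a + s * b) (x t)) (at t)"
    and \<gamma>: "\<And>t. \<gamma> t = pendulum_state a b s (cos (fst (x t))) (sin (fst (x t))) (snd (x t))"
    using m unfolding pendulum_motion_iff by blast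
  define k where "k = a + s * b"
  have k: "k \<noteq> 0" using ab s by (auto simp: k_def)
  define \<phi> \<psi> where "\<phi> t = fst (x t)" and "\<psi> t = snd (x t)" for t
  have d: "(\<phi> has_real_derivative \<psi> t) (at t)" "(\<psi> has_real_derivative - k * sin (\<phi> t)) (at t)" for t
    using x[of t] unfolding has_vector_derivative_planar
    by (simp_all add: pendulum_flow_def case_prod_beta \<phi>_def[abs_def] \<psi>_def[abs_def] k_def)
  have cont: "continuous_on UNIV \<phi>"
    using d(1) DERIV_isCont by (blast intro: continuous_at_imp_continuous_on)
  show ?thesis
  proof (cases "\<exists>t0 t1. t0 < t1 \<and> sin (\<phi> t0) = 0 \<and> sin (\<phi> t1) = 0")
    case True
    then obtain t0 t1 where t: "t0 < t1" "sin (\<phi> t0) = 0" "sin (\<phi> t1) = 0" by blast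
    note r0 = pendulum_flow_reflection[OF x t(2)[unfolded \<phi>_def]]
      and r1 = pendulum_flow_reflection[OF x t(3)[unfolded \<phi>_def]]
    have "x (t + 2 * (t1 - t0)) = (2 * \<phi> t1 - (2 * \<phi> t0 - \<phi> t), \<psi> t)" for t
      using r1[of "2 * t0 - t"] r0[of t] by (simp add: algebra_simps \<phi>_def \<psi>_def)
    moreover have "sin (2 * \<phi> t0) = 0" "cos (2 * \<phi> t0) = 1" "sin (2 * \<phi> t1) = 0" "cos (2 * \<phi> t1) = 1"
      using t(2,3) by (simp_all add: sin_double cos_double_sin)
    ultimately have "\<gamma> (t + 2 * (t1 - t0)) = \<gamma> t" for t
      unfolding \<gamma> by (simp add: sin_diff cos_diff \<phi>_def \<psi>_def)
    then have "periodic \<gamma>"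
      unfolding periodic_def using t(1) by (intro exI[of _ "2 * (t1 - t0)"]) simp
    then show ?thesis by simp
  next
    case False
    have "\<exists>c. \<forall>t. \<bar>t\<bar> \<ge> c \<longrightarrow> sin (\<phi> t) \<noteq> 0"
    proof (cases "\<exists>r. sin (\<phi> r) = 0")
      case True
      then obtain r where "sin (\<phi> r) = 0" by blast
      then have "sin (\<phi> t) \<noteq> 0" if "\<bar>t\<bar> \<ge> \<bar>r\<bar> + 1" for t
        using False that by (cases t r rule: linorder_cases) auto
      then show ?thesis by blast
    qed auto
    then obtain c where c: "\<And>t. \<bar>t\<bar> \<ge> c \<Longrightarrow> sin (\<phi> t) \<noteq> 0" by blast
    have nzc: "sin (\<phi> t) \<noteq> 0" "sin (\<phi> (0 - t)) \<noteq> 0" if "t \<ge> \<bar>c\<bar>" for t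
      using c[of t] c[of "0 - t"] that by auto
    define E where "E = \<psi> 0 ^ 2 / 2 - k * cos (\<phi> 0)"
    have E: "\<psi> t ^ 2 / 2 - k * cos (\<phi> t) = E" for t
      using pendulum_flow_energy[OF x, of t] by (simp add: E_def \<phi>_def \<psi>_def k_def)
    have limit: "S = 0 \<and> Y = 0 \<and> C = - E / k"
      if "gyro_field lam (pendulum_state a b s C S Y) = 0" "pendulum_state a b s C S Y \<in> P6 a b"
        "((\<lambda>t. cos (\<phi> (g t))) \<longlongrightarrow> C) at_top" "((\<lambda>t. \<psi> (g t)) \<longlongrightarrow> Y) at_top" for C S Y and g :: "real \<Rightarrow> real"
    proof -
      have SY: "S = 0" "Y = 0" using equilibrium_pendulum_state[OF that(1,2) ab s] by auto
      have "((\<lambda>t. \<psi> (g t) ^ 2 / 2 - k * cos (\<phi> (g t))) \<longlongrightarrow> Y ^ 2 / 2 - k * C) at_top"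
        by (intro tendsto_intros that) simp
      then have "((\<lambda>t. E) \<longlongrightarrow> Y ^ 2 / 2 - k * C) (at_top :: real filter)" unfolding E .
      then have "E = Y ^ 2 / 2 - k * C"
        by (rule tendsto_unique[OF trivial_limit_at_top_linorder tendsto_const])
      then show ?thesis using SY k by (simp add: field_simps)
    qed
    obtain C S Y where lims: "((\<lambda>t. cos (\<phi> t)) \<longlongrightarrow> C) at_top" "((\<lambda>t. sin (\<phi> t)) \<longlongrightarrow> S) at_top" "(\<psi> \<longlongrightarrow> Y) at_top"
      using pendulum_flow_convergent[where c="\<bar>c\<bar>", OF cont d(2) E _ k] nzc(1) k by auto
    then have lim: "(\<gamma> \<longlongrightarrow> pendulum_state a b s C S Y) at_top"
      unfolding \<gamma>[abs_def] \<phi>_def[abs_def] \<psi>_def[abs_def] by (rule tendsto_pendulum_state)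
    have cont': "continuous_on UNIV (\<lambda>t. \<phi> (0 - t))"
      by (intro continuous_on_compose2[OF cont] continuous_intros; simp)
    have d': "((\<lambda>t. \<psi> (0 - t)) has_real_derivative k * sin (\<phi> (0 - t))) (at t)" for t
    proof -
      have "((\<lambda>t. 0 - t) has_real_derivative - 1) (at t)" by (auto intro!: derivative_eq_intros)
      from DERIV_chain2[where f=\<psi> and g="\<lambda>t. 0 - t", OF d(2) this] show ?thesis by simp
    qed
    obtain C' S' Y' where lims': "((\<lambda>t. cos (\<phi> (0 - t))) \<longlongrightarrow> C') at_top" "((\<lambda>t. sin (\<phi> (0 - t))) \<longlongrightarrow> S') at_top"
        "((\<lambda>t. \<psi> (0 - t)) \<longlongrightarrow> Y') at_top"
      using pendulum_flow_convergent[where c="\<bar>c\<bar>", OF cont' d' E k k] nzc(2) by auto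
    then have lim': "((\<lambda>t. \<gamma> (0 - t)) \<longlongrightarrow> pendulum_state a b s C' S' Y') at_top"
      unfolding \<gamma> \<phi>_def[abs_def] \<psi>_def[abs_def] by (rule tendsto_pendulum_state)
    have "S = 0 \<and> Y = 0 \<and> C = - E / k"
      using limit[OF limit_of_motion[OF mot lim], of "\<lambda>t. t"] lims by simp
    moreover have "S' = 0 \<and> Y' = 0 \<and> C' = - E / k"
      using limit[OF limit_of_motion_at_bot[OF mot lim'], of "\<lambda>t. 0 - t"] lims' by simp
    ultimately have "separatrix lam \<gamma>"
      unfolding separatrix_def using lim lim' limit_of_motion(1)[OF mot lim]
      by (intro exI[of _ "pendulum_state a b s (- E / k) 0 0"]) (auto simp: filterlim_at_bot_mirror)
    then show ?thesis by simp
  qed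
qed

text \<open>By uniqueness, a pendulum that rests at an equilibrium at one time rests there forever.\<close>

lemma pendulum_motion_avoids_equilibria:
  assumes m: "pendulum_motion a b lam \<gamma>" and ab: "a > b" "b > 0" and nc: "\<not> \<gamma> constant_on UNIV"
  shows "gyro_field lam (\<gamma> t) \<noteq> 0"
proof
  assume eq: "gyro_field lam (\<gamma> t) = 0"
  obtain s x where mot: "motion a b lam \<gamma>" and s: "s \<in> {1, -1}"
    and x: "\<And>t. (x has_vector_derivative pendulum_flow (a + s * b) (x t)) (at t)"
    and \<gamma>: "\<And>t. \<gamma> t = pendulum_state a b s (cos (fst (x t))) (sin (fst (x t))) (snd (x t))"
    using m unfolding pendulum_motion_iff by blast
  have "\<gamma> t \<in> P6 a b" using mot by (simp add: motion_def)
  then have "sin (fst (x t)) = 0" "snd (x t) = 0"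
    using equilibrium_pendulum_state[of lam a b s] eq ab s unfolding \<gamma> by blast+
  then have "pendulum_flow (a + s * b) (x t) = 0"
    by (simp add: pendulum_flow_def case_prod_beta zero_prod_def)
  then have "((\<lambda>_. x t) has_vector_derivative pendulum_flow (a + s * b) (x t)) (at r)" for r
    by simp
  then have const: "x r = x t" for r
    using ode_unique[where x=x and y="\<lambda>_. x t" and ?t0.0=t and t=r, OF pendulum_flow_locally_lipschitz x] by simp
  have "\<gamma> r = \<gamma> t" for r unfolding \<gamma> const[of r] by (rule refl)
  then show False using nc unfolding constant_on_def by blast
qed

section \<open>The critical set\<close>

text \<open>An equilibrium is in particular a position of the pendulum.\<close>

lemma dK_dG_vanish_if_dH_vanishes:
  assumes P: "\<zeta> \<in> P6 a b" and a: "a > 0" and b: "b > 0" and H: "\<forall>v\<in>tangent \<zeta>. dH \<zeta> v = 0"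
  shows "\<forall>v\<in>tangent \<zeta>. dK lam \<zeta> v = 0" "\<forall>v\<in>tangent \<zeta>. dG a b lam \<zeta> v = 0"
proof -
  obtain \<omega> \<alpha> \<beta> where \<zeta>: "\<zeta> = (\<omega>, \<alpha>, \<beta>)" by (cases \<zeta>) auto
  have z: "\<omega>$1 = 0" "\<omega>$2 = 0" "\<alpha>$3 = 0" "\<beta>$3 = 0"
    using H dH_vanishes_iff[OF P[unfolded \<zeta>] a b] unfolding \<zeta> by auto
  show "\<forall>v\<in>tangent \<zeta>. dK lam \<zeta> v = 0" "\<forall>v\<in>tangent \<zeta>. dG a b lam \<zeta> v = 0"
    using planar_point_dK_dG[OF P[unfolded \<zeta>] a b z] H unfolding \<zeta> by auto
qed

lemma rank_KH_eq_1_iff: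
  assumes P: "\<zeta> \<in> P6 a b" and a: "a > 0" and b: "b > 0"
  shows "rank_KH lam \<zeta> = 1 \<longleftrightarrow>
    (\<exists>v\<in>tangent \<zeta>. dH \<zeta> v \<noteq> 0) \<and> (\<exists>\<mu>. \<forall>v\<in>tangent \<zeta>. dK lam \<zeta> v = \<mu> * dH \<zeta> v)"
  unfolding rank_KH_def frechet_derivatives
  by (rule rank_on_pair_eq_1_iff) (rule dK_dG_vanish_if_dH_vanishes(1)[OF assms])

lemma rank_J_eq_1_iff:
  assumes P: "\<zeta> \<in> P6 a b" and a: "a > 0" and b: "b > 0"
  shows "rank_J a b lam \<zeta> = 1 \<longleftrightarrow>
    (\<exists>v\<in>tangent \<zeta>. dH \<zeta> v \<noteq> 0) \<and> (\<exists>\<mu>. \<forall>v\<in>tangent \<zeta>. dK lam \<zeta> v = \<mu> * dH \<zeta> v)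
      \<and> (\<exists>\<nu>. \<forall>v\<in>tangent \<zeta>. dG a b lam \<zeta> v = \<nu> * dH \<zeta> v)"
  unfolding rank_J_def frechet_derivatives
  by (rule dim_image_triple_eq_1_iff) (intro conjI dK_dG_vanish_if_dH_vanishes[OF assms])

lemma equilibrium_iff_dH_vanishes:
  assumes P: "\<zeta> \<in> P6 a b" and a: "a > 0" and b: "b > 0"
  shows "gyro_field lam \<zeta> = 0 \<longleftrightarrow> (\<forall>v\<in>tangent \<zeta>. dH \<zeta> v = 0)"
proof -
  obtain \<omega> \<alpha> \<beta> where \<zeta>: "\<zeta> = (\<omega>, \<alpha>, \<beta>)" by (cases \<zeta>) auto
  have "\<omega> = 0 \<longleftrightarrow> \<omega>$1 = 0 \<and> \<omega>$2 = 0 \<and> \<omega>$3 = 0" by (simp add: vec_eq_iff forall_3)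
  then show ?thesis
    unfolding \<zeta> equilibrium_iff[OF P[unfolded \<zeta>] a b] dH_vanishes_iff[OF P[unfolded \<zeta>] a b] by blast
qed

text \<open>The motion is constructed from the planar solution with the initial values given by the point. It is not
constant, because a critical point is not an equilibrium.\<close>

lemma motion_through_critical_point:
  assumes P: "\<zeta> \<in> P6 a b" and ab: "a > b" "b > 0" and lam: "lam \<noteq> 0" and KH: "rank_KH lam \<zeta> = 1"
  shows "\<exists>\<gamma>. (pendulum_motion a b lam \<gamma> \<or> special_motion a b lam \<gamma>) \<and> \<not> \<gamma> constant_on UNIV \<and> \<gamma> 0 = \<zeta>"
proof -
  have a: "a > 0" using ab by simp
  obtain \<omega> \<alpha> \<beta> where \<zeta>: "\<zeta> = (\<omega>, \<alpha>, \<beta>)" by (cases \<zeta>) auto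
  note P' = P[unfolded \<zeta>]
  from KH obtain \<mu> where \<mu>: "\<forall>v\<in>tangent \<zeta>. dK lam \<zeta> v = \<mu> * dH \<zeta> v"
    and ne: "gyro_field lam \<zeta> \<noteq> 0"
    unfolding rank_KH_eq_1_iff[OF P a ab(2)] equilibrium_iff_dH_vanishes[OF P a ab(2)] by blast
  then have crit: "\<forall>v\<in>tangent (\<omega>, \<alpha>, \<beta>). dK lam (\<omega>, \<alpha>, \<beta>) v = 2 * (\<mu> / 2) * dH (\<omega>, \<alpha>, \<beta>) v"
    unfolding \<zeta> by simp
  have "\<exists>\<gamma>. (pendulum_motion a b lam \<gamma> \<or> special_motion a b lam \<gamma>) \<and> \<gamma> 0 = \<zeta>"
  proof (cases "\<omega>$1 = 0 \<and> \<omega>$2 = 0")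
    case True
    then have "lam * \<alpha>$3 = 0" "lam * \<beta>$3 = 0"
      using crit unfolding dK_proportional_dH_iff[OF P' a ab(2)] by simp_all
    then have "\<alpha>$3 = 0" "\<beta>$3 = 0" using lam by simp_all
    then obtain s \<phi> where s: "s \<in> {1, -1}" and "(\<omega>, \<alpha>, \<beta>) = pendulum_state a b s (cos \<phi>) (sin \<phi>) (\<omega>$3)"
      using planar_point_is_pendulum_state[OF P' a ab(2)] True by blast
    then show ?thesis
      using pendulum_motion_through[OF _ s, of a b \<phi> "\<omega>$3" lam] P' unfolding \<zeta> by metis
  next
    case False
    then obtain n R p q where n: "n \<noteq> 0" and R: "R \<noteq> 0" and S: "(\<omega>, \<alpha>, \<beta>) = special_state lam n R p q"
      using special_state_if_critical[OF P' ab lam crit] by blast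
    interpret special_family a b lam n R using ab lam n R by unfold_locales
    have "\<omega>$1 = n * p" "\<omega>$2 = n * q" using S unfolding special_state_def by simp_all
    then have "p^2 + q^2 \<noteq> 0" using False by (auto simp: sum_power2_eq_zero_iff)
    then show ?thesis using special_motion_through[of p q] P' S unfolding \<zeta> by metis
  qed
  then obtain \<gamma> where \<gamma>: "pendulum_motion a b lam \<gamma> \<or> special_motion a b lam \<gamma>" "\<gamma> 0 = \<zeta>" by blast
  then have "motion a b lam \<gamma>" unfolding pendulum_motion_def special_motion_def by blast
  then have "\<not> \<gamma> constant_on UNIV"
    by (rule nonconstant_if_not_equilibrium[where t=0]) (use ne \<gamma> in simp)
  then show ?thesis using \<gamma> by blast
qed

lemma rank_J_on_pendulum_motion:
  assumes m: "pendulum_motion a b lam \<gamma>" and ab: "a > b" "b > 0" and nc: "\<not> \<gamma> constant_on UNIV"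
  shows "rank_J a b lam (\<gamma> t) = 1"
proof -
  have a: "a > 0" using ab by simp
  obtain s x where mot: "motion a b lam \<gamma>"
    and \<gamma>: "\<And>t. \<gamma> t = pendulum_state a b s (cos (fst (x t))) (sin (fst (x t))) (snd (x t))"
    using m unfolding pendulum_motion_iff by blast
  have P: "\<gamma> t \<in> P6 a b" using mot by (simp add: motion_def)
  have "\<exists>v\<in>tangent (\<gamma> t). dH (\<gamma> t) v \<noteq> 0"
    using pendulum_motion_avoids_equilibria[OF m ab nc] equilibrium_iff_dH_vanishes[OF P a ab(2)] by blast
  moreover have "\<exists>\<mu>. \<forall>v\<in>tangent (\<gamma> t). dK lam (\<gamma> t) v = \<mu> * dH (\<gamma> t) v"
    "\<exists>\<nu>. \<forall>v\<in>tangent (\<gamma> t). dG a b lam (\<gamma> t) v = \<nu> * dH (\<gamma> t) v"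
    using planar_point_dK_dG[OF P[unfolded \<gamma> pendulum_state_def] a ab(2), of _ lam]
    unfolding \<gamma> pendulum_state_def by (auto intro!: exI[of _ 0])
  ultimately show ?thesis unfolding rank_J_eq_1_iff[OF P a ab(2)] by blast
qed

text \<open>A special motion has \<open>w > 0\<close>, whereas \<open>\<omega> = 0\<close> at every equilibrium.\<close>

lemma rank_J_on_special_motion:
  assumes m: "special_motion a b lam \<gamma>" and ab: "a > b" "b > 0" and lam: "lam \<noteq> 0"
  shows "rank_J a b lam (\<gamma> t) = 1"
proof -
  have a: "a > 0" using ab by simp
  obtain n R x where fam: "special_family a b lam n R"
    and \<gamma>: "\<gamma> t = special_state lam n R (fst (x t)) (snd (x t))"
    using planar_solution_of_special_motion[OF assms] by blast
  interpret special_family a b lam n R by (rule fam)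
  have P: "\<gamma> t \<in> P6 a b" using m by (simp add: special_motion_def motion_def)
  have "ww (\<gamma> t) > 0" using m unfolding special_motion_def special_point_def Let_def by blast
  then have "gyro_field lam (\<gamma> t) \<noteq> 0"
    using equilibrium_special_state[OF _ P[unfolded \<gamma>] a ab(2) n] unfolding \<gamma>
    by (auto simp: ww_def w1_def w2_def special_state_def)
  then have "\<exists>v\<in>tangent (\<gamma> t). dH (\<gamma> t) v \<noteq> 0"
    unfolding equilibrium_iff_dH_vanishes[OF P a ab(2)] by blast
  moreover have "\<exists>\<mu>. \<forall>v\<in>tangent (\<gamma> t). dK lam (\<gamma> t) v = \<mu> * dH (\<gamma> t) v"
    using special_state_dK[OF P[unfolded \<gamma>] a ab(2) lam] unfolding \<gamma> by blast
  moreover have "\<exists>\<nu>. \<forall>v\<in>tangent (\<gamma> t). dG a b lam (\<gamma> t) v = \<nu> * dH (\<gamma> t) v"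
    using special_state_dG[OF P[unfolded \<gamma>] a ab(2)] unfolding \<gamma> .
  ultimately show ?thesis unfolding rank_J_eq_1_iff[OF P a ab(2)] by blast
qed

theorem proposition2:
  fixes a b lam :: real
  assumes "a > b" and "b > 0" and "lam \<noteq> 0"
  shows "critical_set_1 a b lam = {\<zeta> \<in> P6 a b. rank_KH lam \<zeta> = 1}
    \<and> critical_set_1 a b lam =
        (\<Union>\<gamma> \<in> {\<gamma>. (pendulum_motion a b lam \<gamma> \<or> special_motion a b lam \<gamma>)
                  \<and> \<not> \<gamma> constant_on UNIV}. range \<gamma>)
    \<and> (\<forall>\<gamma>. (pendulum_motion a b lam \<gamma> \<or> special_motion a b lam \<gamma>)
            \<and> \<not> \<gamma> constant_on UNIV \<longrightarrow> periodic \<gamma> \<or> separatrix lam \<gamma>)"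
proof -
  let ?M = "{\<gamma>. (pendulum_motion a b lam \<gamma> \<or> special_motion a b lam \<gamma>) \<and> \<not> \<gamma> constant_on UNIV}"
  have a: "a > 0" using assms by simp
  have J_KH: "critical_set_1 a b lam \<subseteq> {\<zeta> \<in> P6 a b. rank_KH lam \<zeta> = 1}"
    unfolding critical_set_1_def using rank_J_eq_1_iff[OF _ a assms(2)] rank_KH_eq_1_iff[OF _ a assms(2)] by auto
  have KH_M: "{\<zeta> \<in> P6 a b. rank_KH lam \<zeta> = 1} \<subseteq> (\<Union>\<gamma>\<in>?M. range \<gamma>)"
  proof
    fix \<zeta> assume "\<zeta> \<in> {\<zeta> \<in> P6 a b. rank_KH lam \<zeta> = 1}"
    then obtain \<gamma> where "\<gamma> \<in> ?M" "\<gamma> 0 = \<zeta>"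
      using motion_through_critical_point[OF _ assms, of \<zeta>] by blast
    then show "\<zeta> \<in> (\<Union>\<gamma>\<in>?M. range \<gamma>)" by blast
  qed
  have M_J: "(\<Union>\<gamma>\<in>?M. range \<gamma>) \<subseteq> critical_set_1 a b lam"
  proof
    fix \<zeta> assume "\<zeta> \<in> (\<Union>\<gamma>\<in>?M. range \<gamma>)"
    then obtain \<gamma> t where \<gamma>: "pendulum_motion a b lam \<gamma> \<or> special_motion a b lam \<gamma>"
        "\<not> \<gamma> constant_on UNIV" and \<zeta>: "\<zeta> = \<gamma> t" by blast
    then have "motion a b lam \<gamma>" unfolding pendulum_motion_def special_motion_def by blast
    then have "\<zeta> \<in> P6 a b" unfolding \<zeta> motion_def by blast
    moreover have "rank_J a b lam \<zeta> = 1"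
      unfolding \<zeta> using \<gamma> rank_J_on_pendulum_motion rank_J_on_special_motion assms by blast
    ultimately show "\<zeta> \<in> critical_set_1 a b lam" by (simp add: critical_set_1_def)
  qed
  have "periodic \<gamma> \<or> separatrix lam \<gamma>" if "pendulum_motion a b lam \<gamma> \<or> special_motion a b lam \<gamma>" for \<gamma>
    using that pendulum_motion_periodic_or_separatrix special_motion_periodic_or_separatrix assms by blast
  with J_KH KH_M M_J show ?thesis by blast
qed

end
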